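(* Suppose that $0<s\le1$ and let $g$ be an analytic function in $\mathbb{D}$. For $1<p<\infty$ let $p'$ be defined by $\frac1p+\frac1{p'}=1$. Then: (i) $T_g$ maps $B^1$ into $Q_s$ if and only if $g\in Q_s$. (ii) If $1<p<\infty$, $0<s\le1$, and $T_g$ maps $B^p$ into $Q_s$, then $g\in Q_{s,\log,1/p'}$. (iii) If $1<p<\infty$, then $T_g$ maps $B^p$ into $Q_1=BMOA$ if and only if $g\in Q_{1,\log,1/p'}$. (iv) If $2<p<\infty$, $0<s<1$, and $1-\frac2p<s$, then $T_g$ maps $B^p$ into $Q_s$ if and only if $g\in Q_{s,\log,1/p'}$.
   Context: $\mathbb{D}$ is the open unit disc in $\mathbb{C}$ and $dA$ is the normalized Lebesgue area measure on $\mathbb{D}$. For $a\in\mathbb{D}$, $\varphi_a(z)=\frac{a-z}{1-\overline{a}z}$. Besov spaces: for $1<p<\infty$, $B^p$ is the space of all analytic $f$ in $\mathbb{D}$ with $\int_{\mathbb{D}}(1-|z|)^{p-2}|f'(z)|^p\,dA(z)<\infty$; $B^1$ is the space of all analytic $f$ in $\mathbb{D}$ with $\int_{\mathbb{D}}|f''(z)|\,dA(z)<\infty$. $Q_s$ spaces: for $0<s<\infty$, $Q_s$ is the space of all analytic $f$ in $\mathbb{D}$ with $\sup_{a\in\mathbb{D}}\int_{\mathbb{D}}|f'(z)|^2 g(z,a)^s\,dA(z)<\infty$, where $g(z,a)=\log\frac{|1-\overline{a}z|}{|a-z|}$ is the Green function; equivalently (a known fact), $\sup_{a\in\mathbb{D}}\int_{\mathbb{D}}|f'(z)|^2(1-|\varphi_a(z)|^2)^s\,dA(z)<\infty$.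 It is well known that $Q_1=BMOA$. For $0<s<\infty$ and $\alpha>0$, $Q_{s,\log,\alpha}$ is the space of all analytic $f$ in $\mathbb{D}$ with $\sup_{a\in\mathbb{D}}\left(\log\frac{2}{1-|a|}\right)^{2\alpha}\int_{\mathbb{D}}|f'(z)|^2(1-|\varphi_a(z)|^2)^s\,dA(z)<\infty$. For $g$ and $f$ analytic in $\mathbb{D}$ and $z\in\mathbb{D}$: $T_g(f)(z)=\int_0^z g'(\xi)f(\xi)\,d\xi$. $T_g$ maps $X$ into $Y$ if $T_g(X)\subset Y$. *)

theory Defs
  imports "HOL-Complex_Analysis.Complex_Analysis"
begin

abbreviation unit_disc :: "complex set" where
  "unit_disc \<equiv> ball 0 1"

definition area_measure :: "complex measure" where
  "area_measure = scale_measure (ennreal (1 / pi)) (restrict_space lborel unit_disc)"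

lemma emeasure_area_measure_unit_disc: "emeasure area_measure unit_disc = 1"
proof -
  have "emeasure lborel unit_disc = ennreal pi"
    using emeasure_ball[of 1 "0 :: complex"] by (simp add: unit_ball_vol_2)
  then show ?thesis
    by (simp add: area_measure_def emeasure_restrict_space flip: ennreal_mult)
qed

definition disc_aut :: "complex \<Rightarrow> complex \<Rightarrow> complex" where
  "disc_aut a z = (a - z) / (1 - cnj a * z)"

text \<open>
  At \<open>z = a\<close> the Green function is infinite, whereas division by zero makes the following
  formula 0 there; this is a null set, so the integrals below are unaffected.
\<close>
definition green :: "complex \<Rightarrow> complex \<Rightarrow> real" where
  "green z a = ln (cmod (1 - cnj a * z) / cmod (a - z))"

text \<open>
  The spaces are sets of total functions, constrained only by their values on the disc.
  The parameter of \<open>besov\<close> is meant to satisfy \<open>p \<ge> 1\<close>.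
\<close>
definition besov :: "real \<Rightarrow> (complex \<Rightarrow> complex) set" where
  "besov p = {f. f analytic_on unit_disc \<and>
     (if p = 1
      then (\<integral>\<^sup>+ z. ennreal (cmod (deriv (deriv f) z)) \<partial>area_measure) < \<infinity>
      else (\<integral>\<^sup>+ z. ennreal ((1 - cmod z) powr (p - 2) * cmod (deriv f z) powr p) \<partial>area_measure)
             < \<infinity>)}"

definition Q_space :: "real \<Rightarrow> (complex \<Rightarrow> complex) set" where
  "Q_space s = {f. f analytic_on unit_disc \<and>
     (SUP a\<in>unit_disc.
        \<integral>\<^sup>+ z. ennreal ((cmod (deriv f z))\<^sup>2 * green z a powr s) \<partial>area_measure) < \<infinity>}"

definition Q_log_space :: "real \<Rightarrow> real \<Rightarrow> (complex \<Rightarrow> complex) set" where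
  "Q_log_space s \<alpha> = {f. f analytic_on unit_disc \<and>
     (SUP a\<in>unit_disc. ennreal (ln (2 / (1 - cmod a)) powr (2 * \<alpha>)) *
        (\<integral>\<^sup>+ z. ennreal ((cmod (deriv f z))\<^sup>2 * (1 - (cmod (disc_aut a z))\<^sup>2) powr s)
           \<partial>area_measure)) < \<infinity>}"

definition T_op :: "(complex \<Rightarrow> complex) \<Rightarrow> (complex \<Rightarrow> complex) \<Rightarrow> complex \<Rightarrow> complex" where
  "T_op g f z = contour_integral (linepath 0 z) (\<lambda>\<xi>. deriv g \<xi> * f \<xi>)"

definition maps_into ::
  "((complex \<Rightarrow> complex) \<Rightarrow> complex \<Rightarrow> complex) \<Rightarrow>
   (complex \<Rightarrow> complex) set \<Rightarrow> (complex \<Rightarrow> complex) set \<Rightarrow> bool" where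
  "maps_into T X Y \<longleftrightarrow> T ` X \<subseteq> Y"

end

theory Submission imports Defs begin

text \<open>
  Let \<open>L a = ln (2 / (1 - |a|))\<close>.

  Necessity. The functions \<open>L b powr (- 1 / p) * Ln (6 / (1 - \<bar>b z))\<close> are bounded in the Besov space
  and have nonnegative real part. Hence a series of them with positive coefficients dominates each of
  its terms, and such a series replaces the closed graph theorem in proving that their images under the
  operator are uniformly bounded. Along the radius through \<open>a\<close>, at the points with distance
  \<open>2 ^ k * (1 - |a|)\<close> from the circle, these bounds sum up to the logarithmic condition at \<open>a\<close>.

  Sufficiency. By \<open>|f|\<^sup>2 \<le> 2 |f a|\<^sup>2 + 2 |f - f a|\<^sup>2\<close> and the growth \<open>|f a| \<le> M * L a powr (1 - 1 / p)\<close>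
  only the oscillation matters. By conformal invariance the point \<open>a\<close> may be moved to \<open>0\<close>. There the
  oscillation is estimated by integrating the derivative along radii and averaging it over discs; this
  reduces the claim to the inclusion of the Besov space in a Dirichlet space with weight
  \<open>(1 - |z|) powr \<sigma>\<close>, where \<open>max 0 (1 - 2 / p) < \<sigma> < s\<close>.
\<close>

section \<open>Holomorphic change of variables\<close>

text \<open>Necessity: one test function settles only part of the integral at \<open>a\<close>. It
  reaches the size of \<open>L a powr (1 - 1 / p)\<close> where |1 - \<open>cnj a * z\<close>| is
  comparable with 1 - |a|, and is smaller farther out. At distance scale 2^k (1 - |a|) the weight at
  \<open>a\<close> is at most a constant times 2^(-k s) times the weight at the k-th point of the
  radius, while \<open>L a\<close> exceeds the logarithm there by at most the factor 1 + k. The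
  series of (1 + k)^2 2^(-k s) converges for every s > 0.

  Sufficiency: the oscillation integral is reduced by Fubini to weight integrals of g with all
  possible centres, so the uniformity of the Q_s condition is what counts. The radial Cauchy-Schwarz
  step converges only with a spare power of 1 - |z|; this forces \<sigma> < s. The bound 1 - 2 / p <
  \<sigma> is the exponent condition of Hoelder's inequality between |F'|^p and |F'|^2.

  \<open>Q_space\<close> is defined by the Green function, which is singular at \<open>a\<close>,
  whereas all estimates use 1 - |phi_a|^2, with phi_a short for \<open>disc_aut a\<close>. The two
  conditions are shown equivalent; subharmonicity of |f'|^2 absorbs the singularity.\<close>

text \<open>The change of variables formula applied below,
  \<open>has_measure_differentiable_image\<close>, concerns maps on \<open>real^'n\<close>. The
  plane is therefore moved to \<open>real^2\<close> and the result is carried back.\<close>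

definition vec2 :: "complex \<Rightarrow> real^2" where "vec2 z = vector [Re z, Im z]"
definition unvec2 :: "real^2 \<Rightarrow> complex" where "unvec2 v = Complex (v$1) (v$2)"

lemma vec2_nth [simp]: "vec2 z $ 1 = Re z" "vec2 z $ 2 = Im z"
  by (simp_all add: vec2_def)

lemma unvec2_vec2 [simp]: "unvec2 (vec2 z) = z"
  by (simp add: unvec2_def)

lemma vec2_unvec2 [simp]: "vec2 (unvec2 v) = v"
  by (simp add: vec_eq_iff forall_2 unvec2_def)

lemma linear_vec2: "linear vec2"
  by (intro linearI) (auto simp: vec_eq_iff forall_2)

lemma linear_unvec2: "linear unvec2"
  by (intro linearI) (auto simp: complex_eq_iff unvec2_def)

lemma bounded_linear_vec2: "bounded_linear vec2" 
  and bounded_linear_unvec2: "bounded_linear unvec2"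
  using linear_vec2 linear_unvec2 linear_conv_bounded_linear by auto

lemma vec2_borel [measurable]: "vec2 \<in> borel_measurable borel"
  and unvec2_borel [measurable]: "unvec2 \<in> borel_measurable borel"
  using bounded_linear_vec2 bounded_linear_unvec2
  by (auto intro!: borel_measurable_continuous_onI simp: linear_continuous_on)

text \<open>Boxes correspond to boxes of the same volume, and the values on boxes determine Lebesgue
  measure.\<close>

lemma lborel_eq_distr_vec2: "(lborel :: (real^2) measure) = distr lborel borel vec2"
proof (rule lborel_eqI)
  fix l u :: "real^2"
  assume le: "\<And>b. b \<in> Basis \<Longrightarrow> l \<bullet> b \<le> u \<bullet> b"
  have B: "(Basis :: (real^2) set) = {axis 1 1, axis 2 1}"
    unfolding Basis_vec_def by (auto simp: exhaust_2) (metis exhaust_2)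
  have ne: "axis 1 1 \<noteq> (axis 2 1 :: real^2)" by (simp add: axis_eq_axis)
  have "vec2 -` box l u = box (unvec2 l) (unvec2 u)"
    by (auto simp: mem_box_cart forall_2 unvec2_def in_box_complex_iff)
  moreover have "l $ 1 \<le> u $ 1" "l $ 2 \<le> u $ 2"
    using le[of "axis 1 1"] le[of "axis 2 1"] B by (auto simp: inner_axis)
  ultimately show "emeasure (distr lborel borel vec2) (box l u) = (\<Prod>b\<in>Basis. (u - l) \<bullet> b)"
    using ne by (simp add: emeasure_distr B inner_axis unvec2_def emeasure_lborel_box_eq Basis_complex_def inner_complex_def)
qed simp

text \<open>Multiplication by x + iy has the matrix with rows (x, -y) and (y, x). With c the
  derivative of a holomorphic map, this identifies the Jacobian.\<close>

lemma det_mult_vec2: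
  "det (matrix (\<lambda>v. vec2 (c * unvec2 v))) = (cmod c)\<^sup>2"
  by (simp add: det_2 matrix_def unvec2_def axis_def cmod_power2) (simp add: power2_eq_square)

lemma vec2_image_eq: "vec2 ` A = unvec2 -` A"
proof (intro equalityI subsetI)
  fix v assume "v \<in> unvec2 -` A"
  then have "vec2 (unvec2 v) \<in> vec2 ` A" by blast
  then show "v \<in> vec2 ` A" by simp
qed auto

lemma emeasure_lborel_vec2_image:
  assumes "A \<in> sets borel"
  shows "emeasure lborel (vec2 ` A) = emeasure lborel A"
proof -
  have "vec2 ` A = unvec2 -` A"
    by (rule vec2_image_eq)
  with assms have *: "vec2 ` A \<in> sets borel"
    using measurable_sets[OF unvec2_borel assms] by simp
  have "emeasure lborel (vec2 ` A) = emeasure lborel (vec2 -` (vec2 ` A))"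
    using * by (subst lborel_eq_distr_vec2) (simp add: emeasure_distr)
  also have "vec2 -` (vec2 ` A) = A"
    by (metis inj_vimage_image_eq inj_on_inverseI unvec2_vec2)
  finally show ?thesis .
qed

lemma nn_integral_lborel_vec2:
  fixes u :: "complex \<Rightarrow> ennreal"
  assumes "u \<in> borel_measurable borel"
  shows "(\<integral>\<^sup>+ v. u (unvec2 v) \<partial>lborel) = (\<integral>\<^sup>+ z. u z \<partial>lborel)"
  using assms by (subst lborel_eq_distr_vec2) (simp add: nn_integral_distr)

lemma emeasure_lebesgue_borel: "X \<in> sets borel \<Longrightarrow> emeasure lebesgue X = emeasure lborel X"
  by simp

text \<open>Injectivity excludes multiplicities in the area formula, whose Jacobian is |phi'|^2. The
  holomorphic inverse turns the image into a preimage, hence a Borel set.\<close>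

lemma emeasure_holomorphic_image:
  assumes S: "open S" and hol: "\<phi> holomorphic_on S" and inj: "inj_on \<phi> S"
    and A: "A \<in> sets borel" "A \<subseteq> S"
  shows "\<phi> ` A \<in> sets borel"
    and "emeasure lborel (\<phi> ` A) = (\<integral>\<^sup>+ w. ennreal ((cmod (deriv \<phi> w))\<^sup>2) * indicator A w \<partial>lborel)"
proof -
  obtain \<psi> where \<psi>: "\<psi> holomorphic_on (\<phi> ` S)" "\<And>z. z \<in> S \<Longrightarrow> \<psi> (\<phi> z) = z"
    using holomorphic_has_inverse[OF hol S inj] by metis
  have "open (\<phi> ` S)" using S hol inj open_mapping_thm3 by blast
  have "\<phi> ` A = \<psi> -` A \<inter> \<phi> ` S" using A \<psi> by force
  moreover have "\<psi> -` A \<inter> \<phi> ` S \<in> sets borel"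
  proof -
    have "\<psi> \<in> borel_measurable (restrict_space borel (\<phi> ` S))"
      using holomorphic_on_imp_continuous_on[OF \<psi>(1)] by (rule borel_measurable_continuous_on_restrict)
    from measurable_sets[OF this A(1)] show ?thesis
      using \<open>open (\<phi> ` S)\<close> by (auto simp: space_restrict_space sets_restrict_space_iff)
  qed
  ultimately show im: "\<phi> ` A \<in> sets borel" by simp
  let ?f = "\<lambda>v. vec2 (\<phi> (unvec2 v))" and ?f' = "\<lambda>x v. vec2 (deriv \<phi> (unvec2 x) * unvec2 v)"
  let ?V = "vec2 ` A"
  have V: "?V \<in> sets borel"
  proof -
    have "vec2 ` A = unvec2 -` A"
      by (rule vec2_image_eq)
    then show ?thesis
      using measurable_sets[OF unvec2_borel A(1)] by simp
  qed
  have der: "(?f has_derivative ?f' x) (at x within ?V)" if "x \<in> ?V" for x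
  proof -
    have "unvec2 x \<in> S" using that A by auto
    then have "(\<phi> has_derivative (\<lambda>v. deriv \<phi> (unvec2 x) * v)) (at (unvec2 x))"
      using hol S holomorphic_derivI has_field_derivative_def by blast
    then have "(\<phi> has_derivative (\<lambda>v. deriv \<phi> (unvec2 x) * v)) (at (unvec2 x) within unvec2 ` ?V)"
      by (rule has_derivative_at_withinI)
    from diff_chain_within[OF bounded_linear_imp_has_derivative[OF bounded_linear_unvec2] this]
    have "((\<lambda>v. \<phi> (unvec2 v)) has_derivative (\<lambda>v. deriv \<phi> (unvec2 x) * unvec2 v)) (at x within ?V)"
      by (simp add: o_def)
    from bounded_linear.has_derivative[OF bounded_linear_vec2 this] show ?thesis .
  qed
  have inj': "inj_on ?f ?V"
    using inj A(2) by (auto simp: inj_on_def) (metis subsetD unvec2_vec2)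
  have fV: "?f ` ?V = vec2 ` \<phi> ` A" by (auto simp: image_image)
  have "vec2 ` \<phi> ` A \<in> sets borel"
    unfolding vec2_image_eq using measurable_sets[OF unvec2_borel im] by simp
  then have fVs: "?f ` ?V \<in> sets borel" unfolding fV .
  have det: "\<bar>det (matrix (?f' x))\<bar> = (cmod (deriv \<phi> (unvec2 x)))\<^sup>2" for x
    by (simp add: det_mult_vec2)
  have key: "?f ` ?V \<in> lmeasurable \<and> measure lebesgue (?f ` ?V) = m
     \<longleftrightarrow> ((\<lambda>x. (cmod (deriv \<phi> (unvec2 x)))\<^sup>2) has_integral m) ?V" for m
    using has_measure_differentiable_image[OF _ der inj', of m] V unfolding det by simp
  have "deriv \<phi> holomorphic_on S" using hol S holomorphic_deriv by blast
  then have "continuous_on S (deriv \<phi>)" by (rule holomorphic_on_imp_continuous_on)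
  then have cont: "continuous_on S (\<lambda>w. (cmod (deriv \<phi> w))\<^sup>2)" by (intro continuous_intros)
  let ?d = "\<lambda>w. (cmod (deriv \<phi> w))\<^sup>2 * indicator A w"
  have "(\<lambda>w. indicator A w *\<^sub>R ((cmod (deriv \<phi> w))\<^sup>2)) = (\<lambda>w. indicator A w *\<^sub>R (indicator S w *\<^sub>R (cmod (deriv \<phi> w))\<^sup>2))"
    using A(2) by (auto simp: indicator_def fun_eq_iff)
  moreover have "(\<lambda>w. indicator S w *\<^sub>R (cmod (deriv \<phi> w))\<^sup>2) \<in> borel_measurable borel"
    using S cont by (intro borel_measurable_continuous_on_indicator) auto
  ultimately have meas[measurable]: "?d \<in> borel_measurable borel"
    using A(1) by (simp add: mult.commute)
  have "emeasure lborel (\<phi> ` A) = emeasure lborel (?f ` ?V)"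
    unfolding fV using emeasure_lborel_vec2_image[OF im] by simp
  also have "\<dots> = (\<integral>\<^sup>+ v. ennreal (?d (unvec2 v)) \<partial>lborel)"
  \<comment> \<open>\<open>key\<close> speaks about finite values \<open>m\<close> only. If the
    integral is infinite, a finite measure of the image would make it finite by \<open>key\<close>;
    otherwise the integral itself serves as \<open>m\<close>.\<close>
  proof (cases "(\<integral>\<^sup>+ v. ennreal (?d (unvec2 v)) \<partial>lborel) = \<infinity>")
    case True
    show ?thesis
    proof (rule ccontr)
      assume "\<not> ?thesis"
      then have "emeasure lborel (?f ` ?V) < \<infinity>" using True by (simp add: less_top)
      moreover have "?f ` ?V \<in> sets lborel"
        using fVs by simp
      ultimately have "?f ` ?V \<in> lmeasurable"
        by (auto simp: fmeasurable_def)
      with key have "((\<lambda>x. (cmod (deriv \<phi> (unvec2 x)))\<^sup>2) has_integral measure lebesgue (?f ` ?V)) ?V"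
        by blast
      then have "integral\<^sup>N lborel (\<lambda>x. ennreal ((cmod (deriv \<phi> (unvec2 x)))\<^sup>2) * indicator ?V x) = ennreal (measure lebesgue (?f ` ?V))"
        by (intro nn_integral_has_integral_lebesgue') auto
      also have "(\<lambda>x. ennreal ((cmod (deriv \<phi> (unvec2 x)))\<^sup>2) * indicator ?V x) = (\<lambda>v. ennreal (?d (unvec2 v)))"
        by (intro ext) (simp add: vec2_image_eq indicator_def)
      finally show False unfolding True by simp
    qed
  next
    case False
    then obtain m where m: "m \<ge> 0" "(\<integral>\<^sup>+ v. ennreal (?d (unvec2 v)) \<partial>lborel) = ennreal m"
      by (cases "\<integral>\<^sup>+ v. ennreal (?d (unvec2 v)) \<partial>lborel" rule: ennreal_cases) auto
    have "((\<lambda>v. ?d (unvec2 v)) has_integral m) UNIV"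
      by (rule nn_integral_has_integral[OF _ _ m(2,1)]) (simp_all add: measurable_compose[OF unvec2_borel meas])
    moreover have "(\<lambda>v. ?d (unvec2 v)) = (\<lambda>v. if v \<in> ?V then (cmod (deriv \<phi> (unvec2 v)))\<^sup>2 else 0)"
      by (intro ext) (simp add: vec2_image_eq indicator_def)
    ultimately have "((\<lambda>x. (cmod (deriv \<phi> (unvec2 x)))\<^sup>2) has_integral m) ?V"
      by (simp add: has_integral_restrict_UNIV)
    with key have "?f ` ?V \<in> lmeasurable" "measure lebesgue (?f ` ?V) = m" by blast+
    then have "emeasure lebesgue (?f ` ?V) = ennreal m"
      by (metis emeasure_eq_measure2)
    moreover have "emeasure lebesgue (?f ` ?V) = emeasure lborel (?f ` ?V)"
      using fVs by (rule emeasure_lebesgue_borel)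
    ultimately show ?thesis using m(2) by metis
  qed
  also have "\<dots> = (\<integral>\<^sup>+ w. ennreal (?d w) \<partial>lborel)"
    by (rule nn_integral_lborel_vec2) (intro measurable_compose[OF meas] measurable_ennreal)
  finally show "emeasure lborel (\<phi> ` A) = (\<integral>\<^sup>+ w. ennreal ((cmod (deriv \<phi> w))\<^sup>2) * indicator A w \<partial>lborel)"
    by (simp add: ennreal_mult' ennreal_indicator)
qed

text \<open>By the formula for sets, the push-forward of the density |phi'|^2 on \<open>S\<close> is
  Lebesgue measure on the image. Equality of the two measures gives the formula for all functions at
  once.\<close>

lemma nn_integral_holomorphic_subst:
  fixes u :: "complex \<Rightarrow> ennreal"
  assumes S: "open S" and hol: "\<phi> holomorphic_on S" and inj: "inj_on \<phi> S"
    and u: "u \<in> borel_measurable (restrict_space borel (\<phi> ` S))"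
  shows "(\<integral>\<^sup>+ z \<in> \<phi> ` S. u z \<partial>lborel) = (\<integral>\<^sup>+ w \<in> S. (ennreal ((cmod (deriv \<phi> w))\<^sup>2) * u (\<phi> w)) \<partial>lborel)"
proof -
  have opI: "open (\<phi> ` S)" using S hol inj open_mapping_thm3 by blast
  have "deriv \<phi> holomorphic_on S" using hol S holomorphic_deriv by blast
  then have "continuous_on S (deriv \<phi>)" by (rule holomorphic_on_imp_continuous_on)
  then have "continuous_on S (\<lambda>w. (cmod (deriv \<phi> w))\<^sup>2)" by (intro continuous_intros)
  from borel_measurable_continuous_on_restrict[OF this]
  have d[measurable]: "(\<lambda>w. (cmod (deriv \<phi> w))\<^sup>2) \<in> borel_measurable (restrict_space lborel S)"
    by (simp add: measurable_def space_restrict_space sets_restrict_space)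
  have \<phi>m[measurable]: "\<phi> \<in> restrict_space lborel S \<rightarrow>\<^sub>M restrict_space borel (\<phi> ` S)"
  proof (rule measurable_restrict_space2)
    show "\<phi> \<in> borel_measurable (restrict_space lborel S)"
      using borel_measurable_continuous_on_restrict[OF holomorphic_on_imp_continuous_on[OF hol]]
      by (simp add: measurable_def space_restrict_space sets_restrict_space)
  qed (auto simp: space_restrict_space)
  let ?M = "density (restrict_space lborel S) (\<lambda>w. ennreal ((cmod (deriv \<phi> w))\<^sup>2))"
  have eq: "distr ?M (restrict_space borel (\<phi> ` S)) \<phi> = restrict_space lborel (\<phi> ` S)"
  proof (rule measure_eqI)
    show "sets (distr ?M (restrict_space borel (\<phi> ` S)) \<phi>) = sets (restrict_space lborel (\<phi> ` S))"
      by (simp add: sets_restrict_space)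
    fix B assume "B \<in> sets (distr ?M (restrict_space borel (\<phi> ` S)) \<phi>)"
    then have B: "B \<in> sets (restrict_space borel (\<phi> ` S))" by simp
    then have B': "B \<in> sets borel" "B \<subseteq> \<phi> ` S"
      using opI by (auto simp: sets_restrict_space_iff)
    let ?A = "\<phi> -` B \<inter> S"
    have A: "?A \<in> sets (restrict_space lborel S)"
      using measurable_sets[OF \<phi>m B] by (simp add: space_restrict_space)
    then have A': "?A \<in> sets borel" using S by (auto simp: sets_restrict_space_iff)
    have img: "\<phi> ` ?A = B" using B'(2) by auto
    have "emeasure (distr ?M (restrict_space borel (\<phi> ` S)) \<phi>) B = emeasure ?M ?A"
      using B by (subst emeasure_distr) (auto simp: space_restrict_space)
    also have "\<dots> = (\<integral>\<^sup>+ w. ennreal ((cmod (deriv \<phi> w))\<^sup>2) * indicator ?A w \<partial>restrict_space lborel S)"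
      using A by (subst emeasure_density) auto
    also have "\<dots> = (\<integral>\<^sup>+ w. ennreal ((cmod (deriv \<phi> w))\<^sup>2) * indicator ?A w * indicator S w \<partial>lborel)"
      using S by (subst nn_integral_restrict_space) auto
    also have "\<dots> = (\<integral>\<^sup>+ w. ennreal ((cmod (deriv \<phi> w))\<^sup>2) * indicator ?A w \<partial>lborel)"
      by (intro nn_integral_cong) (auto simp: indicator_def)
    also have "\<dots> = emeasure lborel B"
      using emeasure_holomorphic_image[OF S hol inj A'] img by simp
    also have "\<dots> = emeasure (restrict_space lborel (\<phi> ` S)) B"
      using opI B' by (subst emeasure_restrict_space) auto
    finally show "emeasure (distr ?M (restrict_space borel (\<phi> ` S)) \<phi>) B = emeasure (restrict_space lborel (\<phi> ` S)) B" .
  qed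
  have "(\<integral>\<^sup>+ z \<in> \<phi> ` S. u z \<partial>lborel) = (\<integral>\<^sup>+ z. u z \<partial>restrict_space lborel (\<phi> ` S))"
    using opI by (subst nn_integral_restrict_space) auto
  also have "\<dots> = (\<integral>\<^sup>+ w. u (\<phi> w) \<partial>?M)"
    unfolding eq[symmetric] using u by (subst nn_integral_distr) auto
  also have "\<dots> = (\<integral>\<^sup>+ w. ennreal ((cmod (deriv \<phi> w))\<^sup>2) * u (\<phi> w) \<partial>restrict_space lborel S)"
    using u by (subst nn_integral_density) auto
  also have "\<dots> = (\<integral>\<^sup>+ w \<in> S. (ennreal ((cmod (deriv \<phi> w))\<^sup>2) * u (\<phi> w)) \<partial>lborel)"
    using S by (subst nn_integral_restrict_space) auto
  finally show ?thesis .
qed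

section \<open>Polar coordinates\<close>

lemma lborel_complex_eq_distr:
  "(lborel :: complex measure) = distr (lborel \<Otimes>\<^sub>M lborel) borel (\<lambda>(x, y). Complex x y)"
proof -
  have [measurable]: "(\<lambda>(x, y). Complex x y) \<in> borel_measurable borel"
    by (intro borel_measurable_continuous_onI) (auto simp: case_prod_unfold Complex_eq intro!: continuous_intros)
  show ?thesis
  proof (rule lborel_eqI)
    fix l u :: complex
    assume le: "\<And>b. b \<in> Basis \<Longrightarrow> l \<bullet> b \<le> u \<bullet> b"
    have "(\<lambda>(x, y). Complex x y) -` box l u = box (Re l, Im l) (Re u, Im u)"
      by (auto simp: box_def Basis_prod_def Basis_complex_def)
    moreover have "Re l \<le> Re u" "Im l \<le> Im u"
      using le[of 1] le[of \<i>] by (auto simp: Basis_complex_def)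
    ultimately show "emeasure (distr (lborel \<Otimes>\<^sub>M lborel) borel (\<lambda>(x, y). Complex x y)) (box l u) = (\<Prod>b\<in>Basis. (u - l) \<bullet> b)"
      by (simp add: lborel_prod emeasure_distr emeasure_lborel_box_eq Basis_complex_def Basis_prod_def prod.union_disjoint)
  qed simp
qed

lemma nn_integral_complex_eq_pair:
  fixes u :: "complex \<Rightarrow> ennreal"
  assumes [measurable]: "u \<in> borel_measurable borel"
  shows "(\<integral>\<^sup>+ z. u z \<partial>lborel) = (\<integral>\<^sup>+ y. \<integral>\<^sup>+ x. u (Complex x y) \<partial>lborel \<partial>lborel)"
proof -
  have [measurable]: "(\<lambda>(x, y). Complex x y) \<in> lborel \<Otimes>\<^sub>M lborel \<rightarrow>\<^sub>M borel"
    unfolding lborel_prod measurable_lborel1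
    by (simp, intro borel_measurable_continuous_onI) (auto simp: case_prod_unfold Complex_eq intro!: continuous_intros)
  have "(\<integral>\<^sup>+ z. u z \<partial>lborel) = (\<integral>\<^sup>+ p. u ((\<lambda>(x, y). Complex x y) p) \<partial>(lborel \<Otimes>\<^sub>M lborel))"
    by (subst lborel_complex_eq_distr, subst nn_integral_distr) auto
  also have "\<dots> = (\<integral>\<^sup>+ y. \<integral>\<^sup>+ x. u ((\<lambda>(x, y). Complex x y) (x, y)) \<partial>lborel \<partial>lborel)"
    by (subst lborel_pair.nn_integral_snd[symmetric]) auto
  finally show ?thesis by simp
qed

text \<open>Substitution on the compact intervals from exp (-n) to exp n and from -n to n, followed
  by monotone convergence.\<close>

lemma nn_integral_exp_subst:
  fixes f :: "real \<Rightarrow> ennreal"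
  assumes [measurable]: "f \<in> borel_measurable borel"
  shows "(\<integral>\<^sup>+ r \<in> {0<..}. f r \<partial>lborel) = (\<integral>\<^sup>+ x. f (exp x) * ennreal (exp x) \<partial>lborel)"
proof -
  have *: "(\<integral>\<^sup>+ r. f r * indicator {exp (- real n)..exp (real n)} r \<partial>lborel)
     = (\<integral>\<^sup>+ x. f (exp x) * ennreal (exp x) * indicator {- real n..real n} x \<partial>lborel)" for n :: nat
  \<comment> \<open>For \<open>n = 0\<close> both intervals are single points, whereas the
    substitution rule wants a proper interval.\<close>
  proof (cases "n = 0")
    case True
    have "(\<integral>\<^sup>+ r. f r * indicator {1..1} r \<partial>lborel) = (\<integral>\<^sup>+ r. 0 \<partial>(lborel::real measure))"
      by (rule nn_integral_cong_AE, use AE_lborel_singleton[of 1] in eventually_elim) simp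
    moreover have "(\<integral>\<^sup>+ x. f (exp x) * ennreal (exp x) * indicator {0..0} x \<partial>lborel) = (\<integral>\<^sup>+ r. 0 \<partial>(lborel::real measure))"
      by (rule nn_integral_cong_AE, use AE_lborel_singleton[of 0] in eventually_elim) simp
    ultimately show ?thesis using True by simp
  next
    case False
    then show ?thesis
      by (intro nn_integral_substitution_aux) (auto intro!: derivative_eq_intros continuous_intros)
  qed
  have pw: "f r * indicator {0<..} r = (SUP n::nat. f r * indicator {exp (- real n)..exp (real n)} r)" for r
  proof (cases "r > 0")
    case True
    obtain n :: nat where n: "\<bar>ln r\<bar> \<le> real n" using real_arch_simple by blast
    then have "exp (- real n) \<le> r" "r \<le> exp (real n)"
      using True by (metis abs_le_iff exp_le_cancel_iff exp_ln minus_le_iff)+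
    then have "f r * indicator {0<..} r \<le> (SUP n::nat. f r * indicator {exp (- real n)..exp (real n)} r)"
      using True by (intro SUP_upper2[of n]) auto
    moreover have "(SUP n::nat. f r * indicator {exp (- real n)..exp (real n)} r) \<le> f r * indicator {0<..} r"
      using True by (intro SUP_least) (auto simp: indicator_def)
    ultimately show ?thesis by (rule antisym)
  next
    case False
    then have "\<not> exp (- real n) \<le> r" for n using exp_gt_zero[of "- real n"] by linarith
    then show ?thesis using False by (simp add: indicator_def)
  qed
  have pw2: "f (exp x) * ennreal (exp x) = (SUP n::nat. f (exp x) * ennreal (exp x) * indicator {- real n..real n} x)" for x
  proof -
    obtain n :: nat where n: "\<bar>x\<bar> \<le> real n" using real_arch_simple by blast
    then have "f (exp x) * ennreal (exp x) \<le> (SUP n::nat. f (exp x) * ennreal (exp x) * indicator {- real n..real n} x)"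
      by (intro SUP_upper2[of n]) (auto simp: indicator_def)
    moreover have "(SUP n::nat. f (exp x) * ennreal (exp x) * indicator {- real n..real n} x) \<le> f (exp x) * ennreal (exp x)"
      by (intro SUP_least) (auto simp: indicator_def)
    ultimately show ?thesis by (rule antisym)
  qed
  have "(\<integral>\<^sup>+ r \<in> {0<..}. f r \<partial>lborel) = (\<integral>\<^sup>+ r. (SUP n::nat. f r * indicator {exp (- real n)..exp (real n)} r) \<partial>lborel)"
    by (simp only: pw)
  also have "\<dots> = (SUP n::nat. \<integral>\<^sup>+ r. f r * indicator {exp (- real n)..exp (real n)} r \<partial>lborel)"
    by (intro nn_integral_monotone_convergence_SUP incseq_SucI le_funI mult_left_mono indicator_leI)
      (auto intro: order_trans[of "exp (- 1 - real n)" "exp (- real n)" for n] order_trans[of _ "exp (real n)" for n])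
  also have "\<dots> = (SUP n::nat. \<integral>\<^sup>+ x. f (exp x) * ennreal (exp x) * indicator {- real n..real n} x \<partial>lborel)"
    by (simp only: *)
  also have "\<dots> = (\<integral>\<^sup>+ x. (SUP n::nat. f (exp x) * ennreal (exp x) * indicator {- real n..real n} x) \<partial>lborel)"
    by (intro nn_integral_monotone_convergence_SUP[symmetric] incseq_SucI le_funI mult_left_mono indicator_leI) (auto intro: order_trans)
  also have "\<dots> = (\<integral>\<^sup>+ x. f (exp x) * ennreal (exp x) \<partial>lborel)"
    by (simp only: pw2[symmetric])
  finally show ?thesis .
qed

lemma AE_lborel_not_nonpos_Reals: "AE z in lborel. (z::complex) \<notin> \<real>\<^sub>\<le>\<^sub>0"
proof -
  have "negligible {z :: complex. z \<bullet> \<i> = 0}"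
    by (rule negligible_standard_hyperplane) (simp add: Basis_complex_def)
  then have "negligible (\<real>\<^sub>\<le>\<^sub>0 :: complex set)"
    by (rule negligible_subset) (auto simp: complex_nonpos_Reals_iff)
  then have "(\<real>\<^sub>\<le>\<^sub>0 :: complex set) \<in> null_sets lebesgue"
    by (simp add: negligible_iff_null_sets)
  then have "(\<real>\<^sub>\<le>\<^sub>0 :: complex set) \<in> null_sets lborel"
    by (simp add: null_sets_completion_iff closed_nonpos_Reals_complex borel_closed)
  then show ?thesis by (rule AE_not_in)
qed

text \<open>\<open>exp\<close> maps the strip |Im w| < pi injectively onto the plane slit along the
  nonpositive reals, so only a null set is lost. Its Jacobian is r^2 with r = exp x, and the
  substitution of r for x removes one factor r.\<close>

lemma nn_integral_polar:
  fixes u :: "complex \<Rightarrow> ennreal"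
  assumes [measurable]: "u \<in> borel_measurable borel"
  shows "(\<integral>\<^sup>+ z. u z \<partial>lborel) = (\<integral>\<^sup>+ \<theta> \<in> {-pi<..<pi}. (\<integral>\<^sup>+ r \<in> {0<..}. (u (rcis r \<theta>) * ennreal r) \<partial>lborel) \<partial>lborel)"
proof -
  let ?S = "{w :: complex. -pi < Im w \<and> Im w < pi}"
  have opS: "open ?S"
    by (intro open_Collect_conj open_Collect_less continuous_intros)
  have img: "exp ` ?S = - (\<real>\<^sub>\<le>\<^sub>0 :: complex set)"
  proof (intro equalityI subsetI)
    fix z :: complex assume "z \<in> - \<real>\<^sub>\<le>\<^sub>0"
    then have z: "z \<notin> \<real>\<^sub>\<le>\<^sub>0" by simp
    then have "z \<noteq> 0" by auto
    moreover have "\<bar>Im (Ln z)\<bar> < pi"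
    proof -
      have "Im (Ln z) \<noteq> pi" using z \<open>z \<noteq> 0\<close> Im_Ln_eq_pi[of z]
        by (auto simp: complex_nonpos_Reals_iff)
      then show ?thesis using mpi_less_Im_Ln[OF \<open>z \<noteq> 0\<close>] Im_Ln_le_pi[OF \<open>z \<noteq> 0\<close>] by linarith
    qed
    ultimately show "z \<in> exp ` ?S"
      by (intro image_eqI[of _ _ "Ln z"]) auto
  next
    fix z :: complex assume "z \<in> exp ` ?S"
    then obtain w where w: "z = exp w" "\<bar>Im w\<bar> < pi" by auto
    then have "Ln z = w" by (simp add: Ln_exp)
    show "z \<in> - \<real>\<^sub>\<le>\<^sub>0"
    proof
      assume "z \<in> \<real>\<^sub>\<le>\<^sub>0"
      then have "Im (Ln z) = pi" using w by (intro Im_Ln_eq_pi[THEN iffD2]) (use exp_not_eq_zero[of w] in \<open>auto simp: complex_nonpos_Reals_iff complex_eq_iff order_less_le\<close>)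
      then show False using \<open>Ln z = w\<close> w by simp
    qed
  qed
  have inj: "inj_on exp ?S"
    by (rule inj_on_inverseI[of _ Ln]) (auto intro!: Ln_exp)
  have [measurable]: "?S \<in> sets borel" using opS by simp
  have "(\<integral>\<^sup>+ z. u z \<partial>lborel) = (\<integral>\<^sup>+ z. u z * indicator (exp ` ?S) z \<partial>lborel)"
    by (rule nn_integral_cong_AE, use AE_lborel_not_nonpos_Reals in eventually_elim) (simp only: img, simp)
  also have "\<dots> = (\<integral>\<^sup>+ w. ennreal ((cmod (deriv exp w))\<^sup>2) * u (exp w) * indicator ?S w \<partial>lborel)"
    by (rule nn_integral_holomorphic_subst[OF opS _ inj]) (auto intro: holomorphic_intros measurable_restrict_space1)
  also have "\<dots> = (\<integral>\<^sup>+ w. ennreal ((cmod (exp w))\<^sup>2) * u (exp w) * indicator ?S w \<partial>lborel)"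
    by (simp only: DERIV_imp_deriv[OF DERIV_exp])
  also have "\<dots> = (\<integral>\<^sup>+ y. \<integral>\<^sup>+ x. ennreal ((cmod (exp (Complex x y)))\<^sup>2) * u (exp (Complex x y)) * indicator ?S (Complex x y) \<partial>lborel \<partial>lborel)"
    by (rule nn_integral_complex_eq_pair) measurable
  also have "\<dots> = (\<integral>\<^sup>+ \<theta>. (\<integral>\<^sup>+ r. (u (rcis r \<theta>) * ennreal r) * indicator {0<..} r \<partial>lborel) * indicator {-pi<..<pi} \<theta> \<partial>lborel)"
  proof (rule nn_integral_cong)
    fix y :: real
    have 1: "exp (Complex x y) = rcis (exp x) y" for x
      by (simp add: exp_eq_polar rcis_def)
    have 2: "ennreal ((cmod (exp (Complex x y)))\<^sup>2) = ennreal (exp x) * ennreal (exp x)" for x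
      by (simp add: power2_eq_square ennreal_mult')
    have "(\<integral>\<^sup>+ x. ennreal ((cmod (exp (Complex x y)))\<^sup>2) * u (exp (Complex x y)) * indicator ?S (Complex x y) \<partial>lborel)
      = (\<integral>\<^sup>+ x. (u (rcis (exp x) y) * ennreal (exp x) * ennreal (exp x)) * indicator {-pi<..<pi} y \<partial>lborel)"
      unfolding 2 unfolding 1 by (rule nn_integral_cong) (simp only: indicator_def mem_Collect_eq greaterThanLessThan_iff complex.sel mult_ac)
    also have "\<dots> = (\<integral>\<^sup>+ x. (u (rcis (exp x) y) * ennreal (exp x) * ennreal (exp x)) \<partial>lborel) * indicator {-pi<..<pi} y"
      by (rule nn_integral_multc) (simp add: rcis_def)
    also have "(\<integral>\<^sup>+ x. (u (rcis (exp x) y) * ennreal (exp x) * ennreal (exp x)) \<partial>lborel) = (\<integral>\<^sup>+ r \<in> {0<..}. (u (rcis r y) * ennreal r) \<partial>lborel)"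
      by (rule nn_integral_exp_subst[symmetric]) (simp add: rcis_def)
    finally show "(\<integral>\<^sup>+ x. ennreal ((cmod (exp (Complex x y)))\<^sup>2) * u (exp (Complex x y)) * indicator ?S (Complex x y) \<partial>lborel)
      = (\<integral>\<^sup>+ r. (u (rcis r y) * ennreal r) * indicator {0<..} r \<partial>lborel) * indicator {-pi<..<pi} y" .
  qed
  finally show ?thesis .
qed

text \<open>Bounding the increments of an antiderivative inside the open interval avoids its values
  at the ends. Integrands that blow up at an end, such as (1 - r) powr (\<delta> - 1), are thus
  covered. The proof exhausts the interval by compact ones.\<close>

lemma nn_integral_deriv_le:
  fixes f F :: "real \<Rightarrow> real" and a b :: real
  assumes [measurable]: "f \<in> borel_measurable borel"
    and D: "\<And>x. a < x \<Longrightarrow> x < b \<Longrightarrow> (F has_real_derivative f x) (at x)"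
    and f0: "\<And>x. a < x \<Longrightarrow> x < b \<Longrightarrow> 0 \<le> f x"
    and bd: "\<And>x y. a < x \<Longrightarrow> x \<le> y \<Longrightarrow> y < b \<Longrightarrow> F y - F x \<le> c"
  shows "(\<integral>\<^sup>+ x \<in> {a<..<b}. ennreal (f x) \<partial>lborel) \<le> ennreal c"
proof (cases "a < b")
  case True
  obtain u l :: "nat \<Rightarrow> real" where ul: "\<And>i. a < l i" "\<And>i. l i < u i" "\<And>i. u i < b" "decseq l" "incseq u" "l \<longlonglongrightarrow> a" "u \<longlonglongrightarrow> b"
  proof
    let ?l = "\<lambda>i. a + (b - a) / (real i + 3)" and ?u = "\<lambda>i. b - (b - a) / (real i + 3)"
    have "(b - a) / (real i + 3) < (b - a) / 2" for i
      using True by (intro divide_strict_left_mono) auto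
    moreover have "a + c < b - c" if "c < (b - a) / 2" for c using that by (simp add: field_simps)
    ultimately show "?l i < ?u i" for i by blast
    show "a < ?l i" "?u i < b" for i using True by auto
    show "decseq ?l" "incseq ?u" using True
      by (auto simp: decseq_def incseq_def intro!: divide_left_mono)
    show "?l \<longlonglongrightarrow> a" "?u \<longlonglongrightarrow> b" by real_asymp+
  qed
  have pw: "ennreal (f x) * indicator {a<..<b} x = (SUP n::nat. ennreal (f x) * indicator {l n..u n} x)" for x
  proof (rule antisym)
    show "(SUP n::nat. ennreal (f x) * indicator {l n..u n} x) \<le> ennreal (f x) * indicator {a<..<b} x"
    proof (intro SUP_least mult_left_mono indicator_leI)
      show "x \<in> {a<..<b}" if "x \<in> {l n..u n}" for n
        using that ul(1,3)[of n] by auto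
    qed simp
    show "ennreal (f x) * indicator {a<..<b} x \<le> (SUP n::nat. ennreal (f x) * indicator {l n..u n} x)"
    proof (cases "x \<in> {a<..<b}")
      case True
      then have "\<forall>\<^sub>F n in sequentially. l n < x" "\<forall>\<^sub>F n in sequentially. x < u n"
        using order_tendstoD[OF ul(6)] order_tendstoD[OF ul(7)] by auto
      then have "\<forall>\<^sub>F n in sequentially. l n < x \<and> x < u n" by eventually_elim simp
      then obtain n where "l n < x" "x < u n" by (auto simp: eventually_sequentially)
      then show ?thesis using True by (intro SUP_upper2[of n]) auto
    qed auto
  qed
  have "(\<integral>\<^sup>+ x \<in> {a<..<b}. ennreal (f x) \<partial>lborel) = (\<integral>\<^sup>+ x. (SUP n::nat. ennreal (f x) * indicator {l n..u n} x) \<partial>lborel)"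
    by (simp only: pw)
  also have "\<dots> = (SUP n::nat. \<integral>\<^sup>+ x. ennreal (f x) * indicator {l n..u n} x \<partial>lborel)"
  proof (intro nn_integral_monotone_convergence_SUP incseq_SucI le_funI mult_left_mono indicator_leI)
    show "x \<in> {l (Suc n)..u (Suc n)}" if "x \<in> {l n..u n}" for n x
      using that decseq_SucD[OF ul(4), of n] incseq_SucD[OF ul(5), of n] by auto
  qed auto
  also have "\<dots> \<le> ennreal c"
  proof (rule SUP_least)
    fix n
    have I: "a < x" "x < b" if "l n \<le> x" "x \<le> u n" for x
      using that ul(1)[of n] ul(3)[of n] by linarith+
    have "(\<integral>\<^sup>+ x. ennreal (f x) * indicator {l n..u n} x \<partial>lborel) = F (u n) - F (l n)"
      by (rule nn_integral_FTC_Icc) (use ul(2)[of n] I in \<open>auto intro!: D f0\<close>)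
    also have "\<dots> \<le> ennreal c" using ul(1,2,3)[of n] by (intro ennreal_leI bd less_imp_le)
    finally show "(\<integral>\<^sup>+ x. ennreal (f x) * indicator {l n..u n} x \<partial>lborel) \<le> ennreal c" .
  qed
  finally show ?thesis .
qed (simp add: indicator_def)

section \<open>Disc automorphisms and the area measure\<close>

lemma cnj_mult_less_1:
  assumes "cmod a < 1" "cmod z < 1"
  shows "cmod (cnj a * z) < 1"
proof -
  have "cmod a * cmod z \<le> cmod a * 1" using assms by (intro mult_left_mono) auto
  then show ?thesis using assms by (simp add: norm_mult)
qed

lemma one_minus_cnj_mult_nz:
  assumes "cmod a < 1" "cmod z < 1"
  shows "1 - cnj a * z \<noteq> 0"
  using cnj_mult_less_1[OF assms] by auto

lemma cmod_one_minus_cnj_ge: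
  assumes "cmod z < 1"
  shows "1 - cmod a \<le> cmod (1 - cnj a * z)"
proof -
  have "cmod a * cmod z \<le> cmod a * 1" using assms by (intro mult_left_mono) auto
  moreover have "1 - cmod (cnj a * z) \<le> cmod (1 - cnj a * z)" by (metis norm_one norm_triangle_ineq2)
  ultimately show ?thesis by (simp add: norm_mult)
qed

text \<open>The numerator comes from |1 - \<open>cnj a * z\<close>|^2 - |a - z|^2 = (1 - |a|^2) (1 -
  |z|^2).\<close>

lemma one_minus_disc_aut:
  assumes "cmod a < 1" "cmod z < 1"
  shows "1 - (cmod (disc_aut a z))\<^sup>2 = (1 - (cmod a)\<^sup>2) * (1 - (cmod z)\<^sup>2) / (cmod (1 - cnj a * z))\<^sup>2"
proof -
  have nz: "cmod (1 - cnj a * z) \<noteq> 0" using one_minus_cnj_mult_nz[OF assms] by simp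
  have "(cmod (1 - cnj a * z))\<^sup>2 - (cmod (a - z))\<^sup>2 = (1 - (cmod a)\<^sup>2) * (1 - (cmod z)\<^sup>2)"
    unfolding cmod_power2 by (simp add: algebra_simps power2_eq_square)
  then show ?thesis using nz
    by (simp add: disc_aut_def norm_divide power_divide field_simps)
qed

lemma disc_aut_in_disc:
  assumes "cmod a < 1" "cmod z < 1"
  shows "cmod (disc_aut a z) < 1"
proof -
  have "(cmod a)\<^sup>2 < 1" "(cmod z)\<^sup>2 < 1" using assms by (auto simp: power_less_one_iff abs_square_less_1)
  then have "0 < 1 - (cmod (disc_aut a z))\<^sup>2"
    unfolding one_minus_disc_aut[OF assms] using one_minus_cnj_mult_nz[OF assms] by auto
  then show ?thesis by (simp add: abs_square_less_1)
qed

text \<open>The two-point version of the identity for 1 - |phi_a(z)|^2, which is the case v = z. It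
  serves to compute compositions of automorphisms.\<close>

lemma one_minus_cnj_disc_aut:
  assumes "cmod a < 1" "cmod z < 1" "cmod v < 1"
  shows "1 - cnj (disc_aut a v) * disc_aut a z = (1 - (cmod a)\<^sup>2) * (1 - cnj v * z) / ((1 - a * cnj v) * (1 - cnj a * z))"
proof -
  have nz: "1 - cnj a * z \<noteq> 0" "1 - a * cnj v \<noteq> 0"
    using one_minus_cnj_mult_nz[of a z] one_minus_cnj_mult_nz[of v a] assms by (auto simp: mult.commute)
  have "complex_of_real ((cmod a)\<^sup>2) = a * cnj a" using complex_norm_square by auto
  then show ?thesis using nz
    unfolding disc_aut_def complex_cnj_divide complex_cnj_diff complex_cnj_mult complex_cnj_cnj complex_cnj_one
    by (simp add: divide_simps) (simp add: algebra_simps)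
qed

lemma disc_aut_involution:
  assumes "cmod a < 1" "cmod z < 1"
  shows "disc_aut a (disc_aut a z) = z"
proof -
  have nz: "1 - cnj a * z \<noteq> 0" "1 - cnj a * a \<noteq> 0"
    using one_minus_cnj_mult_nz assms by auto
  have "1 - cnj a * disc_aut a z = (1 - cnj a * a) / (1 - cnj a * z)"
    using nz by (simp add: disc_aut_def field_simps)
  moreover have "a - disc_aut a z = z * (1 - cnj a * a) / (1 - cnj a * z)"
    using nz by (simp add: disc_aut_def field_simps)
  ultimately show ?thesis using nz by (simp add: disc_aut_def[of a "disc_aut a z"])
qed

lemma disc_aut_image: "cmod a < 1 \<Longrightarrow> disc_aut a ` unit_disc = unit_disc"
  by (force simp: disc_aut_in_disc intro!: image_eqI[of z "disc_aut a" "disc_aut a z" for z] dest: disc_aut_involution)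

lemma inj_on_disc_aut: "cmod a < 1 \<Longrightarrow> inj_on (disc_aut a) unit_disc"
  by (rule inj_on_inverseI[of _ "disc_aut a"]) (auto simp: disc_aut_involution)

lemma has_field_derivative_disc_aut:
  assumes "cmod a < 1" "cmod z < 1"
  shows "(disc_aut a has_field_derivative (- (1 - (cmod a)\<^sup>2) / (1 - cnj a * z)\<^sup>2)) (at z)"
proof -
  have nz: "1 - cnj a * z \<noteq> 0" using one_minus_cnj_mult_nz[OF assms] by simp
  have "complex_of_real ((cmod a)\<^sup>2) = a * cnj a" using complex_norm_square by auto
  then have "- (1 - (cmod a)\<^sup>2) / (1 - cnj a * z)\<^sup>2 = ((0 - 1) * (1 - cnj a * z) - (a - z) * (0 - cnj a * 1)) / ((1 - cnj a * z) * (1 - cnj a * z))"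
    by (simp add: power2_eq_square algebra_simps)
  moreover have "((\<lambda>z. (a - z) / (1 - cnj a * z)) has_field_derivative ((0 - 1) * (1 - cnj a * z) - (a - z) * (0 - cnj a * 1)) / ((1 - cnj a * z) * (1 - cnj a * z))) (at z)"
    using nz by (intro DERIV_divide derivative_intros) (auto intro!: derivative_eq_intros)
  ultimately show ?thesis by (simp add: disc_aut_def[abs_def])
qed

lemma holomorphic_on_disc_aut: "cmod a < 1 \<Longrightarrow> disc_aut a holomorphic_on unit_disc"
  unfolding holomorphic_on_def field_differentiable_def
  using has_field_derivative_disc_aut has_field_derivative_at_within by (metis dist_0_norm mem_ball)

lemma cmod_deriv_disc_aut:
  assumes "cmod a < 1" "cmod z < 1"
  shows "cmod (deriv (disc_aut a) z) = (1 - (cmod a)\<^sup>2) / (cmod (1 - cnj a * z))\<^sup>2"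
proof -
  have "(cmod a)\<^sup>2 < 1" using assms by (auto simp: power_less_one_iff abs_square_less_1)
  have "deriv (disc_aut a) z = - (1 - (cmod a)\<^sup>2) / (1 - cnj a * z)\<^sup>2"
    using has_field_derivative_disc_aut[OF assms] by (rule DERIV_imp_deriv)
  also have "cmod \<dots> = cmod (complex_of_real (1 - (cmod a)\<^sup>2)) / (cmod (1 - cnj a * z))\<^sup>2"
    by (simp only: of_real_minus norm_divide norm_minus_cancel norm_power)
  also have "cmod (complex_of_real (1 - (cmod a)\<^sup>2)) = 1 - (cmod a)\<^sup>2"
    using \<open>(cmod a)\<^sup>2 < 1\<close> by (subst norm_of_real) simp
  finally show ?thesis .
qed

text \<open>phi_v after phi_a is an automorphism that vanishes at phi_a(v), so it is the
  automorphism with that zero up to a unimodular factor. The computation compares 1 minus the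
  squared modulus on both sides. The oscillation estimate uses this to move the centre of a
  weight.\<close>

lemma cmod_disc_aut_disc_aut:
  assumes "cmod a < 1" "cmod z < 1" "cmod v < 1"
  shows "cmod (disc_aut v (disc_aut a z)) = cmod (disc_aut (disc_aut a v) z)"
proof -
  let ?u = "disc_aut a v" and ?w = "disc_aut a z"
  have u: "cmod ?u < 1" and w: "cmod ?w < 1" using disc_aut_in_disc assms by auto
  have nz: "cmod (1 - cnj a * z) \<noteq> 0" "cmod (1 - cnj a * v) \<noteq> 0" "cmod (1 - cnj ?u * z) \<noteq> 0" "1 - (cmod a)\<^sup>2 \<noteq> 0"
    using one_minus_cnj_mult_nz assms u abs_square_less_1[of "cmod a"] by auto
  have e: "1 - cnj v * ?w = (1 - (cmod a)\<^sup>2) * (1 - cnj ?u * z) / ((1 - a * cnj ?u) * (1 - cnj a * z))"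
    using one_minus_cnj_disc_aut[OF assms(1,2) u] disc_aut_involution[OF assms(1,3)] by simp
  have "1 - cnj a * ?u = (1 - (cmod a)\<^sup>2) / (1 - cnj a * v)"
  proof -
    have "complex_of_real ((cmod a)\<^sup>2) = a * cnj a" using complex_norm_square by auto
    then show ?thesis using nz(2) by (simp add: disc_aut_def field_simps del: of_real_power)
  qed
  then have "cmod (1 - cnj a * ?u) = cmod (complex_of_real (1 - (cmod a)\<^sup>2) / (1 - cnj a * v))"
    by simp
  moreover have "cmod (1 - a * cnj ?u) = cmod (1 - cnj a * ?u)"
    by (subst complex_mod_cnj[symmetric]) simp
  ultimately have f: "cmod (1 - a * cnj ?u) = cmod (complex_of_real (1 - (cmod a)\<^sup>2)) / cmod (1 - cnj a * v)"
    by (simp add: norm_divide)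
  have g: "cmod (1 - cnj v * ?w) = cmod (complex_of_real (1 - (cmod a)\<^sup>2)) * cmod (1 - cnj ?u * z) / (cmod (1 - a * cnj ?u) * cmod (1 - cnj a * z))"
    unfolding e by (simp add: norm_mult norm_divide flip: of_real_power of_real_diff)
  have "cmod (complex_of_real (1 - (cmod a)\<^sup>2)) \<noteq> 0" using nz(4) by (metis norm_eq_zero of_real_eq_0_iff)
  then have h: "cmod (1 - cnj v * ?w) = cmod (1 - cnj ?u * z) * cmod (1 - cnj a * v) / cmod (1 - cnj a * z)"
    unfolding g f using nz by (simp add: field_simps)
  have "1 - (cmod (disc_aut v ?w))\<^sup>2 = (1 - (cmod v)\<^sup>2) * ((1 - (cmod a)\<^sup>2) * (1 - (cmod z)\<^sup>2) / (cmod (1 - cnj a * z))\<^sup>2) / (cmod (1 - cnj v * ?w))\<^sup>2"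
    by (simp only: one_minus_disc_aut[OF assms(3) w] one_minus_disc_aut[OF assms(1,2)])
  also have "\<dots> = ((1 - (cmod a)\<^sup>2) * (1 - (cmod v)\<^sup>2) / (cmod (1 - cnj a * v))\<^sup>2) * (1 - (cmod z)\<^sup>2) / (cmod (1 - cnj ?u * z))\<^sup>2"
    unfolding h using nz(1,2,3) by (simp add: power_divide power_mult_distrib mult_ac)
  also have "\<dots> = 1 - (cmod (disc_aut ?u z))\<^sup>2"
    by (simp only: one_minus_disc_aut[OF u assms(2)] one_minus_disc_aut[OF assms(1,3)])
  finally show ?thesis by (metis diff_left_imp_eq norm_ge_zero power2_eq_imp_eq)
qed

section \<open>Integration against the normalized area measure\<close>

lemma sets_area_measure [simp, measurable_cong]: "sets area_measure = sets (restrict_space borel unit_disc)"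
  by (simp add: area_measure_def sets_restrict_space)

lemma space_area_measure [simp]: "space area_measure = unit_disc"
  using sets_eq_imp_space_eq[OF sets_area_measure] by (simp add: space_restrict_space)

lemma measurable_area_measure_eq: "measurable area_measure N = measurable (restrict_space borel unit_disc) N"
  by (rule measurable_cong_sets) simp_all

lemma borel_measurable_area_measure_continuous:
  "continuous_on unit_disc f \<Longrightarrow> f \<in> borel_measurable area_measure"
  unfolding measurable_area_measure_eq by (rule borel_measurable_continuous_on_restrict)

lemma borel_measurable_area_measure_holomorphic:
  "H holomorphic_on unit_disc \<Longrightarrow> H \<in> borel_measurable area_measure"
  by (intro borel_measurable_area_measure_continuous holomorphic_on_imp_continuous_on)

lemma borel_measurable_area_measureI:
  "f \<in> borel_measurable borel \<Longrightarrow> f \<in> borel_measurable area_measure"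
  unfolding measurable_area_measure_eq by (rule measurable_restrict_space1)

lemma nn_integral_area_measure:
  assumes "f \<in> borel_measurable area_measure"
  shows "(\<integral>\<^sup>+ z. f z \<partial>area_measure) = ennreal (1 / pi) * (\<integral>\<^sup>+ z \<in> unit_disc. f z \<partial>lborel)"
proof -
  have "f \<in> borel_measurable (restrict_space lborel unit_disc)"
    using assms by (simp add: measurable_def space_restrict_space sets_restrict_space)
  then show ?thesis
    unfolding area_measure_def by (simp add: nn_integral_scale_measure nn_integral_restrict_space)
qed

lemma finite_measure_area_measure: "finite_measure area_measure"
  by (rule finite_measureI) (simp add: emeasure_area_measure_unit_disc)

interpretation area_measure: finite_measure area_measure
  by (rule finite_measure_area_measure)

lemma nn_integral_disc_aut:
  assumes a: "cmod a < 1" and u: "u \<in> borel_measurable area_measure"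
  shows "(\<integral>\<^sup>+ z. u z \<partial>area_measure) = (\<integral>\<^sup>+ w. ennreal ((cmod (deriv (disc_aut a) w))\<^sup>2) * u (disc_aut a w) \<partial>area_measure)"
proof -
  have u': "u \<in> borel_measurable (restrict_space borel (disc_aut a ` unit_disc))"
    using u unfolding disc_aut_image[OF a] measurable_area_measure_eq .
  have aut: "disc_aut a \<in> area_measure \<rightarrow>\<^sub>M area_measure"
  proof -
    have "disc_aut a \<in> area_measure \<rightarrow>\<^sub>M restrict_space borel unit_disc"
      using borel_measurable_area_measure_holomorphic[OF holomorphic_on_disc_aut[OF a]] disc_aut_in_disc[OF a]
      by (intro measurable_restrict_space2) auto
    also have "area_measure \<rightarrow>\<^sub>M restrict_space borel unit_disc = area_measure \<rightarrow>\<^sub>M area_measure"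
      by (rule measurable_cong_sets) simp_all
    finally show ?thesis .
  qed
  have m: "(\<lambda>w. ennreal ((cmod (deriv (disc_aut a) w))\<^sup>2) * u (disc_aut a w)) \<in> borel_measurable area_measure"
  proof -
    have "deriv (disc_aut a) \<in> borel_measurable area_measure"
      by (intro borel_measurable_area_measure_holomorphic holomorphic_deriv holomorphic_on_disc_aut a open_ball)
    then have "(\<lambda>w. ennreal ((cmod (deriv (disc_aut a) w))\<^sup>2)) \<in> borel_measurable area_measure"
      by (intro measurable_compose[OF _ measurable_ennreal] borel_measurable_power measurable_compose[OF _ borel_measurable_norm])
    then show ?thesis by (rule borel_measurable_times_ennreal) (rule measurable_compose[OF aut u])
  qed
  show ?thesis
    unfolding nn_integral_area_measure[OF u] nn_integral_area_measure[OF m]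
    using nn_integral_holomorphic_subst[OF open_ball holomorphic_on_disc_aut[OF a] inj_on_disc_aut[OF a] u']
    unfolding disc_aut_image[OF a] by (rule arg_cong)
qed

lemma nn_integral_open_eq_closed_interval:
  fixes f :: "real \<Rightarrow> ennreal"
  shows "(\<integral>\<^sup>+ x \<in> {a<..<b}. f x \<partial>lborel) = (\<integral>\<^sup>+ x \<in> {a..b}. f x \<partial>lborel)"
  by (rule nn_integral_cong_AE, use AE_lborel_singleton[of a] AE_lborel_singleton[of b] in eventually_elim)
    (auto simp: indicator_def)

lemma cmod_has_integral_le_nn_integral:
  fixes f :: "real \<Rightarrow> complex"
  assumes cont: "continuous_on {a..b} f" and I: "(f has_integral I) {a..b}"
  shows "ennreal (cmod I) \<le> (\<integral>\<^sup>+ t \<in> {a..b}. ennreal (cmod (f t)) \<partial>lborel)"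
proof -
  have int: "(\<lambda>t. cmod (f t)) integrable_on {a..b}"
    using cont by (intro integrable_continuous_interval continuous_intros)
  have "cmod (integral {a..b} f) \<le> integral {a..b} (\<lambda>t. cmod (f t))"
    using I int by (intro integral_norm_bound_integral) auto
  then have "ennreal (cmod I) \<le> ennreal (integral {a..b} (\<lambda>t. cmod (f t)))"
    using I by (intro ennreal_leI) (simp add: integral_unique)
  also have "\<dots> = (\<integral>\<^sup>+ t \<in> {a..b}. ennreal (cmod (f t)) \<partial>lborel)"
    using int by (intro nn_integral_has_integral_lebesgue'[symmetric] integrable_integral) auto
  finally show ?thesis .
qed

section \<open>Subharmonicity of powers of the modulus\<close>

lemma cis_borel_measurable [measurable]: "cis \<in> borel_measurable borel"
  by (intro borel_measurable_continuous_onI continuous_intros)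

text \<open>Cauchy's integral formula on the circle of radius r, with the modulus taken inside the
  integral.\<close>

lemma Cauchy_mean_value_le:
  assumes H: "H holomorphic_on ball z R" and r: "0 < r" "r < R"
  shows "ennreal (2 * pi * cmod (H z)) \<le> (\<integral>\<^sup>+ \<theta> \<in> {-pi<..<pi}. ennreal (cmod (H (z + rcis r \<theta>))) \<partial>lborel)"
proof -
  \<comment> \<open>The circle is parametrized over 0 to 2 pi, whereas polar coordinates use -pi to
    pi. The half turn about z, which fixes z, compensates the shift of the angle by pi, since
    \<open>cis (pi + \<theta>) = - cis \<theta>\<close>.\<close>
  define G where "G = (\<lambda>w. H (2 * z - w))"
  have G: "G holomorphic_on ball z R"
    unfolding G_def using H
    by (intro holomorphic_on_compose[of "\<lambda>w. 2 * z - w" _ H, unfolded o_def] holomorphic_intros)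
      (auto elim!: holomorphic_on_subset simp: dist_norm norm_minus_commute algebra_simps)
  have on: "z + of_real r * cis t \<in> ball z R" for t
    using r by (auto simp: dist_norm norm_mult)
  have "G holomorphic_on cball z r"
    using G r by (elim holomorphic_on_subset) auto
  then have "((\<lambda>u. G u / (u - z)) has_contour_integral (2 * of_real pi * \<i> * G z)) (circlepath z r)"
    using r by (intro Cauchy_integral_circlepath_simple) auto
  then have "((\<lambda>t. G (z + r * cis t) / (z + r * cis t - z) * r * \<i> * cis t) has_integral (2 * of_real pi * \<i> * G z)) {0..2*pi}"
    unfolding circlepath_def by (subst (asm) has_contour_integral_part_circlepath_iff) auto
  moreover have "G (z + r * cis t) / (z + r * cis t - z) * r * \<i> * cis t = \<i> * G (z + r * cis t)" for t
    using r by simp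
  ultimately have I: "((\<lambda>t. \<i> * G (z + r * cis t)) has_integral (2 * of_real pi * \<i> * G z)) {0..2*pi}"
    by (simp only:)
  have cont: "continuous_on UNIV (\<lambda>t. G (z + r * cis t))"
    by (rule continuous_on_compose2[OF holomorphic_on_imp_continuous_on[OF G]]) (use on in \<open>auto intro!: continuous_intros\<close>)
  have [measurable]: "(\<lambda>t. G (z + r * cis t)) \<in> borel_measurable borel"
    using cont by (rule borel_measurable_continuous_onI)
  have "ennreal (2 * pi * cmod (H z)) = ennreal (cmod (2 * of_real pi * \<i> * G z))"
    by (simp add: G_def norm_mult)
  also have "\<dots> \<le> (\<integral>\<^sup>+ t \<in> {0..2*pi}. ennreal (cmod (\<i> * G (z + r * cis t))) \<partial>lborel)"
    using continuous_on_subset[OF cont] by (intro cmod_has_integral_le_nn_integral[OF _ I] continuous_intros) auto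
  also have "\<dots> = (\<integral>\<^sup>+ t. ennreal (cmod (G (z + r * cis t))) * indicator {0<..<2*pi} t \<partial>lborel)"
    by (subst nn_integral_open_eq_closed_interval[symmetric]) (simp add: norm_mult)
  also have "\<dots> = (\<integral>\<^sup>+ \<theta>. ennreal (cmod (G (z + r * cis (pi + 1 * \<theta>)))) * indicator {0<..<2*pi} (pi + 1 * \<theta>) \<partial>lborel)"
    by (subst nn_integral_real_affine[where c = 1 and t = pi]) auto
  also have "\<dots> = (\<integral>\<^sup>+ \<theta> \<in> {-pi<..<pi}. ennreal (cmod (H (z + rcis r \<theta>))) \<partial>lborel)"
  proof (rule nn_integral_cong)
    fix \<theta> :: real
    have "cis (pi + 1 * \<theta>) = - cis \<theta>" by (simp flip: cis_mult)
    then have "G (z + r * cis (pi + 1 * \<theta>)) = H (z + rcis r \<theta>)"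
      by (simp add: G_def rcis_def algebra_simps)
    then show "ennreal (cmod (G (z + r * cis (pi + 1 * \<theta>)))) * indicator {0<..<2*pi} (pi + 1 * \<theta>) = ennreal (cmod (H (z + rcis r \<theta>))) * indicator {-pi<..<pi} \<theta>"
      by (auto simp: indicator_def)
  qed
  finally show ?thesis .
qed

text \<open>The mean value inequality on circles is multiplied by r and integrated over 0 < r < R;
  polar coordinates assemble the area integral.\<close>

lemma submean_value:
  assumes H: "H holomorphic_on ball z R" and R: "0 < R"
  shows "ennreal (pi * R\<^sup>2 * cmod (H z)) \<le> (\<integral>\<^sup>+ w \<in> ball z R. ennreal (cmod (H w)) \<partial>lborel)"
proof -
  \<comment> \<open>The cut-off makes the function Borel on the whole plane, as polar coordinates
    require; \<open>H\<close> is controlled on the ball only.\<close>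
  define u where "u = (\<lambda>w. ennreal (indicator (ball 0 R) w *\<^sub>R cmod (H (z + w))))"
  have cont: "continuous_on (ball 0 R) (\<lambda>w. cmod (H (z + w)))"
    by (intro continuous_intros continuous_on_compose2[OF holomorphic_on_imp_continuous_on[OF H]])
      (auto simp: dist_norm)
  have m0: "(\<lambda>w. indicator (ball 0 R) w *\<^sub>R cmod (H (z + w))) \<in> borel_measurable borel"
    by (intro borel_measurable_continuous_on_indicator cont) auto
  then have [measurable]: "u \<in> borel_measurable borel" unfolding u_def by measurable
  have mv: "(\<lambda>w. ennreal (cmod (H w)) * indicator (ball z R) w) \<in> borel_measurable lborel"
  proof -
    have "(\<lambda>w. indicator (ball z R) w *\<^sub>R cmod (H w)) \<in> borel_measurable borel"
      by (intro borel_measurable_continuous_on_indicator continuous_intros holomorphic_on_imp_continuous_on[OF H]) auto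
    then have "(\<lambda>w. ennreal (indicator (ball z R) w *\<^sub>R cmod (H w))) \<in> borel_measurable borel" by measurable
    moreover have "(\<lambda>w. ennreal (indicator (ball z R) w *\<^sub>R cmod (H w))) = (\<lambda>w. ennreal (cmod (H w)) * indicator (ball z R) w)"
      by (auto simp: indicator_def fun_eq_iff)
    ultimately show ?thesis by (simp only: measurable_lborel1 measurable_lborel2)
  qed
  have "ennreal (pi * R\<^sup>2 * cmod (H z)) = ennreal (2 * pi * cmod (H z)) * ennreal (R\<^sup>2 / 2 - 0\<^sup>2 / 2)"
    using R by (simp add: ennreal_mult'[symmetric] mult_ac)
  also have "ennreal (R\<^sup>2 / 2 - 0\<^sup>2 / 2) = (\<integral>\<^sup>+ r. ennreal r * indicator {0..R} r \<partial>lborel)"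
    by (rule nn_integral_FTC_Icc[symmetric]) (use R in \<open>auto intro!: derivative_eq_intros\<close>)
  also have "\<dots> = (\<integral>\<^sup>+ r \<in> {0<..<R}. ennreal r \<partial>lborel)"
    by (rule nn_integral_open_eq_closed_interval[symmetric])
  also have "ennreal (2 * pi * cmod (H z)) * \<dots> = (\<integral>\<^sup>+ r. ennreal (2 * pi * cmod (H z)) * (ennreal r * indicator {0<..<R} r) \<partial>lborel)"
    by (rule nn_integral_cmult[symmetric]) auto
  also have "\<dots> \<le> (\<integral>\<^sup>+ r. (\<integral>\<^sup>+ \<theta>. (u (rcis r \<theta>) * ennreal r * indicator {0<..} r) * indicator {-pi<..<pi} \<theta> \<partial>lborel) \<partial>lborel)"
  proof (rule nn_integral_mono)
    fix r :: real
    show "ennreal (2 * pi * cmod (H z)) * (ennreal r * indicator {0<..<R} r) \<le> (\<integral>\<^sup>+ \<theta>. (u (rcis r \<theta>) * ennreal r * indicator {0<..} r) * indicator {-pi<..<pi} \<theta> \<partial>lborel)"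
    proof (cases "r \<in> {0<..<R}")
      case True
      then have r: "0 < r" "r < R" by auto
      have "ennreal (2 * pi * cmod (H z)) * (ennreal r * indicator {0<..<R} r) \<le> (\<integral>\<^sup>+ \<theta> \<in> {-pi<..<pi}. ennreal (cmod (H (z + rcis r \<theta>))) \<partial>lborel) * ennreal r"
        using True Cauchy_mean_value_le[OF H r] by (simp add: mult_right_mono)
      also have "(\<integral>\<^sup>+ \<theta> \<in> {-pi<..<pi}. ennreal (cmod (H (z + rcis r \<theta>))) \<partial>lborel) = (\<integral>\<^sup>+ \<theta> \<in> {-pi<..<pi}. u (rcis r \<theta>) \<partial>lborel)"
        using r by (simp add: u_def norm_mult rcis_def)
      also have "\<dots> * ennreal r = (\<integral>\<^sup>+ \<theta>. u (rcis r \<theta>) * indicator {-pi<..<pi} \<theta> * ennreal r \<partial>lborel)"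
        by (rule nn_integral_multc[symmetric]) (simp add: rcis_def)
      also have "\<dots> = (\<integral>\<^sup>+ \<theta>. (u (rcis r \<theta>) * ennreal r * indicator {0<..} r) * indicator {-pi<..<pi} \<theta> \<partial>lborel)"
        using r by (simp add: mult_ac)
      finally show ?thesis .
    qed auto
  qed
  also have "\<dots> = (\<integral>\<^sup>+ \<theta>. (\<integral>\<^sup>+ r. (u (rcis r \<theta>) * ennreal r * indicator {0<..} r) * indicator {-pi<..<pi} \<theta> \<partial>lborel) \<partial>lborel)"
    by (rule lborel_pair.Fubini') (simp add: rcis_def)
  also have "\<dots> = (\<integral>\<^sup>+ \<theta> \<in> {-pi<..<pi}. (\<integral>\<^sup>+ r \<in> {0<..}. (u (rcis r \<theta>) * ennreal r) \<partial>lborel) \<partial>lborel)"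
    by (intro nn_integral_cong nn_integral_multc) (simp add: rcis_def)
  also have "\<dots> = (\<integral>\<^sup>+ w. u w \<partial>lborel)"
    by (rule nn_integral_polar[symmetric]) simp
  also have "\<dots> = (\<integral>\<^sup>+ w. ennreal (cmod (H (z + w))) * indicator (ball z R) (z + w) \<partial>lborel)"
    by (intro nn_integral_cong) (auto simp: u_def indicator_def dist_norm)
  also have "\<dots> = (\<integral>\<^sup>+ w \<in> ball z R. ennreal (cmod (H w)) \<partial>distr lborel borel ((+) z))"
    using mv by (subst nn_integral_distr) auto
  finally show ?thesis by (simp only: lborel_distr_plus)
qed

text \<open>By convexity the tangent of x powr q at c lies below the graph. For positive x and c
  this is Young's inequality.\<close>

lemma powr_tangent_le:
  assumes "1 \<le> q" "0 \<le> x" "0 \<le> (c::real)"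
  shows "q * c powr (q - 1) * x \<le> x powr q + (q - 1) * c powr q"
proof (cases "x = 0 \<or> c = 0")
  case False
  then have "x \<noteq> 0" "c \<noteq> 0" by blast+
  then have "0 < x" "0 < c" using assms by linarith+
  have "(x powr q) powr (1 / q) * (c powr q) powr (1 - 1 / q) \<le> (1 / q) * x powr q + (1 - 1 / q) * c powr q"
    using assms \<open>0 < x\<close> \<open>0 < c\<close> by (intro Youngs_inequality_0) (auto simp: field_simps)
  moreover have "(x powr q) powr (1 / q) = x" using assms \<open>0 < x\<close> by (simp add: powr_powr)
  moreover have "(c powr q) powr (1 - 1 / q) = c powr (q - 1)"
    using assms by (simp add: powr_powr right_diff_distrib)
  ultimately have "q * (x * c powr (q - 1)) \<le> q * ((1 / q) * x powr q + (1 - 1 / q) * c powr q)"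
    using assms by (intro mult_left_mono) auto
  also have "\<dots> = x powr q + (q - 1) * c powr q"
    using assms by (simp add: algebra_simps)
  finally show ?thesis by (simp add: mult_ac)
next
  case True
  then have "q * c powr (q - 1) * x = 0" by auto
  moreover have "0 \<le> x powr q + (q - 1) * c powr q" using assms by simp
  ultimately show ?thesis by (simp only:)
qed

text \<open>Jensen's inequality through the tangent at c = |H z|: the inequality for |H| is
  multiplied by q c powr (q - 1), and subtracting the constant term of the tangent leaves one copy
  of R^2 c powr q. This subtraction is why the infinite case is split off. No pi appears because the
  disc has normalized area R^2.\<close>

lemma submean_value_powr:
  assumes H: "H holomorphic_on unit_disc" and R: "0 < R" "ball z R \<subseteq> unit_disc" and q: "1 \<le> q"
  shows "ennreal (R\<^sup>2 * cmod (H z) powr q) \<le> (\<integral>\<^sup>+ w \<in> ball z R. ennreal (cmod (H w) powr q) \<partial>area_measure)"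
    (is "_ \<le> ?I")
proof (cases "?I = \<infinity>")
  case False
  have [measurable]: "H \<in> borel_measurable area_measure"
    by (rule borel_measurable_area_measure_holomorphic[OF H])
  have [measurable]: "(indicator (ball z R) :: complex \<Rightarrow> ennreal) \<in> borel_measurable area_measure"
    by (rule borel_measurable_area_measureI[OF borel_measurable_indicator]) simp
  have ball_eq: "indicator (ball z R) w * indicator unit_disc w = (indicator (ball z R) w :: ennreal)" for w
    using R(2) by (auto simp: indicator_def)
  let ?c = "cmod (H z)"
  have vol: "(\<integral>\<^sup>+ w. indicator (ball z R) w \<partial>area_measure) = ennreal (R\<^sup>2)"
  proof -
    have "(\<integral>\<^sup>+ w. indicator (ball z R) w \<partial>area_measure) = ennreal (1 / pi) * emeasure lborel (ball z R)"
      by (subst nn_integral_area_measure) (simp_all add: ball_eq)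
    also have "\<dots> = ennreal (R\<^sup>2)"
      using R by (simp add: emeasure_ball unit_ball_vol_2 flip: ennreal_mult)
    finally show ?thesis .
  qed
  have mean: "ennreal (R\<^sup>2 * ?c) \<le> (\<integral>\<^sup>+ w \<in> ball z R. ennreal (cmod (H w)) \<partial>area_measure)"
  proof -
    have "ennreal (R\<^sup>2 * ?c) = ennreal (1 / pi) * ennreal (pi * R\<^sup>2 * ?c)"
      by (simp flip: ennreal_mult')
    also have "\<dots> \<le> ennreal (1 / pi) * (\<integral>\<^sup>+ w \<in> ball z R. ennreal (cmod (H w)) \<partial>lborel)"
      using H R by (intro mult_left_mono submean_value) (auto elim: holomorphic_on_subset)
    also have "\<dots> = (\<integral>\<^sup>+ w \<in> ball z R. ennreal (cmod (H w)) \<partial>area_measure)"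
      by (subst nn_integral_area_measure) (simp_all add: ball_eq mult.assoc)
    finally show ?thesis .
  qed
  have "ennreal (q * ?c powr (q - 1)) * ennreal (R\<^sup>2 * ?c) \<le> ennreal (q * ?c powr (q - 1)) * (\<integral>\<^sup>+ w \<in> ball z R. ennreal (cmod (H w)) \<partial>area_measure)"
    using mean by (rule mult_left_mono) simp
  also have "\<dots> = (\<integral>\<^sup>+ w. ennreal (q * ?c powr (q - 1)) * (ennreal (cmod (H w)) * indicator (ball z R) w) \<partial>area_measure)"
    by (rule nn_integral_cmult[symmetric]) measurable
  also have "\<dots> \<le> (\<integral>\<^sup>+ w. ennreal (cmod (H w) powr q) * indicator (ball z R) w + ennreal ((q - 1) * ?c powr q) * indicator (ball z R) w \<partial>area_measure)"
    using powr_tangent_le[OF q] q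
    by (intro nn_integral_mono) (auto simp: indicator_def simp flip: ennreal_mult' ennreal_plus intro!: ennreal_leI)
  also have "\<dots> = ?I + ennreal ((q - 1) * ?c powr q) * ennreal (R\<^sup>2)"
    by (subst nn_integral_add) (simp_all add: nn_integral_cmult vol)
  finally have le: "ennreal (q * ?c powr (q - 1)) * ennreal (R\<^sup>2 * ?c) \<le> ?I + ennreal ((q - 1) * ?c powr q) * ennreal (R\<^sup>2)" .
  obtain I where I: "0 \<le> I" "?I = ennreal I"
    using False by (cases ?I rule: ennreal_cases) auto
  have "q * ?c powr (q - 1) * (R\<^sup>2 * ?c) \<le> I + (q - 1) * ?c powr q * R\<^sup>2"
  proof -
    have "ennreal (q * ?c powr (q - 1) * (R\<^sup>2 * ?c)) \<le> ennreal (I + (q - 1) * ?c powr q * R\<^sup>2)"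
      using le I q by (simp add: ennreal_mult' ennreal_plus mult_ac)
    then show ?thesis using I q by (subst (asm) ennreal_le_iff) auto
  qed
  moreover have "?c powr (q - 1) * ?c = ?c powr q"
    using powr_mult_base[of ?c "q - 1"] by (simp add: mult.commute)
  then have "q * ?c powr (q - 1) * (R\<^sup>2 * ?c) = q * R\<^sup>2 * ?c powr q"
    by (metis mult.assoc mult.commute)
  ultimately have "q * R\<^sup>2 * ?c powr q \<le> I + (q - 1) * ?c powr q * R\<^sup>2" by (simp only:)
  then have "R\<^sup>2 * ?c powr q \<le> I" by (simp add: algebra_simps)
  then show ?thesis using I by (simp add: ennreal_leI)
qed simp

section \<open>Radial estimates\<close>

abbreviation besov_integral :: "real \<Rightarrow> (complex \<Rightarrow> complex) \<Rightarrow> ennreal" where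
  "besov_integral p f \<equiv> \<integral>\<^sup>+ z. ennreal ((1 - cmod z) powr (p - 2) * cmod (deriv f z) powr p) \<partial>area_measure"

abbreviation Q_density :: "real \<Rightarrow> (complex \<Rightarrow> complex) \<Rightarrow> complex \<Rightarrow> complex \<Rightarrow> ennreal" where
  "Q_density s f a z \<equiv> ennreal ((cmod (deriv f z))\<^sup>2 * (1 - (cmod (disc_aut a z))\<^sup>2) powr s)"

lemma id_borel_measurable_area_measure [measurable]: "(\<lambda>x. x) \<in> borel_measurable area_measure"
  by (rule borel_measurable_area_measureI) simp

text \<open>The discs \<open>ball u ((1 - |u|) / 2)\<close> with \<open>u\<close> on the segment from \<open>0\<close> to \<open>w\<close> lie in this region.\<close>
definition cone :: "complex \<Rightarrow> complex set" where
  "cone w = {v. cmod (1 - cnj v * w) \<le> 5 * (1 - cmod v)}"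

lemma cone_borel [measurable]: "cone w \<in> sets borel"
  unfolding cone_def by (intro borel_closed closed_Collect_le continuous_intros)

text \<open>Comparable numbers have comparable powers; the absolute value in the constant serves
  exponents of both signs.\<close>

lemma powr_ratio_le:
  fixes x y :: real
  assumes "0 < x" "0 < y" "x \<le> 2 * y" "y \<le> 2 * x"
  shows "x powr b \<le> 2 powr \<bar>b\<bar> * y powr b"
proof (cases "b \<ge> 0")
  case True
  then have "x powr b \<le> (2 * y) powr b" using assms by (intro powr_mono2) auto
  then show ?thesis using True assms by (simp add: powr_mult)
next
  case False
  then have "x powr b \<le> (y / 2) powr b" using assms by (intro powr_mono2') auto
  then show ?thesis using False assms by (simp add: powr_divide powr_minus field_simps)
qed

text \<open>The value at a radial point is replaced by the mean over the disc of radius (1 - \<rho>)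
  / 2, and the order of integration is exchanged. A point v lies in these discs only for \<rho> in
  an interval of length 2 (1 - |v|), which raises the power from \<beta> - 2 to \<beta> - 1. The
  factor 8 is 4 from the squared radius times 2 from this length.\<close>

lemma radial_estimate:
  assumes H: "H holomorphic_on unit_disc" and q: "1 \<le> q" and e: "cmod e = 1" and T: "0 \<le> T" "T < 1"
  shows "(\<integral>\<^sup>+ \<rho> \<in> {0..T}. ennreal (cmod (H (of_real \<rho> * e)) powr q * (1 - \<rho>) powr \<beta>) \<partial>lborel)
    \<le> ennreal (8 * 2 powr \<bar>\<beta> - 2\<bar>) * (\<integral>\<^sup>+ v \<in> cone (of_real T * e). ennreal (cmod (H v) powr q * (1 - cmod v) powr (\<beta> - 1)) \<partial>area_measure)"
proof -
  interpret pair_sigma_finite lborel area_measure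
    by (intro pair_sigma_finite.intro sigma_finite_lborel area_measure.sigma_finite_measure_axioms)
  have [measurable]: "H \<in> borel_measurable area_measure"
    by (rule borel_measurable_area_measure_holomorphic[OF H])
  have [measurable]: "(\<lambda>p. snd p) \<in> borel_measurable (lborel \<Otimes>\<^sub>M area_measure)"
    by (rule measurable_compose[OF measurable_snd id_borel_measurable_area_measure])
  define K where "K = 4 * 2 powr \<bar>\<beta> - 2\<bar>"
  have K: "0 \<le> K" by (simp add: K_def)
  define B where "B = (\<lambda>(\<rho>, v). 0 \<le> \<rho> \<and> \<rho> \<le> T \<and> dist (of_real \<rho> * e) v < (1 - \<rho>) / 2)"
  have [measurable]: "Measurable.pred (lborel \<Otimes>\<^sub>M area_measure) B"
    unfolding B_def by measurable
  have Bv: "1 - \<rho> \<le> 2 * (1 - cmod v) \<and> 1 - cmod v \<le> 2 * (1 - \<rho>) \<and> v \<in> cone (of_real T * e) \<and> 0 < 1 - cmod v" if "B (\<rho>, v)" for \<rho> v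
  proof -
    have \<rho>: "0 \<le> \<rho>" "\<rho> \<le> T" "cmod (of_real \<rho> * e - v) < (1 - \<rho>) / 2" using that by (auto simp: B_def dist_norm)
    have c: "cmod (of_real \<rho> * e) = \<rho>" using \<rho> e by (simp add: norm_mult)
    have "cmod v \<le> cmod (of_real \<rho> * e) + cmod (of_real \<rho> * e - v)" by (metis norm_minus_commute norm_triangle_sub)
    moreover have "cmod (of_real \<rho> * e) \<le> cmod v + cmod (of_real \<rho> * e - v)" by (metis norm_triangle_sub)
    ultimately have "cmod v < \<rho> + (1 - \<rho>) / 2" "\<rho> < cmod v + (1 - \<rho>) / 2"
      using \<rho>(3) unfolding c by linarith+
    then have 1: "1 - \<rho> \<le> 2 * (1 - cmod v)" "1 - cmod v \<le> 2 * (1 - \<rho>)"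
      using T \<rho>(2) by (simp_all add: field_simps)
    have "cnj e * e = 1" using e complex_norm_square[of e] by (simp add: mult.commute)
    \<comment> \<open>Splitting off the centre \<rho> e leaves 1 - \<rho> T \<le> 1 - \<rho>^2 \<le>
      2 (1 - \<rho>) and an error below (1 - \<rho>) / 2. The total is at most 5/2 (1 - \<rho>), and
      1 - \<rho> \<le> 2 (1 - |v|) explains the 5 in \<open>cone\<close>.\<close>
    then have "1 - cnj v * (of_real T * e) = of_real (1 - \<rho> * T) + of_real T * e * cnj (of_real \<rho> * e - v)"
      by (simp add: algebra_simps)
    also have "cmod \<dots> \<le> cmod (of_real (1 - \<rho> * T)) + cmod (of_real T * e * cnj (of_real \<rho> * e - v))"
      by (rule norm_triangle_ineq)
    also have "cmod (of_real (1 - \<rho> * T) :: complex) = 1 - \<rho> * T"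
    proof -
      have "\<rho> * T \<le> 1 * 1" using \<rho> T by (intro mult_mono) auto
      then show ?thesis unfolding norm_of_real by simp
    qed
    also have "cmod (of_real T * e * cnj (of_real \<rho> * e - v)) = T * cmod (of_real \<rho> * e - v)"
      using T e by (simp add: norm_mult del: complex_cnj_diff complex_cnj_mult)
    also have "T * cmod (of_real \<rho> * e - v) \<le> 1 * cmod (of_real \<rho> * e - v)"
      using T by (intro mult_right_mono) auto
    finally have "cmod (1 - cnj v * (of_real T * e)) \<le> 1 - \<rho> * T + (1 - \<rho>) / 2" using \<rho>(3) by linarith
    moreover have "\<rho> * \<rho> \<le> \<rho> * T" using \<rho> by (intro mult_left_mono) auto
    moreover have "1 - \<rho> * \<rho> \<le> 2 * (1 - \<rho>)" using sum_squares_ge_zero[of "1 - \<rho>" 0] by (simp add: algebra_simps)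
    ultimately have "cmod (1 - cnj v * (of_real T * e)) \<le> 2 * (1 - \<rho>) + (1 - \<rho>) / 2"
      by (elim order_trans) simp
    also have "\<dots> \<le> 5 * (1 - cmod v)" using 1 by (simp add: field_simps)
    finally have "v \<in> cone (of_real T * e)" by (simp add: cone_def)
    then show ?thesis using 1 \<rho> T by auto
  qed
  let ?g = "\<lambda>v. ennreal (K * (cmod (H v) powr q * (1 - cmod v) powr (\<beta> - 2)))"
  have "(\<integral>\<^sup>+ \<rho> \<in> {0..T}. ennreal (cmod (H (of_real \<rho> * e)) powr q * (1 - \<rho>) powr \<beta>) \<partial>lborel)
    \<le> (\<integral>\<^sup>+ \<rho>. \<integral>\<^sup>+ v. ?g v * (if B (\<rho>, v) then 1 else 0) \<partial>area_measure \<partial>lborel)"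
  proof (rule nn_integral_mono)
    fix \<rho> :: real
    show "ennreal (cmod (H (of_real \<rho> * e)) powr q * (1 - \<rho>) powr \<beta>) * indicator {0..T} \<rho> \<le> (\<integral>\<^sup>+ v. ?g v * (if B (\<rho>, v) then 1 else 0) \<partial>area_measure)"
    proof (cases "\<rho> \<in> {0..T}")
      case True
      then have \<rho>: "0 \<le> \<rho>" "\<rho> \<le> T" "0 < 1 - \<rho>" using T by auto
      define R where "R = (1 - \<rho>) / 2"
      have R: "0 < R" "ball (of_real \<rho> * e) R \<subseteq> unit_disc"
      proof -
        show "0 < R" using \<rho> by (simp add: R_def)
        show "ball (of_real \<rho> * e) R \<subseteq> unit_disc"
        proof
          fix v assume "v \<in> ball (of_real \<rho> * e) R"
          then have "B (\<rho>, v)" using \<rho> by (simp add: B_def R_def)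
          from Bv[OF this] show "v \<in> unit_disc" by simp
        qed
      qed
      have "ennreal (cmod (H (of_real \<rho> * e)) powr q * (1 - \<rho>) powr \<beta>) = ennreal (4 * (1 - \<rho>) powr (\<beta> - 2)) * ennreal (R\<^sup>2 * cmod (H (of_real \<rho> * e)) powr q)"
      proof -
        have "(1 - \<rho>) powr \<beta> = (1 - \<rho>) powr (\<beta> - 2) * (1 - \<rho>)\<^sup>2"
          using \<rho> by (simp add: powr_diff powr_numeral)
        then show ?thesis by (simp add: R_def power_divide mult_ac flip: ennreal_mult')
      qed
      also have "\<dots> \<le> ennreal (4 * (1 - \<rho>) powr (\<beta> - 2)) * (\<integral>\<^sup>+ w \<in> ball (of_real \<rho> * e) R. ennreal (cmod (H w) powr q) \<partial>area_measure)"
        using R by (intro mult_left_mono submean_value_powr[OF H _ _ q]) auto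
      also have "\<dots> = (\<integral>\<^sup>+ w. ennreal (4 * (1 - \<rho>) powr (\<beta> - 2)) * (ennreal (cmod (H w) powr q) * indicator (ball (of_real \<rho> * e) R) w) \<partial>area_measure)"
        by (rule nn_integral_cmult[symmetric]) (use borel_measurable_area_measureI[OF borel_measurable_indicator[of "ball (of_real \<rho> * e) R"]] in measurable)
      also have "\<dots> \<le> (\<integral>\<^sup>+ v. ?g v * (if B (\<rho>, v) then 1 else 0) \<partial>area_measure)"
      proof (rule nn_integral_mono)
        fix v
        show "ennreal (4 * (1 - \<rho>) powr (\<beta> - 2)) * (ennreal (cmod (H v) powr q) * indicator (ball (of_real \<rho> * e) R) v) \<le> ?g v * (if B (\<rho>, v) then 1 else 0)"
        proof (cases "v \<in> ball (of_real \<rho> * e) R")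
          case True
          then have B: "B (\<rho>, v)" using \<rho> by (simp add: B_def R_def)
          have "(1 - \<rho>) powr (\<beta> - 2) \<le> 2 powr \<bar>\<beta> - 2\<bar> * (1 - cmod v) powr (\<beta> - 2)"
            using Bv[OF B] \<rho> by (intro powr_ratio_le) auto
          then have "4 * (1 - \<rho>) powr (\<beta> - 2) * cmod (H v) powr q \<le> K * (1 - cmod v) powr (\<beta> - 2) * cmod (H v) powr q"
            by (intro mult_right_mono) (auto simp: K_def)
          then show ?thesis using True B by (simp add: mult_ac flip: ennreal_mult') (simp add: ennreal_leI mult_ac)
        qed simp
      qed
      finally show ?thesis using True by simp
    qed simp
  qed
  also have "\<dots> = (\<integral>\<^sup>+ v. \<integral>\<^sup>+ \<rho>. ?g v * (if B (\<rho>, v) then 1 else 0) \<partial>lborel \<partial>area_measure)"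
    by (rule Fubini'[symmetric]) measurable
  also have "\<dots> \<le> (\<integral>\<^sup>+ v. ennreal (2 * K) * (ennreal (cmod (H v) powr q * (1 - cmod v) powr (\<beta> - 1)) * indicator (cone (of_real T * e)) v) \<partial>area_measure)"
  proof (rule nn_integral_mono)
    fix v assume "v \<in> space area_measure"
    then have v: "0 < 1 - cmod v" by simp
    show "(\<integral>\<^sup>+ \<rho>. ?g v * (if B (\<rho>, v) then 1 else 0) \<partial>lborel) \<le> ennreal (2 * K) * (ennreal (cmod (H v) powr q * (1 - cmod v) powr (\<beta> - 1)) * indicator (cone (of_real T * e)) v)"
    proof (cases "v \<in> cone (of_real T * e)")
      case True
      have "(\<integral>\<^sup>+ \<rho>. ?g v * (if B (\<rho>, v) then 1 else 0) \<partial>lborel) \<le> (\<integral>\<^sup>+ \<rho>. ?g v * indicator {1 - 2 * (1 - cmod v)..1} \<rho> \<partial>lborel)"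
      proof (intro nn_integral_mono mult_left_mono)
        fix \<rho> :: real
        have "\<rho> \<in> {1 - 2 * (1 - cmod v)..1}" if B: "B (\<rho>, v)"
        proof -
          have "\<rho> \<le> T" using B by (simp add: B_def)
          then show ?thesis using Bv[OF B] T(2) by auto
        qed
        then show "(if B (\<rho>, v) then 1 else 0) \<le> (indicator {1 - 2 * (1 - cmod v)..1} \<rho> :: ennreal)"
          by (cases "B (\<rho>, v)") simp_all
      qed simp
      also have "\<dots> = ?g v * ennreal (2 * (1 - cmod v))"
        using v by (subst nn_integral_cmult_indicator) auto
      also have "\<dots> = ennreal (2 * K) * (ennreal (cmod (H v) powr q * (1 - cmod v) powr (\<beta> - 1)))"
      proof -
        have "(1 - cmod v) powr (\<beta> - 1) = (1 - cmod v) powr (\<beta> - 2) * (1 - cmod v)"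
          using v powr_add[of "1 - cmod v" "\<beta> - 2" 1] by simp
        then show ?thesis using K v by (simp add: mult_ac flip: ennreal_mult')
      qed
      finally show ?thesis using True by simp
    next
      case False
      then have "\<not> B (\<rho>, v)" for \<rho> using Bv by blast
      then show ?thesis by simp
    qed
  qed
  also have "\<dots> = ennreal (2 * K) * (\<integral>\<^sup>+ v \<in> cone (of_real T * e). ennreal (cmod (H v) powr q * (1 - cmod v) powr (\<beta> - 1)) \<partial>area_measure)"
    by (rule nn_integral_cmult) measurable
  finally show ?thesis by (simp add: K_def)
qed

lemma radial_FTC:
  assumes F: "F holomorphic_on unit_disc" and e: "cmod e = 1" and T: "0 \<le> T" "T < 1"
  shows "ennreal (cmod (F (of_real T * e) - F 0)) \<le> (\<integral>\<^sup>+ \<rho> \<in> {0..T}. ennreal (cmod (deriv F (of_real \<rho> * e))) \<partial>lborel)"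
proof -
  have on: "of_real t * e \<in> unit_disc" if "t \<in> {0..T}" for t using that T e by (simp add: norm_mult)
  have "((\<lambda>t. deriv F (of_real t * e) * e) has_integral F (of_real T * e) - F (of_real 0 * e)) {0..T}"
  proof (rule fundamental_theorem_of_calculus[OF T(1)])
    fix t assume t: "t \<in> {0..T}"
    have "(F has_field_derivative deriv F (of_real t * e)) (at (of_real t * e))"
      using F on[OF t] holomorphic_derivI[OF F] by auto
    moreover have "((\<lambda>t. of_real t * e) has_vector_derivative e) (at t within {0..T})"
      by (auto intro!: derivative_eq_intros simp: has_vector_derivative_def scaleR_conv_of_real)
    ultimately have "((F \<circ> (\<lambda>t. of_real t * e)) has_vector_derivative e * deriv F (of_real t * e)) (at t within {0..T})"
      using field_vector_diff_chain_within has_field_derivative_at_within by blast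
    then show "((\<lambda>t. F (of_real t * e)) has_vector_derivative deriv F (of_real t * e) * e) (at t within {0..T})"
      by (simp add: o_def mult.commute)
  qed
  moreover have "continuous_on {0..T} (\<lambda>t. deriv F (of_real t * e) * e)"
    by (intro continuous_intros continuous_on_compose2[OF holomorphic_on_imp_continuous_on[OF holomorphic_deriv[OF F open_ball]]])
      (use on in auto)
  ultimately have "ennreal (cmod (F (of_real T * e) - F (of_real 0 * e))) \<le> (\<integral>\<^sup>+ t \<in> {0..T}. ennreal (cmod (deriv F (of_real t * e) * e)) \<partial>lborel)"
    by (intro cmod_has_integral_le_nn_integral)
  then show ?thesis using e by (simp add: norm_mult)
qed

section \<open>Growth and oscillation along radii\<close>

lemma disc_polar_form:
  obtains e :: complex where "cmod e = 1" "w = of_real (cmod w) * e"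
proof (cases "w = 0")
  case True
  then show ?thesis using that[of 1] by simp
next
  case False
  show ?thesis
    by (rule that[of "w / of_real (cmod w)"]) (use False in \<open>auto simp: norm_divide\<close>)
qed

text \<open>F is recovered by integrating F'' twice along the radius. Exchanging the two integrals
  produces the weight 1 - \<sigma>, which \<open>radial_estimate\<close> with q = \<beta> = 1 turns
  into the unweighted area integral. This is the embedding of B^1 in the bounded functions.\<close>

lemma bounded_if_second_deriv_integrable:
  assumes F: "F holomorphic_on unit_disc"
    and fin: "(\<integral>\<^sup>+ z. ennreal (cmod (deriv (deriv F) z)) \<partial>area_measure) < \<infinity>"
  obtains M where "\<And>z. cmod z < 1 \<Longrightarrow> cmod (F z) \<le> M"
proof -
  have F': "deriv F holomorphic_on unit_disc" by (rule holomorphic_deriv[OF F open_ball])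
  have F'': "deriv (deriv F) holomorphic_on unit_disc" by (rule holomorphic_deriv[OF F' open_ball])
  obtain A where A: "0 \<le> A" "(\<integral>\<^sup>+ z. ennreal (cmod (deriv (deriv F) z)) \<partial>area_measure) = ennreal A"
    using fin by (cases "\<integral>\<^sup>+ z. ennreal (cmod (deriv (deriv F) z)) \<partial>area_measure" rule: ennreal_cases) auto
  have le: "cmod (F z - F 0) \<le> cmod (deriv F 0) + 16 * A" if z: "cmod z < 1" for z
  proof -
    obtain e where e: "cmod e = 1" "z = of_real (cmod z) * e" by (rule disc_polar_form)
    let ?T = "cmod z"
    have on: "of_real t * e \<in> unit_disc" if "t \<in> {0..?T}" for t using that z e(1) by (simp add: norm_mult)
    let ?D = "\<lambda>\<sigma>. cmod (deriv (deriv F) (of_real \<sigma> * e))"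
    have cont: "continuous_on {0..?T} ?D"
      by (intro continuous_intros continuous_on_compose2[OF holomorphic_on_imp_continuous_on[OF F'']]) (use on in auto)
    have [measurable]: "(\<lambda>\<sigma>. ennreal (?D \<sigma>) * indicator {0..?T} \<sigma>) \<in> borel_measurable lborel"
    proof -
      have "(\<lambda>\<sigma>. ennreal (indicator {0..?T} \<sigma> *\<^sub>R ?D \<sigma>)) \<in> borel_measurable lborel"
        using borel_measurable_continuous_on_indicator[OF _ cont] by simp
      moreover have "(\<lambda>\<sigma>. ennreal (indicator {0..?T} \<sigma> *\<^sub>R ?D \<sigma>)) = (\<lambda>\<sigma>. ennreal (?D \<sigma>) * indicator {0..?T} \<sigma>)"
        by (auto simp: indicator_def fun_eq_iff)
      ultimately show ?thesis by (simp only:)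
    qed
    define d where "d = (\<lambda>\<sigma>. ennreal (?D \<sigma>) * indicator {0..?T} \<sigma>)"
    have [measurable]: "d \<in> borel_measurable borel" unfolding d_def by measurable
    have "ennreal (cmod (F z - F 0)) \<le> (\<integral>\<^sup>+ \<rho> \<in> {0..?T}. ennreal (cmod (deriv F (of_real \<rho> * e))) \<partial>lborel)"
      using radial_FTC[OF F e(1) _ z] e(2) by simp
    \<comment> \<open>The indicator of the interval from \<sigma> to 1, rather than to |z|, only
      enlarges the right-hand side and makes the inner length 1 - \<sigma> after Fubini.\<close>
    also have "\<dots> \<le> (\<integral>\<^sup>+ \<rho>. ennreal (cmod (deriv F 0)) * indicator {0..?T} \<rho> + (\<integral>\<^sup>+ \<sigma>. d \<sigma> * indicator {\<sigma>..1} \<rho> \<partial>lborel) \<partial>lborel)"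
    proof (rule nn_integral_mono)
      fix \<rho> :: real
      show "ennreal (cmod (deriv F (of_real \<rho> * e))) * indicator {0..?T} \<rho> \<le> ennreal (cmod (deriv F 0)) * indicator {0..?T} \<rho> + (\<integral>\<^sup>+ \<sigma>. d \<sigma> * indicator {\<sigma>..1} \<rho> \<partial>lborel)"
      proof (cases "\<rho> \<in> {0..?T}")
        case True
        then have \<rho>: "0 \<le> \<rho>" "\<rho> \<le> ?T" "\<rho> < 1" using z by auto
        have "ennreal (cmod (deriv F (of_real \<rho> * e))) \<le> ennreal (cmod (deriv F 0) + cmod (deriv F (of_real \<rho> * e) - deriv F 0))"
          by (intro ennreal_leI) (metis add.commute norm_triangle_sub)
        also have "\<dots> = ennreal (cmod (deriv F 0)) + ennreal (cmod (deriv F (of_real \<rho> * e) - deriv F 0))"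
          by (rule ennreal_plus) auto
        also have "ennreal (cmod (deriv F (of_real \<rho> * e) - deriv F 0)) \<le> (\<integral>\<^sup>+ \<sigma> \<in> {0..\<rho>}. ennreal (?D \<sigma>) \<partial>lborel)"
          by (rule radial_FTC[OF F' e(1) \<rho>(1,3)])
        also have "\<dots> \<le> (\<integral>\<^sup>+ \<sigma>. d \<sigma> * indicator {\<sigma>..1} \<rho> \<partial>lborel)"
          using \<rho> by (intro nn_integral_mono) (auto simp: d_def indicator_def)
        finally show ?thesis using True by (simp add: add_left_mono)
      qed simp
    qed
    also have "\<dots> = ennreal (cmod (deriv F 0)) * ennreal ?T + (\<integral>\<^sup>+ \<rho>. (\<integral>\<^sup>+ \<sigma>. d \<sigma> * indicator {\<sigma>..1} \<rho> \<partial>lborel) \<partial>lborel)"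
    proof -
      have "(\<lambda>\<rho>. \<integral>\<^sup>+ \<sigma>. d \<sigma> * indicator {\<sigma>..1} \<rho> \<partial>lborel) \<in> borel_measurable lborel"
        by (simp add: indicator_def)
      then show ?thesis by (subst nn_integral_add) (simp_all add: nn_integral_cmult_indicator)
    qed
    also have "(\<integral>\<^sup>+ \<rho>. (\<integral>\<^sup>+ \<sigma>. d \<sigma> * indicator {\<sigma>..1} \<rho> \<partial>lborel) \<partial>lborel) = (\<integral>\<^sup>+ \<sigma>. (\<integral>\<^sup>+ \<rho>. d \<sigma> * indicator {\<sigma>..1} \<rho> \<partial>lborel) \<partial>lborel)"
      by (rule lborel_pair.Fubini') (simp add: indicator_def)
    also have "\<dots> = (\<integral>\<^sup>+ \<sigma>. ennreal (?D \<sigma> powr 1 * (1 - \<sigma>) powr 1) * indicator {0..?T} \<sigma> \<partial>lborel)"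
    proof (rule nn_integral_cong)
      fix \<sigma> :: real
      show "(\<integral>\<^sup>+ \<rho>. d \<sigma> * indicator {\<sigma>..1} \<rho> \<partial>lborel) = ennreal (?D \<sigma> powr 1 * (1 - \<sigma>) powr 1) * indicator {0..?T} \<sigma>"
        using z by (subst nn_integral_cmult_indicator) (auto simp: d_def indicator_def ennreal_mult')
    qed
    also have "\<dots> \<le> ennreal (8 * 2 powr \<bar>1 - 2\<bar>) * (\<integral>\<^sup>+ v \<in> cone (of_real ?T * e). ennreal (cmod (deriv (deriv F) v) powr 1 * (1 - cmod v) powr (1 - 1)) \<partial>area_measure)"
      using z by (intro radial_estimate[OF F'' _ e(1)]) auto
    also have "\<dots> \<le> ennreal 16 * (\<integral>\<^sup>+ v. ennreal (cmod (deriv (deriv F) v)) \<partial>area_measure)"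
      by (intro mult_mono nn_integral_mono) (auto simp: indicator_def)
    finally have "ennreal (cmod (F z - F 0)) \<le> ennreal (cmod (deriv F 0)) * ennreal ?T + ennreal 16 * ennreal A"
      unfolding A(2) by (simp add: add_left_mono)
    also have "\<dots> = ennreal (cmod (deriv F 0) * ?T + 16 * A)"
      using A(1) by (simp add: ennreal_mult')
    finally have "cmod (F z - F 0) \<le> cmod (deriv F 0) * ?T + 16 * A"
      using A(1) by (subst (asm) ennreal_le_iff) auto
    also have "cmod (deriv F 0) * ?T \<le> cmod (deriv F 0) * 1"
      using z by (intro mult_left_mono) auto
    finally show ?thesis by simp
  qed
  have "cmod (F z) \<le> cmod (F 0) + (cmod (deriv F 0) + 16 * A)" if "cmod z < 1" for z
    using le[OF that] norm_triangle_sub[of "F z" "F 0"] by linarith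
  then show ?thesis by (rule that)
qed

lemma borel_measurable_continuous_on_times_indicator:
  fixes h :: "'a::topological_space \<Rightarrow> real"
  assumes "continuous_on S h" "S \<in> sets borel"
  shows "(\<lambda>x. ennreal (h x) * indicator S x) \<in> borel_measurable borel"
proof -
  have "(\<lambda>x. indicator S x *\<^sub>R h x) \<in> borel_measurable borel"
    using assms by (intro borel_measurable_continuous_on_indicator)
  then have "(\<lambda>x. ennreal (indicator S x *\<^sub>R h x)) \<in> borel_measurable borel" by measurable
  moreover have "(\<lambda>x. ennreal (indicator S x *\<^sub>R h x)) = (\<lambda>x. ennreal (h x) * indicator S x)"
    by (auto simp: indicator_def fun_eq_iff)
  ultimately show ?thesis by (simp only:)
qed

text \<open>If t exceeds the second term, then t powr (p - 1) X \<ge> 1 and the first term is at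
  least t. This replaces Hoelder's inequality: X is free and can be chosen to balance two
  integrals.\<close>

lemma le_powr_plus_powr:
  fixes t X p :: real
  assumes "0 \<le> t" "0 < X" "1 < p"
  shows "t \<le> t powr p * X + X powr (- 1 / (p - 1))"
proof (cases "t \<le> X powr (- 1 / (p - 1))")
  case True
  then show ?thesis using assms by (simp add: add_increasing)
next
  case False
  then have t: "X powr (- 1 / (p - 1)) < t" by simp
  then have t0: "0 < t" by (rule le_less_trans[OF powr_ge_zero])
  have "(X powr (- 1 / (p - 1))) powr (p - 1) \<le> t powr (p - 1)"
    using t assms by (intro powr_mono2) auto
  moreover have "(X powr (- 1 / (p - 1))) powr (p - 1) = 1 / X"
  proof -
    have "- 1 / (p - 1) * (p - 1) = - 1" using assms by simp
    then show ?thesis using assms by (simp only: powr_powr) (simp add: powr_minus_divide)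
  qed
  ultimately have "1 / X \<le> t powr (p - 1)" by (simp only:)
  then have "1 \<le> t powr (p - 1) * X" using assms by (simp add: field_simps)
  then have "t * 1 \<le> t * (t powr (p - 1) * X)" using t0 by (intro mult_left_mono) auto
  also have "\<dots> = t powr p * X" using powr_mult_base[of t "p - 1"] t0 by simp
  finally show ?thesis by (simp add: add_increasing2)
qed

lemma ennreal_lincomb:
  "0 \<le> a \<Longrightarrow> 0 \<le> b \<Longrightarrow> 0 \<le> c \<Longrightarrow> 0 \<le> d \<Longrightarrow> ennreal (a * b + c * d) = ennreal a * ennreal b + ennreal c * ennreal d"
  by (simp add: ennreal_plus ennreal_mult)

lemma log_ge_ln2: "0 \<le> T \<Longrightarrow> T < 1 \<Longrightarrow> ln 2 \<le> ln (2 / (1 - T))" for T :: real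
  by (subst ln_le_cancel_iff) (auto simp: field_simps)

lemma log_pos: "0 \<le> T \<Longrightarrow> T < 1 \<Longrightarrow> 0 < ln (2 / (1 - T))" for T :: real
  using log_ge_ln2[of T] ln_gt_zero[of 2] by linarith

text \<open>With t = |F'| (1 - \<rho>), \<open>le_powr_plus_powr\<close> splits the radial integral
  of |F'| into a Besov part, bounded through \<open>radial_estimate\<close>, and a multiple of the
  integral of 1 / (1 - \<rho>), which is at most L.\<close>

lemma besov_growth:
  assumes F: "F holomorphic_on unit_disc" and p: "1 < p"
    and fin: "besov_integral p F < \<infinity>"
  obtains M where "0 \<le> M" "\<And>z. cmod z < 1 \<Longrightarrow> cmod (F z) \<le> M * ln (2 / (1 - cmod z)) powr (1 - 1 / p)"
proof -
  have F': "deriv F holomorphic_on unit_disc" by (rule holomorphic_deriv[OF F open_ball])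
  have [measurable]: "deriv F \<in> borel_measurable area_measure"
    by (rule borel_measurable_area_measure_holomorphic[OF F'])
  obtain A where A: "0 \<le> A" "besov_integral p F = ennreal A"
    using fin by (cases "besov_integral p F" rule: ennreal_cases) auto
  define C where "C = 8 * 2 powr \<bar>p - 1 - 2\<bar>"
  have C: "0 \<le> C" by (simp add: C_def)
  have le: "cmod (F z - F 0) \<le> (C * A + 1) * ln (2 / (1 - cmod z)) powr (1 - 1 / p)" if z: "cmod z < 1" for z
  proof -
    obtain e where e: "cmod e = 1" "z = of_real (cmod z) * e" by (rule disc_polar_form)
    let ?T = "cmod z"
    define L where "L = ln (2 / (1 - ?T))"
    have L: "0 < L" unfolding L_def using z by (intro log_pos) auto
    \<comment> \<open>The balancing choice: the Besov part is of the order X, and the other part is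
      at most X powr (- 1 / (p - 1)) L, which equals X again.\<close>
    define X where "X = L powr (1 - 1 / p)"
    have X: "0 < X" using L by (simp add: X_def)
    have X': "X powr (- 1 / (p - 1)) = L powr (- 1 / p)"
      using p by (simp add: X_def powr_powr field_simps)
    have on: "of_real t * e \<in> unit_disc" if "t \<in> {0..?T}" for t using that z e(1) by (simp add: norm_mult)
    let ?D = "\<lambda>\<rho>. cmod (deriv F (of_real \<rho> * e))"
    have cont: "continuous_on {0..?T} ?D"
      by (intro continuous_intros continuous_on_compose2[OF holomorphic_on_imp_continuous_on[OF F']]) (use on in auto)
    have [measurable]: "(\<lambda>\<rho>. ennreal (?D \<rho> powr p * (1 - \<rho>) powr (p - 1)) * indicator {0..?T} \<rho>) \<in> borel_measurable borel"
      by (intro borel_measurable_continuous_on_times_indicator continuous_intros continuous_on_powr' cont) (use p z in auto)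
    have "ennreal (cmod (F z - F 0)) \<le> (\<integral>\<^sup>+ \<rho> \<in> {0..?T}. ennreal (?D \<rho>) \<partial>lborel)"
      using radial_FTC[OF F e(1) _ z] e(2) by simp
    also have "\<dots> \<le> (\<integral>\<^sup>+ \<rho>. ennreal X * (ennreal (?D \<rho> powr p * (1 - \<rho>) powr (p - 1)) * indicator {0..?T} \<rho>)
        + ennreal (L powr (- 1 / p)) * (ennreal (1 / (1 - \<rho>)) * indicator {0..?T} \<rho>) \<partial>lborel)"
    proof (rule nn_integral_mono)
      fix \<rho> :: real
      show "ennreal (?D \<rho>) * indicator {0..?T} \<rho> \<le> ennreal X * (ennreal (?D \<rho> powr p * (1 - \<rho>) powr (p - 1)) * indicator {0..?T} \<rho>)
        + ennreal (L powr (- 1 / p)) * (ennreal (1 / (1 - \<rho>)) * indicator {0..?T} \<rho>)"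
      proof (cases "\<rho> \<in> {0..?T}")
        case True
        then have \<rho>: "0 < 1 - \<rho>" using z by auto
        let ?t = "?D \<rho> * (1 - \<rho>)"
        have "?t / (1 - \<rho>) \<le> (?t powr p * X + X powr (- 1 / (p - 1))) / (1 - \<rho>)"
          using \<rho> X p by (intro divide_right_mono le_powr_plus_powr) auto
        also have "?t powr p = ?D \<rho> powr p * (1 - \<rho>) powr (p - 1) * (1 - \<rho>)"
          using \<rho> by (simp add: powr_mult powr_diff)
        also have "(?D \<rho> powr p * (1 - \<rho>) powr (p - 1) * (1 - \<rho>) * X + X powr (- 1 / (p - 1))) / (1 - \<rho>)
          = X * (?D \<rho> powr p * (1 - \<rho>) powr (p - 1)) + L powr (- 1 / p) * (1 / (1 - \<rho>))"
          using \<rho> unfolding X' by (simp add: add_divide_distrib)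
        also have "?t / (1 - \<rho>) = ?D \<rho>" using \<rho> by simp
        finally have "?D \<rho> \<le> X * (?D \<rho> powr p * (1 - \<rho>) powr (p - 1)) + L powr (- 1 / p) * (1 / (1 - \<rho>))" .
        then have "ennreal (?D \<rho>) \<le> ennreal (X * (?D \<rho> powr p * (1 - \<rho>) powr (p - 1)) + L powr (- 1 / p) * (1 / (1 - \<rho>)))"
          by (rule ennreal_leI)
        also have "\<dots> = ennreal X * ennreal (?D \<rho> powr p * (1 - \<rho>) powr (p - 1)) + ennreal (L powr (- 1 / p)) * ennreal (1 / (1 - \<rho>))"
          using \<rho> X by (intro ennreal_lincomb) auto
        finally show ?thesis using True by simp
      qed simp
    qed
    also have "\<dots> = ennreal X * (\<integral>\<^sup>+ \<rho> \<in> {0..?T}. ennreal (?D \<rho> powr p * (1 - \<rho>) powr (p - 1)) \<partial>lborel)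
        + ennreal (L powr (- 1 / p)) * (\<integral>\<^sup>+ \<rho> \<in> {0..?T}. ennreal (1 / (1 - \<rho>)) \<partial>lborel)"
      by (subst nn_integral_add) (simp_all add: nn_integral_cmult)
    also have "(\<integral>\<^sup>+ \<rho> \<in> {0..?T}. ennreal (1 / (1 - \<rho>)) \<partial>lborel) = ennreal (- ln (1 - ?T) - (- ln (1 - 0)))"
      by (rule nn_integral_FTC_Icc) (use z in \<open>auto intro!: derivative_eq_intros\<close>)
    also have "\<dots> \<le> ennreal L"
      using z by (intro ennreal_leI) (simp add: L_def ln_div)
    also have "(\<integral>\<^sup>+ \<rho> \<in> {0..?T}. ennreal (?D \<rho> powr p * (1 - \<rho>) powr (p - 1)) \<partial>lborel)
      \<le> ennreal C * (\<integral>\<^sup>+ v \<in> cone (of_real ?T * e). ennreal (cmod (deriv F v) powr p * (1 - cmod v) powr (p - 1 - 1)) \<partial>area_measure)"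
      unfolding C_def using z p by (intro radial_estimate[OF F' _ e(1)]) auto
    also have "\<dots> \<le> ennreal C * besov_integral p F"
      by (intro mult_left_mono nn_integral_mono) (auto simp: indicator_def mult.commute)
    finally have "ennreal (cmod (F z - F 0)) \<le> ennreal X * (ennreal C * ennreal A) + ennreal (L powr (- 1 / p)) * ennreal L"
      unfolding A(2) by (simp add: add_mono mult_left_mono)
    also have "\<dots> = ennreal (X * (C * A) + L powr (- 1 / p) * L)"
      using A(1) C X L by (simp add: ennreal_mult')
    finally have "cmod (F z - F 0) \<le> X * (C * A) + L powr (- 1 / p) * L"
      using A(1) C X L by (subst (asm) ennreal_le_iff) auto
    also have "L powr (- 1 / p) * L = X"
      using L powr_mult_base[of L "- 1 / p"] by (simp add: X_def mult.commute)
    finally show ?thesis by (simp add: X_def L_def algebra_simps)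
  qed
  \<comment> \<open>The value F 0 is absorbed because the logarithm never falls below ln 2.\<close>
  define M where "M = cmod (F 0) / ln 2 powr (1 - 1 / p) + (C * A + 1)"
  show ?thesis
  proof (rule that)
    show "0 \<le> M" using A C by (simp add: M_def)
    fix z assume z: "cmod z < 1"
    let ?L = "ln (2 / (1 - cmod z))"
    have "ln 2 powr (1 - 1 / p) \<le> ?L powr (1 - 1 / p)"
      using z p by (intro powr_mono2 log_ge_ln2) auto
    then have "cmod (F 0) * ln 2 powr (1 - 1 / p) \<le> cmod (F 0) * ?L powr (1 - 1 / p)"
      by (rule mult_left_mono) simp
    then have "cmod (F 0) \<le> cmod (F 0) / ln 2 powr (1 - 1 / p) * ?L powr (1 - 1 / p)"
      by (simp add: field_simps)
    moreover have "cmod (F z) \<le> cmod (F 0) + cmod (F z - F 0)" by (rule norm_triangle_sub)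
    ultimately show "cmod (F z) \<le> M * ?L powr (1 - 1 / p)"
      using le[OF z] by (simp add: M_def algebra_simps)
  qed
qed

text \<open>Cauchy-Schwarz with the weight (1 - \<rho>) powr (1 - \<epsilon>): the other factor, the
  integral of (1 - \<rho>) powr (\<epsilon> - 1), is at most 1 / \<epsilon>, whereas \<epsilon> = 0
  would produce a logarithm. Integrating over the cone, not the whole disc, permits the exchange of
  weights in \<open>cone_disc_aut_le\<close>.\<close>

lemma square_oscillation_le:
  assumes F: "F holomorphic_on unit_disc" and w: "cmod w < 1" and \<epsilon>: "0 < \<epsilon>"
  shows "ennreal ((cmod (F w - F 0))\<^sup>2) \<le> ennreal (8 * 2 powr \<bar>1 - \<epsilon> - 2\<bar> / \<epsilon>) *
    (\<integral>\<^sup>+ v \<in> cone w. ennreal ((cmod (deriv F v))\<^sup>2 * (1 - cmod v) powr (- \<epsilon>)) \<partial>area_measure)"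
proof -
  have F': "deriv F holomorphic_on unit_disc" by (rule holomorphic_deriv[OF F open_ball])
  obtain e where e: "cmod e = 1" "w = of_real (cmod w) * e" by (rule disc_polar_form)
  let ?T = "cmod w"
  have on: "of_real t * e \<in> unit_disc" if "t \<in> {0..?T}" for t using that w e(1) by (simp add: norm_mult)
  let ?D = "\<lambda>\<rho>. cmod (deriv F (of_real \<rho> * e))"
  have cont: "continuous_on {0..?T} ?D"
    by (intro continuous_intros continuous_on_compose2[OF holomorphic_on_imp_continuous_on[OF F']]) (use on in auto)
  define f where "f = (\<lambda>\<rho>. ennreal (?D \<rho> * (1 - \<rho>) powr ((1 - \<epsilon>) / 2)) * indicator {0..?T} \<rho>)"
  define g where "g = (\<lambda>\<rho>. ennreal ((1 - \<rho>) powr (- ((1 - \<epsilon>) / 2))) * indicator {0..?T} \<rho>)"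
  have [measurable]: "f \<in> borel_measurable borel" "g \<in> borel_measurable borel"
    unfolding f_def g_def
    by (intro borel_measurable_continuous_on_times_indicator continuous_intros cont; use w in auto)+
  have "ennreal (cmod (F w - F 0)) \<le> (\<integral>\<^sup>+ \<rho> \<in> {0..?T}. ennreal (?D \<rho>) \<partial>lborel)"
    using radial_FTC[OF F e(1) _ w] e(2) by simp
  also have "\<dots> = (\<integral>\<^sup>+ \<rho>. f \<rho> * g \<rho> \<partial>lborel)"
  proof (rule nn_integral_cong)
    fix \<rho> :: real
    show "ennreal (?D \<rho>) * indicator {0..?T} \<rho> = f \<rho> * g \<rho>"
    proof (cases "\<rho> \<in> {0..?T}")
      case True
      then have "0 < 1 - \<rho>" using w by auto
      then have "(1 - \<rho>) powr ((1 - \<epsilon>) / 2) * (1 - \<rho>) powr (- ((1 - \<epsilon>) / 2)) = 1"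
        by (simp flip: powr_add)
      then show ?thesis using True by (simp add: f_def g_def mult.assoc flip: ennreal_mult')
    qed (simp add: f_def)
  qed
  finally have "(ennreal (cmod (F w - F 0)))\<^sup>2 \<le> (\<integral>\<^sup>+ \<rho>. f \<rho> * g \<rho> \<partial>lborel)\<^sup>2"
    by (rule power_mono) simp
  also have "\<dots> \<le> (\<integral>\<^sup>+ \<rho>. f \<rho> ^ 2 \<partial>lborel) * (\<integral>\<^sup>+ \<rho>. g \<rho> ^ 2 \<partial>lborel)"
    by (rule Cauchy_Schwarz_nn_integral) auto
  also have "(\<integral>\<^sup>+ \<rho>. g \<rho> ^ 2 \<partial>lborel) = (\<integral>\<^sup>+ \<rho> \<in> {0..?T}. ennreal ((1 - \<rho>) powr (\<epsilon> - 1)) \<partial>lborel)"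
    by (intro nn_integral_cong) (auto simp: g_def indicator_def ennreal_power power2_eq_square simp flip: powr_add ennreal_mult')
  also have "\<dots> = ennreal (- ((1 - ?T) powr \<epsilon>) / \<epsilon> - - ((1 - 0) powr \<epsilon>) / \<epsilon>)"
    by (rule nn_integral_FTC_Icc) (use w \<epsilon> in \<open>auto intro!: derivative_eq_intros\<close>)
  also have "\<dots> \<le> ennreal (1 / \<epsilon>)"
    using \<epsilon> by (intro ennreal_leI) (simp add: field_simps)
  also have "(\<integral>\<^sup>+ \<rho>. f \<rho> ^ 2 \<partial>lborel) = (\<integral>\<^sup>+ \<rho> \<in> {0..?T}. ennreal (?D \<rho> powr 2 * (1 - \<rho>) powr (1 - \<epsilon>)) \<partial>lborel)"
  proof (rule nn_integral_cong)
    fix \<rho> :: real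
    have "((1 - \<rho>) powr ((1 - \<epsilon>) / 2))\<^sup>2 = (1 - \<rho>) powr (1 - \<epsilon>)"
      by (simp add: power2_eq_square flip: powr_add)
    then show "f \<rho> ^ 2 = ennreal (?D \<rho> powr 2 * (1 - \<rho>) powr (1 - \<epsilon>)) * indicator {0..?T} \<rho>"
      by (auto simp: f_def indicator_def ennreal_power power_mult_distrib)
  qed
  also have "\<dots> \<le> ennreal (8 * 2 powr \<bar>1 - \<epsilon> - 2\<bar>) *
      (\<integral>\<^sup>+ v \<in> cone (of_real ?T * e). ennreal (cmod (deriv F v) powr 2 * (1 - cmod v) powr (1 - \<epsilon> - 1)) \<partial>area_measure)"
    using w by (intro radial_estimate[OF F' _ e(1)]) auto
  also have "\<dots> = ennreal (8 * 2 powr \<bar>1 - \<epsilon> - 2\<bar>) *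
      (\<integral>\<^sup>+ v \<in> cone w. ennreal ((cmod (deriv F v))\<^sup>2 * (1 - cmod v) powr (- \<epsilon>)) \<partial>area_measure)"
    using e(2) by simp
  finally have "(ennreal (cmod (F w - F 0)))\<^sup>2 \<le> ennreal (8 * 2 powr \<bar>1 - \<epsilon> - 2\<bar>) *
      (\<integral>\<^sup>+ v \<in> cone w. ennreal ((cmod (deriv F v))\<^sup>2 * (1 - cmod v) powr (- \<epsilon>)) \<partial>area_measure) * ennreal (1 / \<epsilon>)"
    by (simp add: mult_left_mono mult_right_mono)
  also have "\<dots> = ennreal (8 * 2 powr \<bar>1 - \<epsilon> - 2\<bar> / \<epsilon>) * (\<integral>\<^sup>+ v \<in> cone w. ennreal ((cmod (deriv F v))\<^sup>2 * (1 - cmod v) powr (- \<epsilon>)) \<partial>area_measure)"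
  proof -
    have "ennreal (8 * 2 powr \<bar>1 - \<epsilon> - 2\<bar> / \<epsilon>) = ennreal (8 * 2 powr \<bar>1 - \<epsilon> - 2\<bar>) * ennreal (1 / \<epsilon>)"
      using \<epsilon> by (simp flip: ennreal_mult')
    then show ?thesis by (simp only: mult_ac)
  qed
  finally show ?thesis by (simp add: ennreal_power)
qed

text \<open>On the cone |1 - \<open>cnj v * w\<close>|^2 is at most 25 (1 - |v|)^2, hence at most 25
  (1 - |v|) (1 - |v|^2), and the formula for 1 - |phi_v(w)|^2 does the rest. Decay in w is thus
  traded for decay in v and a weight centred at v.\<close>

lemma cone_disc_aut_le:
  assumes "cmod v < 1" "cmod w < 1" "v \<in> cone w"
  shows "1 - (cmod w)\<^sup>2 \<le> 25 * (1 - cmod v) * (1 - (cmod (disc_aut v w))\<^sup>2)"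
proof -
  let ?d = "cmod (1 - cnj v * w)"
  have d: "0 < ?d" using one_minus_cnj_mult_nz[OF assms(1,2)] by simp
  have w2: "0 \<le> 1 - (cmod w)\<^sup>2" using assms abs_square_less_1[of "cmod w"] by simp
  have "?d\<^sup>2 \<le> (5 * (1 - cmod v))\<^sup>2" using assms(3) by (intro power_mono) (auto simp: cone_def)
  also have "\<dots> \<le> 25 * (1 - cmod v) * (1 - (cmod v)\<^sup>2)"
  proof -
    have "(cmod v)\<^sup>2 \<le> cmod v" using assms(1) by (simp add: power2_eq_square mult_left_le_one_le)
    then have "(1 - cmod v) * (1 - cmod v) \<le> (1 - cmod v) * (1 - (cmod v)\<^sup>2)" using assms(1) by (intro mult_left_mono) auto
    then show ?thesis by (simp add: power2_eq_square algebra_simps)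
  qed
  finally have "?d\<^sup>2 * (1 - (cmod w)\<^sup>2) \<le> 25 * (1 - cmod v) * (1 - (cmod v)\<^sup>2) * (1 - (cmod w)\<^sup>2)"
    using w2 by (rule mult_right_mono)
  then show ?thesis
    unfolding one_minus_disc_aut[OF assms(1,2)] using d by (simp add: field_simps)
qed

text \<open>Polar coordinates, with the Jacobian r estimated by 1. The integrand may blow up at the
  circle, but integrably.\<close>

lemma nn_integral_radial_weight_finite:
  assumes "0 < \<delta>"
  shows "(\<integral>\<^sup>+ z. ennreal ((1 - cmod z) powr (\<delta> - 1)) \<partial>area_measure) \<le> ennreal (2 / \<delta>)"
proof -
  have "(\<integral>\<^sup>+ z. ennreal ((1 - cmod z) powr (\<delta> - 1)) * indicator unit_disc z \<partial>lborel)
     = (\<integral>\<^sup>+ \<theta> \<in> {-pi<..<pi}. (\<integral>\<^sup>+ r \<in> {0<..}. (ennreal ((1 - cmod (rcis r \<theta>)) powr (\<delta> - 1)) * indicator unit_disc (rcis r \<theta>) * ennreal r) \<partial>lborel) \<partial>lborel)"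
    by (intro nn_integral_polar borel_measurable_times_ennreal borel_measurable_indicator) simp_all
  also have "\<dots> \<le> (\<integral>\<^sup>+ \<theta> \<in> {-pi<..<pi}. ennreal (1 / \<delta>) \<partial>lborel)"
  proof (intro nn_integral_mono mult_right_mono)
    fix \<theta> :: real
    have "(\<integral>\<^sup>+ r \<in> {0<..}. (ennreal ((1 - cmod (rcis r \<theta>)) powr (\<delta> - 1)) * indicator unit_disc (rcis r \<theta>) * ennreal r) \<partial>lborel)
      \<le> (\<integral>\<^sup>+ r \<in> {0<..<1}. ennreal ((1 - r) powr (\<delta> - 1)) \<partial>lborel)"
    proof (rule nn_integral_mono)
      fix r :: real
      show "ennreal ((1 - cmod (rcis r \<theta>)) powr (\<delta> - 1)) * indicator unit_disc (rcis r \<theta>) * ennreal r * indicator {0<..} r \<le> ennreal ((1 - r) powr (\<delta> - 1)) * indicator {0<..<1} r"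
      proof (cases "0 < r \<and> r < 1")
        case True
        then have "(1 - r) powr (\<delta> - 1) * r \<le> (1 - r) powr (\<delta> - 1) * 1" by (intro mult_left_mono) auto
        then show ?thesis using True by (simp add: rcis_def norm_mult ennreal_leI flip: ennreal_mult')
      qed (auto simp: indicator_def)
    qed
    also have "\<dots> \<le> ennreal (1 / \<delta>)"
    proof (rule nn_integral_deriv_le[where F = "\<lambda>r. - ((1 - r) powr \<delta>) / \<delta>"])
      fix x y :: real assume xy: "0 < x" "x \<le> y" "y < 1"
      then have "(1 - x) powr \<delta> \<le> 1 powr \<delta>" using assms by (intro powr_mono2) auto
      then have "(1 - x) powr \<delta> \<le> 1 + (1 - y) powr \<delta>" by (rule order_trans) simp
      then have "((1 - x) powr \<delta> - (1 - y) powr \<delta>) / \<delta> \<le> 1 / \<delta>" using assms by (intro divide_right_mono) auto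
      then show "- ((1 - y) powr \<delta>) / \<delta> - - ((1 - x) powr \<delta>) / \<delta> \<le> 1 / \<delta>" by (simp add: diff_divide_distrib)
    qed (use assms in \<open>auto intro!: derivative_eq_intros\<close>)
    finally show "(\<integral>\<^sup>+ r \<in> {0<..}. (ennreal ((1 - cmod (rcis r \<theta>)) powr (\<delta> - 1)) * indicator unit_disc (rcis r \<theta>) * ennreal r) \<partial>lborel) \<le> ennreal (1 / \<delta>)" .
  qed simp
  also have "\<dots> = ennreal (1 / \<delta>) * ennreal (2 * pi)"
  proof -
    have "emeasure lborel {-pi<..<pi} = ennreal (pi - - pi)" by (rule emeasure_lborel_Ioo) simp
    then show ?thesis by (subst nn_integral_cmult_indicator) (simp, simp only:, simp)
  qed
  finally have I: "(\<integral>\<^sup>+ z. ennreal ((1 - cmod z) powr (\<delta> - 1)) * indicator unit_disc z \<partial>lborel) \<le> ennreal (1 / \<delta>) * ennreal (2 * pi)" .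
  have "(\<integral>\<^sup>+ z. ennreal ((1 - cmod z) powr (\<delta> - 1)) \<partial>area_measure)
     = ennreal (1 / pi) * (\<integral>\<^sup>+ z. ennreal ((1 - cmod z) powr (\<delta> - 1)) * indicator unit_disc z \<partial>lborel)"
    by (subst nn_integral_area_measure) auto
  also have "\<dots> \<le> ennreal (1 / pi) * (ennreal (1 / \<delta>) * ennreal (2 * pi))"
    using I by (rule mult_left_mono) simp
  also have "\<dots> = ennreal (2 / \<delta>)" using assms by (simp flip: ennreal_mult')
  finally show ?thesis .
qed

section \<open>Oscillation of Besov functions\<close>

lemma cnj_borel_measurable [measurable]: "cnj \<in> borel_measurable borel"
  by (intro borel_measurable_continuous_onI continuous_intros)

lemma one_minus_disc_aut_pos:
  assumes "cmod a < 1" "cmod z < 1"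
  shows "0 < 1 - (cmod (disc_aut a z))\<^sup>2"
  using disc_aut_in_disc[OF assms] by (simp add: abs_square_less_1)

lemma one_minus_square_bounds:
  assumes "cmod z < 1"
  shows "1 - cmod z \<le> 1 - (cmod z)\<^sup>2" "1 - (cmod z)\<^sup>2 \<le> 2 * (1 - cmod z)" "0 < 1 - (cmod z)\<^sup>2"
proof -
  show "1 - cmod z \<le> 1 - (cmod z)\<^sup>2" using assms by (simp add: power2_eq_square mult_left_le_one_le)
  have "0 \<le> (1 - cmod z)\<^sup>2" by simp
  then show "1 - (cmod z)\<^sup>2 \<le> 2 * (1 - cmod z)" unfolding power2_diff by simp
  show "0 < 1 - (cmod z)\<^sup>2" using assms by (simp add: abs_square_less_1)
qed

lemma ball_half_distance:
  assumes "cmod z < 1" "u \<in> ball z ((1 - cmod z) / 2)"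
  shows "1 - cmod z \<le> 2 * (1 - cmod u)" "1 - cmod u \<le> 2 * (1 - cmod z)" "cmod u < 1"
proof -
  have "cmod (z - u) < (1 - cmod z) / 2" using assms(2) by (simp add: dist_norm)
  moreover have "cmod u \<le> cmod z + cmod (z - u)" by (metis norm_minus_commute norm_triangle_sub)
  moreover have "cmod z \<le> cmod u + cmod (z - u)" by (metis norm_triangle_sub)
  ultimately have "cmod u < cmod z + (1 - cmod z) / 2" "cmod z < cmod u + (1 - cmod z) / 2" by linarith+
  then show "1 - cmod z \<le> 2 * (1 - cmod u)" "1 - cmod u \<le> 2 * (1 - cmod z)" "cmod u < 1"
    using assms(1) by (simp_all add: field_simps)
qed

text \<open>Subharmonicity of |F'|^p on the disc of radius (1 - |z|) / 2, where 1 - |w| is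
  comparable with 1 - |z|. This is the embedding of B^p in the Bloch space; the constant is explicit
  because a bound uniform in F is wanted.\<close>

lemma besov_deriv_bound:
  assumes F: "F holomorphic_on unit_disc" and p: "1 < p" and A: "0 \<le> A"
    and le: "besov_integral p F \<le> ennreal A"
    and z: "cmod z < 1"
  shows "(cmod (deriv F z) * (1 - cmod z)) powr p \<le> 4 * 2 powr \<bar>p - 2\<bar> * A"
proof -
  have F': "deriv F holomorphic_on unit_disc" by (rule holomorphic_deriv[OF F open_ball])
  define R where "R = (1 - cmod z) / 2"
  have R: "0 < R" using z by (simp add: R_def)
  have sub: "ball z R \<subseteq> unit_disc" using ball_half_distance(3)[OF z] by (auto simp: R_def)
  have m: "deriv F \<in> borel_measurable area_measure"
    by (rule borel_measurable_area_measure_holomorphic[OF F'])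
  have mb: "(indicator (ball z R) :: complex \<Rightarrow> ennreal) \<in> borel_measurable area_measure"
    by (rule borel_measurable_area_measureI[OF borel_measurable_indicator]) simp
  let ?c = "(1 - cmod z) powr (p - 2)"
  have "ennreal ?c * ennreal (R\<^sup>2 * cmod (deriv F z) powr p) \<le> ennreal ?c * (\<integral>\<^sup>+ w \<in> ball z R. ennreal (cmod (deriv F w) powr p) \<partial>area_measure)"
    using R sub p by (intro mult_left_mono submean_value_powr[OF F']) auto
  also have "\<dots> = (\<integral>\<^sup>+ w. ennreal ?c * (ennreal (cmod (deriv F w) powr p) * indicator (ball z R) w) \<partial>area_measure)"
    by (rule nn_integral_cmult[symmetric]) (use m mb in measurable)
  also have "\<dots> \<le> (\<integral>\<^sup>+ w. ennreal (2 powr \<bar>p - 2\<bar>) * ennreal ((1 - cmod w) powr (p - 2) * cmod (deriv F w) powr p) \<partial>area_measure)"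
  proof (rule nn_integral_mono)
    fix w
    show "ennreal ?c * (ennreal (cmod (deriv F w) powr p) * indicator (ball z R) w) \<le> ennreal (2 powr \<bar>p - 2\<bar>) * ennreal ((1 - cmod w) powr (p - 2) * cmod (deriv F w) powr p)"
    proof (cases "w \<in> ball z R")
      case True
      have "?c \<le> 2 powr \<bar>p - 2\<bar> * (1 - cmod w) powr (p - 2)"
        using ball_half_distance[OF z, of w] True z by (intro powr_ratio_le) (auto simp: R_def)
      then have "?c * cmod (deriv F w) powr p \<le> 2 powr \<bar>p - 2\<bar> * (1 - cmod w) powr (p - 2) * cmod (deriv F w) powr p"
        by (rule mult_right_mono) simp
      then show ?thesis using True by (simp add: mult.assoc ennreal_leI flip: ennreal_mult')
    qed simp
  qed
  also have "\<dots> = ennreal (2 powr \<bar>p - 2\<bar>) * besov_integral p F"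
    by (rule nn_integral_cmult) (use m in measurable)
  also have "\<dots> \<le> ennreal (2 powr \<bar>p - 2\<bar>) * ennreal A"
    using le by (rule mult_left_mono) simp
  finally have "?c * (R\<^sup>2 * cmod (deriv F z) powr p) \<le> 2 powr \<bar>p - 2\<bar> * A"
    using A by (simp add: ennreal_le_iff flip: ennreal_mult')
  moreover have "(cmod (deriv F z) * (1 - cmod z)) powr p = 4 * (?c * (R\<^sup>2 * cmod (deriv F z) powr p))"
  proof -
    have "(1 - cmod z) powr p = ?c * (1 - cmod z)\<^sup>2"
      using z by (simp add: powr_diff powr_numeral)
    then show ?thesis using z by (simp add: powr_mult R_def power_divide mult_ac)
  qed
  ultimately show ?thesis by simp
qed

text \<open>C is chosen before F because the lemma is applied to f composed with every disc
  automorphism. For p \<le> 2 the Bloch bound reduces the exponent 2 to p. For p > 2 it is Hoelder's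
  inequality with exponents p / 2 and p / (p - 2), carried out pointwise.\<close>

lemma besov_subset_dirichlet:
  assumes p: "1 < p" and A: "0 \<le> A" and \<sigma>: "0 < \<sigma>" "1 - 2 / p < \<sigma>"
  obtains C where "0 \<le> C"
    "\<And>F. F holomorphic_on unit_disc \<Longrightarrow>
       besov_integral p F \<le> ennreal A \<Longrightarrow>
       (\<integral>\<^sup>+ z. ennreal ((cmod (deriv F z))\<^sup>2 * (1 - cmod z) powr \<sigma>) \<partial>area_measure) \<le> ennreal C"
proof (cases "p \<le> 2")
  case True
  define B where "B = (4 * 2 powr \<bar>p - 2\<bar> * A) powr (1 / p)"
  have B: "0 \<le> B" by (simp add: B_def)
  show ?thesis
  proof (rule that)
    show "0 \<le> B powr (2 - p) * A" using A by simp
    fix F assume F: "F holomorphic_on unit_disc"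
      and le: "besov_integral p F \<le> ennreal A"
    have [measurable]: "deriv F \<in> borel_measurable area_measure"
      by (intro borel_measurable_area_measure_holomorphic holomorphic_deriv F open_ball)
    have "(\<integral>\<^sup>+ z. ennreal ((cmod (deriv F z))\<^sup>2 * (1 - cmod z) powr \<sigma>) \<partial>area_measure)
      \<le> (\<integral>\<^sup>+ z. ennreal (B powr (2 - p)) * ennreal ((1 - cmod z) powr (p - 2) * cmod (deriv F z) powr p) \<partial>area_measure)"
    proof (rule nn_integral_mono)
      fix z assume "z \<in> space area_measure"
      then have z: "cmod z < 1" by simp
      let ?x = "cmod (deriv F z) * (1 - cmod z)"
      have x0: "0 \<le> ?x" using z by simp
      have "(?x powr p) powr (1 / p) \<le> B"
        unfolding B_def using besov_deriv_bound[OF F p A le z] p by (intro powr_mono2) auto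
      then have "?x \<le> B" using p x0 by (simp add: powr_powr)
      then have "?x powr (2 - p) \<le> B powr (2 - p)" using True x0 by (intro powr_mono2) auto
      then have "?x powr p * ?x powr (2 - p) \<le> ?x powr p * B powr (2 - p)" by (rule mult_left_mono) simp
      moreover have "?x powr p * ?x powr (2 - p) = ?x\<^sup>2" using x0 by (simp flip: powr_add)
      ultimately have *: "?x\<^sup>2 \<le> ?x powr p * B powr (2 - p)" by simp
      have "(cmod (deriv F z))\<^sup>2 * (1 - cmod z) powr \<sigma> \<le> (cmod (deriv F z))\<^sup>2 * 1"
        using z \<sigma> by (intro mult_left_mono powr_le1) auto
      also have "\<dots> = ?x\<^sup>2 * (1 - cmod z) powr (- 2)"
      proof -
        have "(1 - cmod z)\<^sup>2 * (1 - cmod z) powr (- 2) = 1" using z by (simp add: powr_minus powr_numeral)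
        then show ?thesis by (simp add: power_mult_distrib mult.assoc)
      qed
      also have "\<dots> \<le> ?x powr p * B powr (2 - p) * (1 - cmod z) powr (- 2)"
        using * by (rule mult_right_mono) simp
      also have "\<dots> = B powr (2 - p) * ((1 - cmod z) powr (p - 2) * cmod (deriv F z) powr p)"
      proof -
        have "?x powr p * (1 - cmod z) powr (- 2) = (1 - cmod z) powr (p - 2) * cmod (deriv F z) powr p"
          using z by (simp add: powr_mult powr_add[of _ p "- 2", simplified, symmetric])
        then show ?thesis by (metis mult.assoc mult.commute)
      qed
      finally show "ennreal ((cmod (deriv F z))\<^sup>2 * (1 - cmod z) powr \<sigma>)
         \<le> ennreal (B powr (2 - p)) * ennreal ((1 - cmod z) powr (p - 2) * cmod (deriv F z) powr p)"
        by (simp add: ennreal_leI flip: ennreal_mult')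
    qed
    also have "\<dots> = ennreal (B powr (2 - p)) * besov_integral p F"
      by (rule nn_integral_cmult) measurable
    also have "\<dots> \<le> ennreal (B powr (2 - p)) * ennreal A" using le by (rule mult_left_mono) simp
    finally show "(\<integral>\<^sup>+ z. ennreal ((cmod (deriv F z))\<^sup>2 * (1 - cmod z) powr \<sigma>) \<partial>area_measure) \<le> ennreal (B powr (2 - p) * A)"
      by (simp add: ennreal_mult')
  qed
next
  case False
  then have p2: "2 < p" by simp
  \<comment> \<open>Hoelder's inequality leaves the power \<delta> - 1 = \<sigma> p / (p - 2) - 2 of
    1 - |z|, which is integrable over the disc exactly when \<sigma> > 1 - 2 / p.\<close>
  define \<delta> where "\<delta> = \<sigma> * p / (p - 2) - 1"
  have \<delta>: "0 < \<delta>"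
  proof -
    have "p - 2 < \<sigma> * p" using \<sigma>(2) p2 by (simp add: field_simps)
    then show ?thesis using p2 by (simp add: \<delta>_def field_simps)
  qed
  show ?thesis
  proof (rule that)
    show "0 \<le> A + 2 / \<delta>" using A \<delta> by simp
    fix F assume F: "F holomorphic_on unit_disc"
      and le: "besov_integral p F \<le> ennreal A"
    have [measurable]: "deriv F \<in> borel_measurable area_measure"
      by (intro borel_measurable_area_measure_holomorphic holomorphic_deriv F open_ball)
    have "(\<integral>\<^sup>+ z. ennreal ((cmod (deriv F z))\<^sup>2 * (1 - cmod z) powr \<sigma>) \<partial>area_measure)
      \<le> (\<integral>\<^sup>+ z. ennreal ((1 - cmod z) powr (p - 2) * cmod (deriv F z) powr p) + ennreal ((1 - cmod z) powr (\<delta> - 1)) \<partial>area_measure)"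
    proof (rule nn_integral_mono)
      fix z assume "z \<in> space area_measure"
      then have z: "cmod z < 1" by simp
      define D where "D = 1 - cmod z"
      have D: "0 < D" using z by (simp add: D_def)
      define y where "y = cmod (deriv F z)"
      have y: "0 \<le> y" by (simp add: y_def)
      have "y\<^sup>2 * D powr \<sigma> \<le> D powr (p - 2) * y powr p + D powr (\<delta> - 1)"
      \<comment> \<open>At the threshold D powr \<sigma> = (y D) powr (p - 2) the left-hand side
        equals each of the two bounds. On one side of it the first bound is larger than the
        left-hand side, on the other side the second.\<close>
      proof (cases "D powr \<sigma> \<le> (y * D) powr (p - 2)")
        case True
        have "y\<^sup>2 * D powr \<sigma> \<le> y\<^sup>2 * (y * D) powr (p - 2)" using True by (rule mult_left_mono) simp
        also have "\<dots> = D powr (p - 2) * y powr p"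
        proof (cases "y = 0")
          case False
          then have "y powr p = y\<^sup>2 * y powr (p - 2)" using y by (simp add: powr_diff powr_numeral)
          then show ?thesis using y D by (simp add: powr_mult)
        qed (use p in simp)
        finally show ?thesis by (simp add: add_increasing2)
      next
        case False
        then have "((y * D) powr (p - 2)) powr (2 / (p - 2)) \<le> (D powr \<sigma>) powr (2 / (p - 2))"
          using p2 by (intro powr_mono2) auto
        moreover have "(p - 2) * (2 / (p - 2)) = 2" "\<sigma> * (2 / (p - 2)) = \<sigma> * 2 / (p - 2)" using p2 by (simp_all add: field_simps)
        ultimately have "(y * D) powr 2 \<le> D powr (\<sigma> * 2 / (p - 2))"
          by (simp only: powr_powr)
        then have "(y * D)\<^sup>2 \<le> D powr (\<sigma> * 2 / (p - 2))" using y D by simp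
        then have "(y * D)\<^sup>2 * (D powr \<sigma> * D powr (- 2)) \<le> D powr (\<sigma> * 2 / (p - 2)) * (D powr \<sigma> * D powr (- 2))"
          by (rule mult_right_mono) simp
        also have "\<dots> = D powr (\<delta> - 1)"
        proof -
          have "\<sigma> * 2 / (p - 2) + (\<sigma> + - 2) = \<delta> - 1" using p2 by (simp add: \<delta>_def field_simps)
          then show ?thesis by (simp only: powr_add[symmetric])
        qed
        also have "(y * D)\<^sup>2 * (D powr \<sigma> * D powr (- 2)) = y\<^sup>2 * D powr \<sigma>"
        proof -
          have "D\<^sup>2 * D powr (- 2) = 1" using D by (simp add: powr_minus powr_numeral)
          then show ?thesis by (simp add: power_mult_distrib mult_ac)
        qed
        finally show ?thesis by (simp add: add_increasing)
      qed
      then show "ennreal ((cmod (deriv F z))\<^sup>2 * (1 - cmod z) powr \<sigma>)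
         \<le> ennreal ((1 - cmod z) powr (p - 2) * cmod (deriv F z) powr p) + ennreal ((1 - cmod z) powr (\<delta> - 1))"
        by (simp add: ennreal_leI y_def D_def flip: ennreal_plus)
    qed
    also have "\<dots> = besov_integral p F + (\<integral>\<^sup>+ z. ennreal ((1 - cmod z) powr (\<delta> - 1)) \<partial>area_measure)"
      by (rule nn_integral_add) measurable
    also have "\<dots> \<le> ennreal A + ennreal (2 / \<delta>)"
      using le nn_integral_radial_weight_finite[OF \<delta>] by (rule add_mono)
    finally show "(\<integral>\<^sup>+ z. ennreal ((cmod (deriv F z))\<^sup>2 * (1 - cmod z) powr \<sigma>) \<partial>area_measure) \<le> ennreal (A + 2 / \<delta>)"
      using A \<delta> by (simp add: ennreal_plus)
  qed
qed

text \<open>With 1 - |z|^2 in place of 1 - |z| the integral is invariant, since 1 - |phi_a(w)|^2 =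
  (1 - |w|^2) |phi_a'(w)|. Passing to that weight and back costs the factor 2 powr |p - 2|
  twice.\<close>

lemma besov_disc_aut_le:
  assumes f: "f holomorphic_on unit_disc" and a: "cmod a < 1" and A: "0 \<le> A"
    and le: "besov_integral p f \<le> ennreal A"
  shows "besov_integral p (f \<circ> disc_aut a)
    \<le> ennreal ((2 powr \<bar>p - 2\<bar>)\<^sup>2 * A)"
proof -
  let ?K = "2 powr \<bar>p - 2\<bar>"
  have [measurable]: "deriv f \<in> borel_measurable area_measure"
    by (intro borel_measurable_area_measure_holomorphic holomorphic_deriv f open_ball)
  let ?u = "\<lambda>z. ennreal (?K * ((1 - (cmod z)\<^sup>2) powr (p - 2) * cmod (deriv f z) powr p))"
  have "besov_integral p (f \<circ> disc_aut a)
    \<le> (\<integral>\<^sup>+ w. ennreal ((cmod (deriv (disc_aut a) w))\<^sup>2) * ?u (disc_aut a w) \<partial>area_measure)"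
  proof (rule nn_integral_mono)
    fix w assume "w \<in> space area_measure"
    then have w: "cmod w < 1" by simp
    let ?z = "disc_aut a w" and ?d = "cmod (deriv (disc_aut a) w)"
    have z: "cmod ?z < 1" by (rule disc_aut_in_disc[OF a w])
    have "deriv (f \<circ> disc_aut a) w = deriv f ?z * deriv (disc_aut a) w"
      using has_field_derivative_disc_aut[OF a w] z holomorphic_derivI[OF f open_ball, of ?z]
      by (intro deriv_chain) (auto simp: field_differentiable_def)
    then have c: "cmod (deriv (f \<circ> disc_aut a) w) powr p = cmod (deriv f ?z) powr p * ?d powr p"
      by (simp add: norm_mult powr_mult)
    note w2 = one_minus_square_bounds[OF w]
    have d0: "0 < ?d" 
      unfolding cmod_deriv_disc_aut[OF a w] using one_minus_square_bounds(3)[OF a] one_minus_cnj_mult_nz[OF a w] by simp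
    have dz: "1 - (cmod ?z)\<^sup>2 = (1 - (cmod w)\<^sup>2) * ?d"
      unfolding one_minus_disc_aut[OF a w] cmod_deriv_disc_aut[OF a w] by simp
    have "(1 - cmod w) powr (p - 2) * (cmod (deriv f ?z) powr p * ?d powr p) \<le> ?K * (1 - (cmod w)\<^sup>2) powr (p - 2) * (cmod (deriv f ?z) powr p * ?d powr p)"
      using w2 w by (intro mult_right_mono powr_ratio_le) auto
    also have "\<dots> = ?d\<^sup>2 * (?K * ((1 - (cmod ?z)\<^sup>2) powr (p - 2) * cmod (deriv f ?z) powr p))"
    proof -
      have "?d powr p = ?d\<^sup>2 * ?d powr (p - 2)" using d0 by (simp add: powr_diff powr_numeral)
      then show ?thesis unfolding dz using w2 d0 by (simp add: powr_mult mult_ac)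
    qed
    finally show "ennreal ((1 - cmod w) powr (p - 2) * cmod (deriv (f \<circ> disc_aut a) w) powr p) \<le> ennreal (?d\<^sup>2) * ?u ?z"
      unfolding c by (simp add: ennreal_leI flip: ennreal_mult')
  qed
  also have "\<dots> = (\<integral>\<^sup>+ z. ?u z \<partial>area_measure)"
    by (rule nn_integral_disc_aut[OF a, symmetric]) measurable
  also have "\<dots> \<le> (\<integral>\<^sup>+ z. ennreal (?K\<^sup>2) * ennreal ((1 - cmod z) powr (p - 2) * cmod (deriv f z) powr p) \<partial>area_measure)"
  proof (rule nn_integral_mono)
    fix z assume "z \<in> space area_measure"
    then have z: "cmod z < 1" by simp
    note z2 = one_minus_square_bounds[OF z]
    have "?K * ((1 - (cmod z)\<^sup>2) powr (p - 2) * cmod (deriv f z) powr p) \<le> ?K * ((?K * (1 - cmod z) powr (p - 2)) * cmod (deriv f z) powr p)"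
      using z2 z by (intro mult_left_mono mult_right_mono powr_ratio_le) auto
    then show "?u z \<le> ennreal (?K\<^sup>2) * ennreal ((1 - cmod z) powr (p - 2) * cmod (deriv f z) powr p)"
      by (simp add: ennreal_leI power2_eq_square mult.assoc flip: ennreal_mult')
  qed
  also have "\<dots> = ennreal (?K\<^sup>2) * besov_integral p f"
    by (rule nn_integral_cmult) measurable
  also have "\<dots> \<le> ennreal (?K\<^sup>2) * ennreal A" using le by (rule mult_left_mono) simp
  finally show ?thesis by (simp add: ennreal_mult')
qed

text \<open>After Fubini the inner integral is that of \<open>Q_density\<close> for g centred at
  phi_a(v), at most M for every v. The outer one is a weighted Dirichlet integral of f composed with
  phi_a, which is bounded independently of a.\<close>

lemma oscillation_embedding:
  assumes f: "f holomorphic_on unit_disc" and g: "g holomorphic_on unit_disc"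
    and p: "1 < p" and s: "0 < s" "1 - 2 / p < s" and M: "0 \<le> M"
    and fin: "besov_integral p f < \<infinity>"
    and Q: "\<And>a. cmod a < 1 \<Longrightarrow> (\<integral>\<^sup>+ z. Q_density s g a z \<partial>area_measure) \<le> ennreal M"
  obtains C where "0 \<le> C"
    "\<And>a. cmod a < 1 \<Longrightarrow> (\<integral>\<^sup>+ z. ennreal ((cmod (f z - f a))\<^sup>2) * Q_density s g a z \<partial>area_measure) \<le> ennreal C"
proof -
  have [measurable]: "deriv g \<in> borel_measurable area_measure"
    by (intro borel_measurable_area_measure_holomorphic holomorphic_deriv g open_ball)
  obtain A where A: "0 \<le> A" "besov_integral p f = ennreal A"
    using fin by (cases "besov_integral p f" rule: ennreal_cases) auto
  \<comment> \<open>The gap s - \<sigma> = \<epsilon> pays for the weight (1 - |v|) powr (-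
    \<epsilon>) in \<open>square_oscillation_le\<close>. The lower bounds on \<sigma> are those of
    \<open>besov_subset_dirichlet\<close>.\<close>
  obtain \<sigma> where \<sigma>: "0 < \<sigma>" "1 - 2 / p < \<sigma>" "\<sigma> < s"
    using dense[of "max 0 (1 - 2 / p)" s] s by auto
  define A' where "A' = (2 powr \<bar>p - 2\<bar>)\<^sup>2 * A"
  have A': "0 \<le> A'" using A by (simp add: A'_def)
  obtain C2 where C2: "0 \<le> C2" "\<And>F. F holomorphic_on unit_disc \<Longrightarrow>
       besov_integral p F \<le> ennreal A' \<Longrightarrow>
       (\<integral>\<^sup>+ z. ennreal ((cmod (deriv F z))\<^sup>2 * (1 - cmod z) powr \<sigma>) \<partial>area_measure) \<le> ennreal C2"
    using besov_subset_dirichlet[OF p A' \<sigma>(1,2)] by blast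
  define \<epsilon> where "\<epsilon> = s - \<sigma>"
  have \<epsilon>: "0 < \<epsilon>" using \<sigma> by (simp add: \<epsilon>_def)
  define C1 where "C1 = 8 * 2 powr \<bar>1 - \<epsilon> - 2\<bar> / \<epsilon>"
  have C1: "0 \<le> C1" using \<epsilon> by (simp add: C1_def)
  interpret pair_sigma_finite area_measure area_measure
    by (intro pair_sigma_finite.intro area_measure.sigma_finite_measure_axioms)
  have [measurable]: "(\<lambda>x. snd x) \<in> borel_measurable (area_measure \<Otimes>\<^sub>M area_measure)"
      "(\<lambda>x. fst x) \<in> borel_measurable (area_measure \<Otimes>\<^sub>M area_measure)"
    by (rule measurable_compose[OF measurable_snd id_borel_measurable_area_measure]
        measurable_compose[OF measurable_fst id_borel_measurable_area_measure])+
  show ?thesis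
  proof (rule that)
    show "0 \<le> C1 * 25 powr s * M * C2" using C1 M C2(1) by simp
    fix a assume a: "cmod a < 1"
    \<comment> \<open>phi_a is an involution with phi_a(0) = a, so f z - f a is the oscillation of F
      between 0 and the point phi_a(z).\<close>
    define F where "F = f \<circ> disc_aut a"
    have F: "F holomorphic_on unit_disc" unfolding F_def
      using holomorphic_on_disc_aut[OF a] f disc_aut_image[OF a] by (intro holomorphic_on_compose) auto
    have [measurable]: "deriv F \<in> borel_measurable area_measure"
      by (intro borel_measurable_area_measure_holomorphic holomorphic_deriv F open_ball)
    have FC2: "(\<integral>\<^sup>+ z. ennreal ((cmod (deriv F z))\<^sup>2 * (1 - cmod z) powr \<sigma>) \<partial>area_measure) \<le> ennreal C2"
      using besov_disc_aut_le[OF f a A(1), of p] A(2) by (intro C2(2)[OF F]) (simp add: F_def A'_def)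
    let ?K = "\<lambda>v. ennreal ((cmod (deriv F v))\<^sup>2 * (1 - cmod v) powr \<sigma>)"
    let ?G = "\<lambda>v z. Q_density s g (disc_aut a v) z"
    have mG[measurable]: "(\<lambda>(z, v). ?K v * ?G v z) \<in> borel_measurable (area_measure \<Otimes>\<^sub>M area_measure)"
      unfolding disc_aut_def by measurable
    have mGv[measurable]: "?G v \<in> borel_measurable area_measure" for v
      unfolding disc_aut_def by measurable
    have mGz[measurable]: "(\<lambda>v. ?K v * ?G v z) \<in> borel_measurable area_measure" for z
      unfolding disc_aut_def by measurable
    have "(\<integral>\<^sup>+ z. ennreal ((cmod (f z - f a))\<^sup>2) * Q_density s g a z \<partial>area_measure)
      \<le> (\<integral>\<^sup>+ z. \<integral>\<^sup>+ v. ennreal (C1 * 25 powr s) * (?K v * ?G v z) \<partial>area_measure \<partial>area_measure)"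
    proof (rule nn_integral_mono)
      fix z assume "z \<in> space area_measure"
      then have z: "cmod z < 1" by simp
      let ?w = "disc_aut a z"
      have w: "cmod ?w < 1" by (rule disc_aut_in_disc[OF a z])
      have "F ?w = f z" "F 0 = f a" using disc_aut_involution[OF a z] by (simp_all add: F_def disc_aut_def)
      then have "ennreal ((cmod (f z - f a))\<^sup>2) \<le> ennreal C1 * (\<integral>\<^sup>+ v \<in> cone ?w. ennreal ((cmod (deriv F v))\<^sup>2 * (1 - cmod v) powr (- \<epsilon>)) \<partial>area_measure)"
        using square_oscillation_le[OF F w \<epsilon>] by (simp add: C1_def)
      then have "ennreal ((cmod (f z - f a))\<^sup>2) * ennreal ((cmod (deriv g z))\<^sup>2 * (1 - (cmod ?w)\<^sup>2) powr s)
        \<le> ennreal C1 * (\<integral>\<^sup>+ v \<in> cone ?w. ennreal ((cmod (deriv F v))\<^sup>2 * (1 - cmod v) powr (- \<epsilon>)) \<partial>area_measure) * ennreal ((cmod (deriv g z))\<^sup>2 * (1 - (cmod ?w)\<^sup>2) powr s)"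
        by (rule mult_right_mono) simp
      also have "\<dots> = (ennreal C1 * ennreal ((cmod (deriv g z))\<^sup>2 * (1 - (cmod ?w)\<^sup>2) powr s)) * (\<integral>\<^sup>+ v. ennreal ((cmod (deriv F v))\<^sup>2 * (1 - cmod v) powr (- \<epsilon>)) * indicator (cone ?w) v \<partial>area_measure)"
        by (simp only: mult_ac)
      also have "\<dots> = (\<integral>\<^sup>+ v. (ennreal C1 * ennreal ((cmod (deriv g z))\<^sup>2 * (1 - (cmod ?w)\<^sup>2) powr s)) * (ennreal ((cmod (deriv F v))\<^sup>2 * (1 - cmod v) powr (- \<epsilon>)) * indicator (cone ?w) v) \<partial>area_measure)"
        by (rule nn_integral_cmult[symmetric]) measurable
      also have "\<dots> \<le> (\<integral>\<^sup>+ v. ennreal (C1 * 25 powr s) * (?K v * ?G v z) \<partial>area_measure)"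
      proof (rule nn_integral_mono)
        fix v assume "v \<in> space area_measure"
        then have v: "cmod v < 1" by simp
        show "(ennreal C1 * ennreal ((cmod (deriv g z))\<^sup>2 * (1 - (cmod ?w)\<^sup>2) powr s)) * (ennreal ((cmod (deriv F v))\<^sup>2 * (1 - cmod v) powr (- \<epsilon>)) * indicator (cone ?w) v) \<le> ennreal (C1 * 25 powr s) * (?K v * ?G v z)"
        proof (cases "v \<in> cone ?w")
          case True
          let ?j = "1 - (cmod (disc_aut (disc_aut a v) z))\<^sup>2"
          have j: "0 < ?j" by (rule one_minus_disc_aut_pos[OF disc_aut_in_disc[OF a v] z])
          \<comment> \<open>The weight centred at v, taken at phi_a(z), is the weight centred at
            phi_a(v), taken at z.\<close>
          have "1 - (cmod ?w)\<^sup>2 \<le> 25 * (1 - cmod v) * ?j"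
            using cone_disc_aut_le[OF v w True] unfolding cmod_disc_aut_disc_aut[OF a z v] .
          then have "(1 - (cmod ?w)\<^sup>2) powr s \<le> (25 * (1 - cmod v) * ?j) powr s"
            using one_minus_square_bounds(3)[OF w] s by (intro powr_mono2) auto
          also have "\<dots> = 25 powr s * (1 - cmod v) powr s * ?j powr s"
            by (simp only: powr_mult)
          finally have "(1 - (cmod ?w)\<^sup>2) powr s * (1 - cmod v) powr (- \<epsilon>) \<le> 25 powr s * (1 - cmod v) powr s * ?j powr s * (1 - cmod v) powr (- \<epsilon>)"
            by (rule mult_right_mono) simp
          also have "\<dots> = 25 powr s * ((1 - cmod v) powr \<sigma> * ?j powr s)"
          proof -
            have "(1 - cmod v) powr s * (1 - cmod v) powr (- \<epsilon>) = (1 - cmod v) powr \<sigma>"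
              by (simp add: \<epsilon>_def flip: powr_add)
            from this[symmetric] show ?thesis by (simp only: mult_ac)
          qed
          finally have "C1 * ((cmod (deriv g z))\<^sup>2 * (cmod (deriv F v))\<^sup>2) * ((1 - (cmod ?w)\<^sup>2) powr s * (1 - cmod v) powr (- \<epsilon>)) \<le> C1 * ((cmod (deriv g z))\<^sup>2 * (cmod (deriv F v))\<^sup>2) * (25 powr s * ((1 - cmod v) powr \<sigma> * ?j powr s))"
            using C1 by (intro mult_left_mono) auto
          then have "C1 * ((cmod (deriv g z))\<^sup>2 * (1 - (cmod ?w)\<^sup>2) powr s) * ((cmod (deriv F v))\<^sup>2 * (1 - cmod v) powr (- \<epsilon>)) \<le> C1 * 25 powr s * (((cmod (deriv F v))\<^sup>2 * (1 - cmod v) powr \<sigma>) * ((cmod (deriv g z))\<^sup>2 * ?j powr s))"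
            by (simp only: mult_ac)
          then have "ennreal (C1 * ((cmod (deriv g z))\<^sup>2 * (1 - (cmod ?w)\<^sup>2) powr s) * ((cmod (deriv F v))\<^sup>2 * (1 - cmod v) powr (- \<epsilon>))) \<le> ennreal (C1 * 25 powr s * (((cmod (deriv F v))\<^sup>2 * (1 - cmod v) powr \<sigma>) * ((cmod (deriv g z))\<^sup>2 * ?j powr s)))"
            by (rule ennreal_leI)
          then show ?thesis using True C1 by (simp add: ennreal_mult)
        qed simp
      qed
      finally show "ennreal ((cmod (f z - f a))\<^sup>2) * ennreal ((cmod (deriv g z))\<^sup>2 * (1 - (cmod ?w)\<^sup>2) powr s) \<le> (\<integral>\<^sup>+ v. ennreal (C1 * 25 powr s) * (?K v * ?G v z) \<partial>area_measure)" .
    qed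
    also have "\<dots> = (\<integral>\<^sup>+ z. ennreal (C1 * 25 powr s) * (\<integral>\<^sup>+ v. ?K v * ?G v z \<partial>area_measure) \<partial>area_measure)"
      by (intro nn_integral_cong nn_integral_cmult) measurable
    also have "\<dots> = ennreal (C1 * 25 powr s) * (\<integral>\<^sup>+ z. \<integral>\<^sup>+ v. ?K v * ?G v z \<partial>area_measure \<partial>area_measure)"
      by (rule nn_integral_cmult) (rule area_measure.borel_measurable_nn_integral[OF mG])
    also have "(\<integral>\<^sup>+ z. \<integral>\<^sup>+ v. ?K v * ?G v z \<partial>area_measure \<partial>area_measure) = (\<integral>\<^sup>+ v. \<integral>\<^sup>+ z. ?K v * ?G v z \<partial>area_measure \<partial>area_measure)"
      by (rule Fubini'[OF mG, symmetric])
    also have "\<dots> = (\<integral>\<^sup>+ v. ?K v * (\<integral>\<^sup>+ z. ?G v z \<partial>area_measure) \<partial>area_measure)"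
      by (intro nn_integral_cong nn_integral_cmult) measurable
    also have "\<dots> \<le> (\<integral>\<^sup>+ v. ?K v * ennreal M \<partial>area_measure)"
      using disc_aut_in_disc[OF a] by (intro nn_integral_mono mult_left_mono Q) auto
    also have "\<dots> = (\<integral>\<^sup>+ v. ?K v \<partial>area_measure) * ennreal M"
      by (rule nn_integral_multc) measurable
    also have "\<dots> \<le> ennreal C2 * ennreal M" using FC2 by (rule mult_right_mono) simp
    finally have "(\<integral>\<^sup>+ z. ennreal ((cmod (f z - f a))\<^sup>2) * Q_density s g a z \<partial>area_measure)
      \<le> ennreal (C1 * 25 powr s) * (ennreal C2 * ennreal M)"
      by (simp add: mult_left_mono)
    also have "\<dots> = ennreal (C1 * 25 powr s * M * C2)"
      using C1 C2(1) M by (simp add: mult_ac flip: ennreal_mult')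
    finally show "(\<integral>\<^sup>+ z. ennreal ((cmod (f z - f a))\<^sup>2) * Q_density s g a z \<partial>area_measure)
      \<le> ennreal (C1 * 25 powr s * M * C2)" .
  qed
qed

section \<open>The Green function\<close>

lemma AE_area_measure_neq: "AE z in area_measure. z \<noteq> a"
proof (cases "a \<in> unit_disc")
  case True
  then have "{a} \<in> sets area_measure" by (auto simp: sets_restrict_space intro!: image_eqI[of _ _ "{a}"])
  then have "emeasure area_measure {a} = (\<integral>\<^sup>+ z. indicator {a} z \<partial>area_measure)" by simp
  also have "\<dots> = ennreal (1 / pi) * (\<integral>\<^sup>+ z \<in> unit_disc. indicator {a} z \<partial>lborel)"
    by (intro nn_integral_area_measure borel_measurable_area_measureI borel_measurable_indicator) simp
  also have "(\<integral>\<^sup>+ z \<in> unit_disc. indicator {a} z \<partial>lborel) = (\<integral>\<^sup>+ z. 0 \<partial>(lborel :: complex measure))"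
    by (rule nn_integral_cong_AE, use AE_lborel_singleton[of a] in eventually_elim) simp
  finally have "{a} \<in> null_sets area_measure" using \<open>{a} \<in> sets area_measure\<close> by (intro null_setsI) simp_all
  from AE_not_in[OF this] show ?thesis by simp
next
  case False
  then show ?thesis by (intro AE_I2) auto
qed

lemma green_eq: "cmod a < 1 \<Longrightarrow> cmod z < 1 \<Longrightarrow> z \<noteq> a \<Longrightarrow> green z a = - ln (cmod (disc_aut a z))"
  using one_minus_cnj_mult_nz[of a z] by (simp add: green_def disc_aut_def norm_divide ln_div)

text \<open>Apply ln x \<le> x - 1 to x = |phi_a(z)|^2.\<close>

lemma one_minus_disc_aut_le_green:
  assumes "cmod a < 1" "cmod z < 1" "z \<noteq> a"
  shows "1 - (cmod (disc_aut a z))\<^sup>2 \<le> 2 * green z a"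
proof -
  have "0 < cmod (disc_aut a z)"
    using assms one_minus_cnj_mult_nz[OF assms(1,2)] by (simp add: disc_aut_def)
  then have "ln ((cmod (disc_aut a z))\<^sup>2) \<le> (cmod (disc_aut a z))\<^sup>2 - 1" by (intro ln_le_minus_one) simp
  moreover have "ln ((cmod (disc_aut a z))\<^sup>2) = 2 * ln (cmod (disc_aut a z))"
    using \<open>0 < cmod (disc_aut a z)\<close> by (subst ln_realpow) auto
  ultimately show ?thesis unfolding green_eq[OF assms] by linarith
qed

lemma nn_integral_disc_aut_le_green:
  assumes a: "cmod a < 1" and s: "0 < s" and H: "H \<in> borel_measurable area_measure"
  shows "(\<integral>\<^sup>+ z. ennreal ((cmod (H z))\<^sup>2 * (1 - (cmod (disc_aut a z))\<^sup>2) powr s) \<partial>area_measure)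
    \<le> ennreal (2 powr s) * (\<integral>\<^sup>+ z. ennreal ((cmod (H z))\<^sup>2 * green z a powr s) \<partial>area_measure)"
proof -
  have "(\<integral>\<^sup>+ z. ennreal ((cmod (H z))\<^sup>2 * (1 - (cmod (disc_aut a z))\<^sup>2) powr s) \<partial>area_measure)
    \<le> (\<integral>\<^sup>+ z. ennreal (2 powr s) * ennreal ((cmod (H z))\<^sup>2 * green z a powr s) \<partial>area_measure)"
  proof (rule nn_integral_mono_AE, use AE_area_measure_neq[of a] AE_space in eventually_elim)
    fix z assume z: "z \<noteq> a" "z \<in> space area_measure"
    then have z1: "cmod z < 1" by simp
    have "(1 - (cmod (disc_aut a z))\<^sup>2) powr s \<le> (2 * green z a) powr s"
      using one_minus_disc_aut_le_green[OF a z1 z(1)] one_minus_disc_aut_pos[OF a z1] s by (intro powr_mono2) auto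
    then have "(cmod (H z))\<^sup>2 * (1 - (cmod (disc_aut a z))\<^sup>2) powr s \<le> (cmod (H z))\<^sup>2 * (2 powr s * green z a powr s)"
      unfolding powr_mult by (rule mult_left_mono) simp
    then show "ennreal ((cmod (H z))\<^sup>2 * (1 - (cmod (disc_aut a z))\<^sup>2) powr s) \<le> ennreal (2 powr s) * ennreal ((cmod (H z))\<^sup>2 * green z a powr s)"
      by (simp add: ennreal_leI mult_ac flip: ennreal_mult')
  qed
  also have "\<dots> = ennreal (2 powr s) * (\<integral>\<^sup>+ z. ennreal ((cmod (H z))\<^sup>2 * green z a powr s) \<partial>area_measure)"
    by (rule nn_integral_cmult) (use H in \<open>unfold green_def, measurable\<close>)
  finally show ?thesis .
qed

text \<open>The Jacobian r of polar coordinates about a cancels the singularity.\<close>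

lemma nn_integral_inverse_dist_le:
  assumes R: "0 < R"
  shows "(\<integral>\<^sup>+ z \<in> ball a R. ennreal (1 / cmod (a - z)) \<partial>lborel) \<le> ennreal (2 * pi * R)"
proof -
  have m: "(\<lambda>z. ennreal (1 / cmod (a - z)) * indicator (ball a R) z) \<in> borel_measurable borel"
    by (intro borel_measurable_times_ennreal borel_measurable_indicator) simp_all
  have "(\<integral>\<^sup>+ z \<in> ball a R. ennreal (1 / cmod (a - z)) \<partial>lborel) = (\<integral>\<^sup>+ z \<in> ball a R. ennreal (1 / cmod (a - z)) \<partial>distr lborel borel ((+) a))"
    by (simp only: lborel_distr_plus)
  also have "\<dots> = (\<integral>\<^sup>+ w. ennreal (1 / cmod (a - (a + w))) * indicator (ball a R) (a + w) \<partial>lborel)"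
    using m by (subst nn_integral_distr) auto
  also have "\<dots> = (\<integral>\<^sup>+ w. ennreal (1 / cmod w) * indicator (ball 0 R) w \<partial>lborel)"
    by (intro nn_integral_cong) (auto simp: indicator_def dist_norm)
  also have "\<dots> = (\<integral>\<^sup>+ \<theta> \<in> {-pi<..<pi}. (\<integral>\<^sup>+ r \<in> {0<..}. (ennreal (1 / cmod (rcis r \<theta>)) * indicator (ball 0 R) (rcis r \<theta>) * ennreal r) \<partial>lborel) \<partial>lborel)"
    by (intro nn_integral_polar borel_measurable_times_ennreal borel_measurable_indicator) simp_all
  also have "\<dots> = (\<integral>\<^sup>+ \<theta>. ennreal R * indicator {-pi<..<pi} \<theta> \<partial>lborel)"
  proof (intro nn_integral_cong arg_cong2[where f = "(*)"] refl)
    fix \<theta> :: real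
    have "(\<integral>\<^sup>+ r \<in> {0<..}. (ennreal (1 / cmod (rcis r \<theta>)) * indicator (ball 0 R) (rcis r \<theta>) * ennreal r) \<partial>lborel) = (\<integral>\<^sup>+ r. indicator {0<..<R} r \<partial>lborel)"
    proof (rule nn_integral_cong)
      fix r :: real
      show "ennreal (1 / cmod (rcis r \<theta>)) * indicator (ball 0 R) (rcis r \<theta>) * ennreal r * indicator {0<..} r = indicator {0<..<R} r"
      proof (cases "0 < r \<and> r < R")
        case True
        then have "ennreal (1 / r) * ennreal r = 1" by (simp flip: ennreal_mult')
        then show ?thesis using True by (simp add: rcis_def norm_mult)
      qed (auto simp: indicator_def rcis_def norm_mult)
    qed
    also have "\<dots> = ennreal R" using R by simp
    finally show "(\<integral>\<^sup>+ r \<in> {0<..}. (ennreal (1 / cmod (rcis r \<theta>)) * indicator (ball 0 R) (rcis r \<theta>) * ennreal r) \<partial>lborel) = ennreal R" .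
  qed
  also have "\<dots> = ennreal R * ennreal (2 * pi)"
  proof -
    have "emeasure lborel {-pi<..<pi} = ennreal (pi - - pi)" by (rule emeasure_lborel_Ioo) simp
    then show ?thesis by (subst nn_integral_cmult_indicator) (simp, simp only:, simp)
  qed
  also have "\<dots> = ennreal (2 * pi * R)" using R by (simp add: mult_ac flip: ennreal_mult')
  finally show ?thesis by simp
qed

text \<open>Away from a the Green function is at most a multiple of 1 - |phi_a|^2. Near a it has a
  logarithmic singularity, but there subharmonicity bounds |H|^2 by a multiple of K / \<delta>^2,
  and the singularity is integrable. The constant 41 is 32 from the near part plus 9 from the far
  part.\<close>

lemma nn_integral_green_le:
  assumes H: "H holomorphic_on unit_disc" and a: "cmod a < 1" and s: "0 < s" "s \<le> 1" and K: "0 \<le> K"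
    and le: "(\<integral>\<^sup>+ z. ennreal ((cmod (H z))\<^sup>2 * (1 - (cmod (disc_aut a z))\<^sup>2) powr s) \<partial>area_measure) \<le> ennreal K"
  shows "(\<integral>\<^sup>+ z. ennreal ((cmod (H z))\<^sup>2 * green z a powr s) \<partial>area_measure) \<le> ennreal (41 * K)"
proof -
  have [measurable]: "H \<in> borel_measurable area_measure"
    by (rule borel_measurable_area_measure_holomorphic[OF H])
  define \<delta> where "\<delta> = 1 - cmod a"
  have \<delta>: "0 < \<delta>" using a by (simp add: \<delta>_def)
  \<comment> \<open>Expansion about z = a: the modulus differs from 1 - |a|^2 by at most |a| |a -
    z|, so it is of the order \<delta> near a.\<close>
  have expand: "1 - cnj a * z = of_real (1 - (cmod a)\<^sup>2) - cnj a * (z - a)" for z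
    by (simp add: algebra_simps complex_norm_square del: of_real_power)
  have a2: "\<delta> \<le> 1 - (cmod a)\<^sup>2" "1 - (cmod a)\<^sup>2 \<le> 2 * \<delta>"
    using one_minus_square_bounds[OF a] by (simp_all add: \<delta>_def)
  have prod_le: "cmod (cnj a * (z - a)) \<le> cmod a * cmod (a - z)" for z
    by (simp add: norm_mult norm_minus_commute)
  have ge: "1 - (cmod a)\<^sup>2 - cmod a * cmod (a - z) \<le> cmod (1 - cnj a * z)" for z
  proof -
    have "cmod (of_real (1 - (cmod a)\<^sup>2)) - cmod (cnj a * (z - a)) \<le> cmod (1 - cnj a * z)"
      unfolding expand by (rule norm_triangle_ineq2)
    moreover have "cmod (of_real (1 - (cmod a)\<^sup>2) :: complex) = 1 - (cmod a)\<^sup>2"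
      using a2 \<delta> unfolding norm_of_real by linarith
    ultimately show ?thesis using prod_le[of z] by linarith
  qed
  have up: "cmod (1 - cnj a * z) \<le> 2 * \<delta> + cmod (a - z)" for z
  proof -
    have "cmod (1 - cnj a * z) \<le> cmod (of_real (1 - (cmod a)\<^sup>2)) + cmod (cnj a * (z - a))"
      unfolding expand by (rule norm_triangle_ineq4)
    moreover have "cmod (of_real (1 - (cmod a)\<^sup>2) :: complex) = 1 - (cmod a)\<^sup>2"
      using a2 \<delta> unfolding norm_of_real by linarith
    moreover have "cmod a * cmod (a - z) \<le> 1 * cmod (a - z)" using a by (intro mult_right_mono) auto
    ultimately show ?thesis using prod_le[of z] a2 by linarith
  qed
  have sub: "ball a (\<delta> / 2) \<subseteq> unit_disc" using ball_half_distance(3)[OF a] by (auto simp: \<delta>_def)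
  have mb: "(indicator (ball z R) :: complex \<Rightarrow> ennreal) \<in> borel_measurable area_measure" for z R
    by (rule borel_measurable_area_measureI[OF borel_measurable_indicator]) simp
  \<comment> \<open>On this ball the denominator of phi_a(z) is at least (1 - |a|^2) - |a| \<delta>
    = \<delta>, so |phi_a(z)| \<le> 1/2.\<close>
  have aut_near: "3 / 4 \<le> 1 - (cmod (disc_aut a z))\<^sup>2" if z: "z \<in> ball a (\<delta> / 2)" for z
  proof -
    have d: "cmod (a - z) \<le> \<delta> / 2" using z by (simp add: dist_norm)
    have "cmod a * cmod (a - z) \<le> cmod a * (\<delta> / 2)" using d by (rule mult_left_mono) simp
    also have "\<dots> \<le> cmod a * \<delta>" using \<delta> by (simp add: mult_left_mono)
    finally have "\<delta> \<le> cmod (1 - cnj a * z)"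
      using ge[of z] by (simp add: \<delta>_def power2_eq_square algebra_simps)
    then have "cmod (disc_aut a z) \<le> (\<delta> / 2) / \<delta>"
      unfolding disc_aut_def norm_divide using d \<delta> by (intro frac_le) auto
    then have "cmod (disc_aut a z) \<le> 1 / 2" using \<delta> by simp
    then have "(cmod (disc_aut a z))\<^sup>2 \<le> (1 / 2)\<^sup>2" by (intro power_mono) auto
    then show ?thesis by (simp add: power2_eq_square)
  qed
  have near: "(\<integral>\<^sup>+ z \<in> ball a (\<delta> / 2). ennreal ((cmod (H z))\<^sup>2) \<partial>area_measure) \<le> ennreal (4 / 3 * K)"
  proof -
    have "(\<integral>\<^sup>+ z \<in> ball a (\<delta> / 2). ennreal ((cmod (H z))\<^sup>2) \<partial>area_measure)
      \<le> (\<integral>\<^sup>+ z. ennreal (4 / 3) * ennreal ((cmod (H z))\<^sup>2 * (1 - (cmod (disc_aut a z))\<^sup>2) powr s) \<partial>area_measure)"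
    proof (rule nn_integral_mono)
      fix z
      show "ennreal ((cmod (H z))\<^sup>2) * indicator (ball a (\<delta> / 2)) z \<le> ennreal (4 / 3) * ennreal ((cmod (H z))\<^sup>2 * (1 - (cmod (disc_aut a z))\<^sup>2) powr s)"
      proof (cases "z \<in> ball a (\<delta> / 2)")
        case True
        have "(3 / 4 :: real) powr 1 \<le> (3 / 4) powr s" using s by (intro powr_mono') auto
        also have "\<dots> \<le> (1 - (cmod (disc_aut a z))\<^sup>2) powr s" using aut_near[OF True] s by (intro powr_mono2) auto
        finally have "(cmod (H z))\<^sup>2 * (3 / 4) \<le> (cmod (H z))\<^sup>2 * (1 - (cmod (disc_aut a z))\<^sup>2) powr s"
          by (intro mult_left_mono) auto
        then have "(cmod (H z))\<^sup>2 \<le> 4 / 3 * ((cmod (H z))\<^sup>2 * (1 - (cmod (disc_aut a z))\<^sup>2) powr s)" by simp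
        then have "ennreal ((cmod (H z))\<^sup>2) \<le> ennreal (4 / 3 * ((cmod (H z))\<^sup>2 * (1 - (cmod (disc_aut a z))\<^sup>2) powr s))"
          by (rule ennreal_leI)
        also have "\<dots> = ennreal (4 / 3) * ennreal ((cmod (H z))\<^sup>2 * (1 - (cmod (disc_aut a z))\<^sup>2) powr s)"
          by (rule ennreal_mult') simp
        finally show ?thesis using True by simp
      qed simp
    qed
    also have "\<dots> = ennreal (4 / 3) * (\<integral>\<^sup>+ z. ennreal ((cmod (H z))\<^sup>2 * (1 - (cmod (disc_aut a z))\<^sup>2) powr s) \<partial>area_measure)"
      by (rule nn_integral_cmult) (unfold disc_aut_def, measurable)
    also have "\<dots> \<le> ennreal (4 / 3) * ennreal K" using le by (rule mult_left_mono) simp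
    also have "\<dots> = ennreal (4 / 3 * K)" by (rule ennreal_mult'[symmetric]) simp
    finally show ?thesis .
  qed
  \<comment> \<open>Discs of radius \<delta> / 4 about these points stay in the ball of
    \<open>near\<close>; dividing 4/3 K by (\<delta> / 4)^2 gives the constant.\<close>
  have Hbd: "(cmod (H z))\<^sup>2 \<le> 64 / 3 * K / \<delta>\<^sup>2" if z: "z \<in> ball a (\<delta> / 4)" for z
  proof -
    have sub': "ball z (\<delta> / 4) \<subseteq> ball a (\<delta> / 2)"
    proof
      fix u assume "u \<in> ball z (\<delta> / 4)"
      then have "dist z u < \<delta> / 4" "dist a z < \<delta> / 4" using z by auto
      then show "u \<in> ball a (\<delta> / 2)" using dist_triangle[of a u z] by simp
    qed
    have "ennreal ((\<delta> / 4)\<^sup>2 * cmod (H z) powr 2) \<le> (\<integral>\<^sup>+ w \<in> ball z (\<delta> / 4). ennreal (cmod (H w) powr 2) \<partial>area_measure)"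
      using \<delta> sub sub' by (intro submean_value_powr[OF H]) auto
    also have "\<dots> \<le> (\<integral>\<^sup>+ w \<in> ball a (\<delta> / 2). ennreal ((cmod (H w))\<^sup>2) \<partial>area_measure)"
      using sub' by (intro nn_integral_mono) (auto simp: indicator_def)
    also note near
    finally have "(\<delta> / 4)\<^sup>2 * (cmod (H z))\<^sup>2 \<le> 4 / 3 * K" using K by simp
    then show ?thesis using \<delta> by (simp add: field_simps)
  qed
  let ?N = "64 * K / \<delta>"
  have "(\<integral>\<^sup>+ z. ennreal ((cmod (H z))\<^sup>2 * green z a powr s) \<partial>area_measure)
    \<le> (\<integral>\<^sup>+ z. ennreal ?N * (ennreal (1 / cmod (a - z)) * indicator (ball a (\<delta> / 4)) z) + ennreal 9 * ennreal ((cmod (H z))\<^sup>2 * (1 - (cmod (disc_aut a z))\<^sup>2) powr s) \<partial>area_measure)"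
  proof (rule nn_integral_mono_AE, use AE_area_measure_neq[of a] AE_space in eventually_elim)
    fix z assume z: "z \<noteq> a" "z \<in> space area_measure"
    then have z1: "cmod z < 1" and r: "0 < cmod (a - z)" by simp_all
    have t: "0 < cmod (disc_aut a z)"
      using z one_minus_cnj_mult_nz[OF a z1] by (simp add: disc_aut_def)
    have t1: "cmod (disc_aut a z) < 1" by (rule disc_aut_in_disc[OF a z1])
    have g0: "0 \<le> green z a" unfolding green_eq[OF a z1 z(1)] using t t1 by simp
    show "ennreal ((cmod (H z))\<^sup>2 * green z a powr s) \<le> ennreal ?N * (ennreal (1 / cmod (a - z)) * indicator (ball a (\<delta> / 4)) z) + ennreal 9 * ennreal ((cmod (H z))\<^sup>2 * (1 - (cmod (disc_aut a z))\<^sup>2) powr s)"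
    proof (cases "z \<in> ball a (\<delta> / 4)")
      case True
      then have d: "cmod (a - z) < \<delta>" using \<delta> by (simp add: dist_norm)
      \<comment> \<open>For s \<le> 1 the power is at most 1 plus the Green function, and 1 + ln x
        \<le> x replaces the logarithm by the quotient itself, whose singularity 1 / |a - z| is
        still integrable.\<close>
      have "green z a powr s \<le> 1 + green z a"
      proof (cases "green z a \<le> 1")
        case True
        then have "green z a powr s \<le> 1" using g0 s by (intro powr_le1) auto
        then show ?thesis using g0 by linarith
      next
        case False
        then have "green z a powr s \<le> green z a powr 1" using s by (intro powr_mono) auto
        then show ?thesis using g0 by simp
      qed
      also have "\<dots> \<le> cmod (1 - cnj a * z) / cmod (a - z)"
        using ln_le_minus_one[of "cmod (1 - cnj a * z) / cmod (a - z)"] r one_minus_cnj_mult_nz[OF a z1] by (simp add: green_def)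
      also have "\<dots> \<le> 3 * \<delta> / cmod (a - z)"
        using up[of z] d r by (intro divide_right_mono) auto
      finally have "(cmod (H z))\<^sup>2 * green z a powr s \<le> (64 / 3 * K / \<delta>\<^sup>2) * (3 * \<delta> / cmod (a - z))"
        using Hbd[OF True] K \<delta> by (intro mult_mono) auto
      also have "\<dots> = ?N * (1 / cmod (a - z))" using \<delta> by (simp add: power2_eq_square)
      finally have "ennreal ((cmod (H z))\<^sup>2 * green z a powr s) \<le> ennreal (?N * (1 / cmod (a - z)))" by (rule ennreal_leI)
      also have "\<dots> = ennreal ?N * ennreal (1 / cmod (a - z))" using K \<delta> by (intro ennreal_mult') auto
      finally show ?thesis using True by (simp add: add_increasing2)
    next
      case False
      then have d: "\<delta> \<le> 4 * cmod (a - z)" by (simp add: dist_norm)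
      \<comment> \<open>2 \<delta> \<le> 8 |a - z| gives the 9. So t = |phi_a(z)| is at least 1/9,
        and - ln t \<le> (1 - t) / t \<le> 9 (1 - t).\<close>
      have "cmod (1 - cnj a * z) \<le> 9 * cmod (a - z)" using up[of z] d by linarith
      then have t9: "1 / 9 \<le> cmod (disc_aut a z)"
        unfolding disc_aut_def norm_divide using one_minus_cnj_mult_nz[OF a z1] by (simp add: field_simps)
      let ?t = "cmod (disc_aut a z)"
      have "green z a = ln (1 / ?t)" unfolding green_eq[OF a z1 z(1)] using t by (simp add: ln_div)
      also have "\<dots> \<le> 1 / ?t - 1" using t by (intro ln_le_minus_one) simp
      also have "\<dots> = (1 - ?t) * (1 / ?t)" using t by (simp add: field_simps)
      also have "\<dots> \<le> (1 - ?t) * 9" using t t1 t9 by (intro mult_left_mono) (auto simp: field_simps)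
      also have "\<dots> \<le> 9 * (1 - ?t\<^sup>2)" using one_minus_square_bounds(1)[OF t1] by simp
      finally have "green z a powr s \<le> (9 * (1 - ?t\<^sup>2)) powr s" using g0 s by (intro powr_mono2) auto
      also have "\<dots> = 9 powr s * (1 - ?t\<^sup>2) powr s" by (rule powr_mult)
      also have "\<dots> \<le> 9 powr 1 * (1 - ?t\<^sup>2) powr s" using s by (intro mult_right_mono powr_mono) auto
      finally have "(cmod (H z))\<^sup>2 * green z a powr s \<le> (cmod (H z))\<^sup>2 * (9 * (1 - ?t\<^sup>2) powr s)"
        by (intro mult_left_mono) auto
      then have "ennreal ((cmod (H z))\<^sup>2 * green z a powr s) \<le> ennreal (9 * ((cmod (H z))\<^sup>2 * (1 - ?t\<^sup>2) powr s))"
        by (intro ennreal_leI) (simp add: mult_ac)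
      also have "\<dots> = ennreal 9 * ennreal ((cmod (H z))\<^sup>2 * (1 - ?t\<^sup>2) powr s)" by (rule ennreal_mult') simp
      finally show ?thesis by (simp add: add_increasing)
    qed
  qed
  also have "\<dots> = ennreal ?N * (\<integral>\<^sup>+ z \<in> ball a (\<delta> / 4). ennreal (1 / cmod (a - z)) \<partial>area_measure)
      + ennreal 9 * (\<integral>\<^sup>+ z. ennreal ((cmod (H z))\<^sup>2 * (1 - (cmod (disc_aut a z))\<^sup>2) powr s) \<partial>area_measure)"
  proof -
    have m1[measurable]: "(\<lambda>z. ennreal (1 / cmod (a - z)) * indicator (ball a (\<delta> / 4)) z) \<in> borel_measurable area_measure"
      by (intro borel_measurable_times_ennreal mb) measurable
    have m2[measurable]: "(\<lambda>z. ennreal ((cmod (H z))\<^sup>2 * (1 - (cmod (disc_aut a z))\<^sup>2) powr s)) \<in> borel_measurable area_measure"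
      unfolding disc_aut_def by measurable
    show ?thesis
      by (subst nn_integral_add) (simp_all add: nn_integral_cmult[OF m1] nn_integral_cmult[OF m2])
  qed
  also have "\<dots> \<le> ennreal ?N * ennreal (\<delta> / 2) + ennreal 9 * ennreal K"
  proof (intro add_mono mult_left_mono le)
    have "(\<integral>\<^sup>+ z \<in> ball a (\<delta> / 4). ennreal (1 / cmod (a - z)) \<partial>area_measure)
      = ennreal (1 / pi) * (\<integral>\<^sup>+ z \<in> unit_disc. (ennreal (1 / cmod (a - z)) * indicator (ball a (\<delta> / 4)) z) \<partial>lborel)"
      by (intro nn_integral_area_measure borel_measurable_times_ennreal mb) measurable
    also have "\<dots> \<le> ennreal (1 / pi) * (\<integral>\<^sup>+ z \<in> ball a (\<delta> / 4). ennreal (1 / cmod (a - z)) \<partial>lborel)"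
      by (intro mult_left_mono nn_integral_mono) (auto simp: indicator_def)
    also have "\<dots> \<le> ennreal (1 / pi) * ennreal (2 * pi * (\<delta> / 4))"
      using \<delta> by (intro mult_left_mono nn_integral_inverse_dist_le) auto
    also have "\<dots> = ennreal (1 / pi * (2 * pi * (\<delta> / 4)))" by (rule ennreal_mult'[symmetric]) simp
    also have "1 / pi * (2 * pi * (\<delta> / 4)) = \<delta> / 2" by simp
    finally show "(\<integral>\<^sup>+ z \<in> ball a (\<delta> / 4). ennreal (1 / cmod (a - z)) \<partial>area_measure) \<le> ennreal (\<delta> / 2)" .
  qed simp_all
  also have "\<dots> = ennreal (?N * (\<delta> / 2) + 9 * K)"
    using K \<delta> by (intro ennreal_lincomb[symmetric]) auto
  also have "?N * (\<delta> / 2) + 9 * K = 41 * K" using \<delta> by simp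
  finally show ?thesis .
qed

section \<open>A critical Forelli--Rudin estimate\<close>

text \<open>The Taylor remainder |x|^3 / 6 is at most 2/3 |x| for |x| \<le> 2.\<close>

lemma abs_sin_ge: "\<bar>x\<bar> \<le> 2 \<Longrightarrow> \<bar>x\<bar> / 3 \<le> \<bar>sin x\<bar>" for x :: real
proof -
  assume x: "\<bar>x\<bar> \<le> 2"
  have "\<bar>sin x - x\<bar> \<le> \<bar>x\<bar> ^ 3 / 6"
    using Maclaurin_sin_bound[of x 3] by (simp add: eval_nat_numeral sin_coeff_def)
  also have "\<bar>x\<bar> ^ 3 / 6 \<le> 2 / 3 * \<bar>x\<bar>"
  proof -
    have "\<bar>x\<bar> * (\<bar>x\<bar> * \<bar>x\<bar>) \<le> \<bar>x\<bar> * (2 * 2)" using x by (intro mult_left_mono mult_mono) auto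
    then show ?thesis by (simp add: power3_eq_cube mult.assoc)
  qed
  finally show ?thesis by linarith
qed

text \<open>The chord satisfies |cis \<theta> - 1| = 2 |sin (\<theta> / 2)| \<ge> |\<theta>| / 3.
  Going from cis \<theta> to \<rho> cis \<theta> changes it by 1 - \<rho>, itself at most |1 -
  \<rho> cis \<theta>|, which costs one more factor 2.\<close>

lemma cmod_one_minus_rcis_ge:
  assumes "0 \<le> \<rho>" "\<rho> \<le> 1" "\<bar>\<theta>\<bar> \<le> pi"
  shows "\<bar>\<theta>\<bar> / 6 \<le> cmod (1 - rcis \<rho> \<theta>)" "1 - \<rho> \<le> cmod (1 - rcis \<rho> \<theta>)"
proof -
  have n: "cmod (rcis \<rho> \<theta>) = \<rho>" using assms(1) by simp
  show 1: "1 - \<rho> \<le> cmod (1 - rcis \<rho> \<theta>)" using norm_triangle_ineq2[of 1 "rcis \<rho> \<theta>"] unfolding n by simp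
  have "(cmod (cis \<theta> - 1))\<^sup>2 = (2 * sin (\<theta> / 2))\<^sup>2"
  proof -
    have "(cmod (cis \<theta> - 1))\<^sup>2 = (cos \<theta> - 1)\<^sup>2 + (sin \<theta>)\<^sup>2" by (simp add: cmod_power2)
    also have "\<dots> = 2 - 2 * cos \<theta>"
      using sin_cos_squared_add[of \<theta>] by (simp add: power2_diff)
    also have "cos \<theta> = 1 - 2 * (sin (\<theta> / 2))\<^sup>2" using cos_double_sin[of "\<theta> / 2"] by simp
    finally show ?thesis by (simp add: power_mult_distrib)
  qed
  then have "cmod (cis \<theta> - 1) = \<bar>2 * sin (\<theta> / 2)\<bar>"
    by (metis abs_of_nonneg norm_ge_zero power2_eq_iff_nonneg power2_abs abs_ge_zero)
  moreover have "\<bar>\<theta> / 2\<bar> / 3 \<le> \<bar>sin (\<theta> / 2)\<bar>"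
    using assms(3) pi_half_less_two by (intro abs_sin_ge) simp
  ultimately have "\<bar>\<theta>\<bar> / 3 \<le> cmod (cis \<theta> - 1)" by (simp add: abs_mult)
  also have "cis \<theta> - 1 = of_real (1 - \<rho>) * cis \<theta> - (1 - rcis \<rho> \<theta>)"
    by (simp add: rcis_def algebra_simps)
  also have "cmod \<dots> \<le> cmod (of_real (1 - \<rho>) * cis \<theta>) + cmod (1 - rcis \<rho> \<theta>)" by (rule norm_triangle_ineq4)
  also have "cmod (of_real (1 - \<rho>) * cis \<theta>) = 1 - \<rho>" using assms(2) by (simp add: norm_mult del: of_real_diff)
  finally show "\<bar>\<theta>\<bar> / 6 \<le> cmod (1 - rcis \<rho> \<theta>)" using 1 by (simp add: field_simps)
qed

text \<open>With y = 1 - r the quotient y / (y + m) has y-derivative m / (y + m)^2. Hence an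
  antiderivative is a multiple of (y / (y + m)) powr (p - 1), a quantity between 0 and 1.\<close>

lemma nn_integral_radial_kernel_le:
  assumes p: "1 < p" and m: "0 < m"
  shows "(\<integral>\<^sup>+ r \<in> {0<..<1}. ennreal ((1 - r) powr (p - 2) * (1 - r + m) powr (- p)) \<partial>lborel) \<le> ennreal (1 / (m * (p - 1)))"
proof (rule nn_integral_deriv_le[where F = "\<lambda>r. - (((1 - r) / (1 - r + m)) powr (p - 1)) / (m * (p - 1))"])
  fix x :: real assume x: "0 < x" "x < 1"
  define y where "y = 1 - x"
  have y: "0 < y" using x by (simp add: y_def)
  define c where "c = (p - 1) * (y / (y + m)) powr (p - 1 - 1) * (- (m / ((y + m) * (y + m))))"
  have d1: "((\<lambda>r. (1 - r) / (1 - r + m)) has_real_derivative - (m / ((y + m) * (y + m)))) (at x)"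
    using y m unfolding y_def by (auto intro!: derivative_eq_intros simp: field_simps)
  have d2: "((\<lambda>t. t powr (p - 1)) has_real_derivative (p - 1) * (y / (y + m)) powr (p - 1 - 1)) (at ((1 - x) / (1 - x + m)))"
    using y m by (intro has_real_derivative_powr[THEN DERIV_cong]) (simp_all add: y_def)
  have "((\<lambda>r. ((1 - r) / (1 - r + m)) powr (p - 1)) has_real_derivative c) (at x)"
    unfolding c_def by (rule DERIV_chain2[OF d2 d1])
  then have "((\<lambda>r. - (((1 - r) / (1 - r + m)) powr (p - 1)) / (m * (p - 1))) has_real_derivative (- c) / (m * (p - 1))) (at x)"
    by (intro DERIV_cdivide DERIV_minus)
  moreover have "(- c) / (m * (p - 1)) = (1 - x) powr (p - 2) * (1 - x + m) powr (- p)"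
  proof -
    have "(y + m) powr (- p) = (y + m) powr (- (p - 2)) * (y + m) powr (- 2)" by (simp flip: powr_add)
    also have "(y + m) powr (- 2) = 1 / ((y + m) * (y + m))"
      using y m by (simp add: powr_minus powr_numeral power2_eq_square field_simps)
    finally have "(y + m) powr (- p) = (y + m) powr (- (p - 2)) * (1 / ((y + m) * (y + m)))" .
    moreover have "(y / (y + m)) powr (p - 2) = y powr (p - 2) * (y + m) powr (- (p - 2))"
      using y m powr_minus_divide[of "y + m" "p - 2"] by (simp add: powr_divide)
    ultimately show ?thesis using m p by (simp add: c_def y_def mult_ac)
  qed
  ultimately show "((\<lambda>r. - (((1 - r) / (1 - r + m)) powr (p - 1)) / (m * (p - 1))) has_real_derivative (1 - x) powr (p - 2) * (1 - x + m) powr (- p)) (at x)"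
    by simp
next
  fix x y :: real assume xy: "0 < x" "x \<le> y" "y < 1"
  have "((1 - x) / (1 - x + m)) powr (p - 1) \<le> 1" using xy m p by (intro powr_le1) (auto simp: field_simps)
  moreover have "0 \<le> ((1 - y) / (1 - y + m)) powr (p - 1)" by simp
  ultimately have "((1 - x) / (1 - x + m)) powr (p - 1) - ((1 - y) / (1 - y + m)) powr (p - 1) \<le> 1" by linarith
  then have "(((1 - x) / (1 - x + m)) powr (p - 1) - ((1 - y) / (1 - y + m)) powr (p - 1)) / (m * (p - 1)) \<le> 1 / (m * (p - 1))"
    using m p by (intro divide_right_mono) auto
  then show "- (((1 - y) / (1 - y + m)) powr (p - 1)) / (m * (p - 1)) - - (((1 - x) / (1 - x + m)) powr (p - 1)) / (m * (p - 1)) \<le> 1 / (m * (p - 1))"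
    by (simp add: diff_divide_distrib)
qed simp_all

text \<open>This is where the logarithm arises: on each half of the interval 6 ln (d + |\<theta>| /
  6) is an antiderivative up to sign, and d + pi / 6 \<le> 2.\<close>

lemma nn_integral_angular_kernel_le:
  assumes d: "0 < d" "d \<le> 1"
  shows "(\<integral>\<^sup>+ \<theta> \<in> {-pi<..<pi}. ennreal (1 / (d + \<bar>\<theta>\<bar> / 6)) \<partial>lborel) \<le> ennreal (12 * ln (2 / d))"
proof -
  let ?f = "\<lambda>\<theta>. 1 / (d + \<bar>\<theta>\<bar> / 6)"
  have L: "6 * ln (d + t / 6) - 6 * ln d \<le> 6 * ln (2 / d)" if "0 \<le> t" "t \<le> pi" for t
  proof -
    have "d + t / 6 \<le> 2" using that d pi_less_4 by linarith
    then have "ln (d + t / 6) \<le> ln 2" using that d by simp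
    then show ?thesis using d by (simp add: ln_div)
  qed
  have pos: "(\<integral>\<^sup>+ \<theta> \<in> {0<..<pi}. ennreal (?f \<theta>) \<partial>lborel) \<le> ennreal (6 * ln (2 / d))"
  proof (rule nn_integral_deriv_le[where F = "\<lambda>\<theta>. 6 * ln (d + \<theta> / 6)"])
    fix x y :: real assume xy: "0 < x" "x \<le> y" "y < pi"
    have "ln d \<le> ln (d + x / 6)" using xy d by simp
    then show "6 * ln (d + y / 6) - 6 * ln (d + x / 6) \<le> 6 * ln (2 / d)" using L[of y] xy by linarith
  qed (use d in \<open>auto intro!: derivative_eq_intros simp: add_pos_pos field_simps\<close>)
  have neg: "(\<integral>\<^sup>+ \<theta> \<in> {-pi<..<0}. ennreal (?f \<theta>) \<partial>lborel) \<le> ennreal (6 * ln (2 / d))"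
  proof (rule nn_integral_deriv_le[where F = "\<lambda>\<theta>. - 6 * ln (d - \<theta> / 6)"])
    fix x assume x: "-pi < x" "x < 0"
    then have "0 < d - x / 6" using d by linarith
    then show "((\<lambda>\<theta>. - 6 * ln (d - \<theta> / 6)) has_real_derivative ?f x) (at x)"
      using x by (auto intro!: derivative_eq_intros simp: field_simps)
  next
    fix x y :: real assume xy: "-pi < x" "x \<le> y" "y < 0"
    have "ln d \<le> ln (d - y / 6)" using xy d by simp
    then show "- 6 * ln (d - y / 6) - - 6 * ln (d - x / 6) \<le> 6 * ln (2 / d)" using L[of "- x"] xy by simp
  qed (use d in auto)
  have "(\<integral>\<^sup>+ \<theta> \<in> {-pi<..<pi}. ennreal (?f \<theta>) \<partial>lborel) = (\<integral>\<^sup>+ \<theta>. ennreal (?f \<theta>) * indicator {-pi<..<0} \<theta> + ennreal (?f \<theta>) * indicator {0<..<pi} \<theta> \<partial>lborel)"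
    by (rule nn_integral_cong_AE, use AE_lborel_singleton[of "0::real"] in eventually_elim) (auto simp: indicator_def)
  also have "\<dots> = (\<integral>\<^sup>+ \<theta> \<in> {-pi<..<0}. ennreal (?f \<theta>) \<partial>lborel) + (\<integral>\<^sup>+ \<theta> \<in> {0<..<pi}. ennreal (?f \<theta>) \<partial>lborel)"
    by (rule nn_integral_add) measurable
  also have "\<dots> \<le> ennreal (6 * ln (2 / d)) + ennreal (6 * ln (2 / d))" using neg pos by (rule add_mono)
  also have "\<dots> = ennreal (12 * ln (2 / d))" using d by (simp flip: ennreal_plus)
  finally show ?thesis .
qed

lemma nn_integral_lborel_rotate:
  fixes u :: "complex \<Rightarrow> ennreal"
  assumes "cmod e = 1" "u \<in> borel_measurable borel"
  shows "(\<integral>\<^sup>+ z. u z \<partial>lborel) = (\<integral>\<^sup>+ z. u (e * z) \<partial>lborel)"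
proof -
  have e: "e \<noteq> 0" using assms(1) by auto
  have "surj ((*) e)" by (rule surjI[of _ "\<lambda>z. z / e"]) (use e in simp)
  moreover have "deriv ((*) e) w = e" for w by (rule DERIV_imp_deriv) (auto intro!: derivative_eq_intros)
  moreover have "(\<integral>\<^sup>+ z \<in> (*) e ` UNIV. u z \<partial>lborel) = (\<integral>\<^sup>+ w \<in> UNIV. (ennreal ((cmod (deriv ((*) e) w))\<^sup>2) * u (e * w)) \<partial>lborel)"
    by (rule nn_integral_holomorphic_subst)
      (use e assms(2) in \<open>auto intro!: holomorphic_intros inj_onI measurable_restrict_space1\<close>)
  ultimately show ?thesis using assms(1) by simp
qed

text \<open>The exponent p = 2 + (p - 2) is the critical one, with logarithmic growth. After a
  rotation b is nonnegative, and |1 - |b| r cis \<theta>| is at least a third of 1 - r + d +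
  |\<theta>| / 6, because each of the three summands is a lower bound for it. The radial integral
  leaves 1 / (d + |\<theta>| / 6), the angular one the logarithm.\<close>

lemma forelli_rudin_log:
  assumes p: "1 < p" and b: "cmod b < 1"
  shows "(\<integral>\<^sup>+ z. ennreal ((1 - cmod z) powr (p - 2) * cmod (1 - cnj b * z) powr (- p)) \<partial>area_measure)
    \<le> ennreal (12 * 3 powr p / (p - 1) * ln (2 / (1 - cmod b)))"
proof -
  obtain e where e: "cmod e = 1" "b = of_real (cmod b) * e" by (rule disc_polar_form)
  have ee: "cnj b * (e * z) = of_real (cmod b) * z" for z
  proof -
    have "cnj e * e = 1" using e complex_norm_square[of e] by (simp add: mult.commute)
    then have "cnj (of_real (cmod b) * e) * (e * z) = of_real (cmod b) * z" by (simp add: mult.assoc[symmetric])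
    then show ?thesis using e(2) by simp
  qed
  define d where "d = 1 - cmod b"
  have d: "0 < d" "d \<le> 1" using b by (simp_all add: d_def)
  let ?u = "\<lambda>z. ennreal ((1 - cmod z) powr (p - 2) * cmod (1 - cnj b * z) powr (- p)) * indicator unit_disc z"
  let ?v = "\<lambda>z. ennreal ((1 - cmod z) powr (p - 2) * cmod (1 - of_real (cmod b) * z) powr (- p)) * indicator unit_disc z"
  have mu: "?u \<in> borel_measurable borel" and mv: "?v \<in> borel_measurable borel"
    by (intro borel_measurable_times_ennreal borel_measurable_indicator; simp)+
  have ev: "?u (e * z) = ?v z" for z
    unfolding ee using e(1) by (simp add: norm_mult indicator_def)
  have "(\<integral>\<^sup>+ z. ?u z \<partial>lborel) = (\<integral>\<^sup>+ z. ?v z \<partial>lborel)"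
    using nn_integral_lborel_rotate[OF e(1) mu] unfolding ev .
  also have "\<dots> = (\<integral>\<^sup>+ \<theta> \<in> {-pi<..<pi}. (\<integral>\<^sup>+ r \<in> {0<..}. (?v (rcis r \<theta>) * ennreal r) \<partial>lborel) \<partial>lborel)"
    by (rule nn_integral_polar[OF mv])
  also have "\<dots> \<le> (\<integral>\<^sup>+ \<theta>. ennreal (3 powr p / (p - 1)) * (ennreal (1 / (d + \<bar>\<theta>\<bar> / 6)) * indicator {-pi<..<pi} \<theta>) \<partial>lborel)"
  proof (rule nn_integral_mono)
    fix \<theta> :: real
    show "(\<integral>\<^sup>+ r \<in> {0<..}. (?v (rcis r \<theta>) * ennreal r) \<partial>lborel) * indicator {-pi<..<pi} \<theta> \<le> ennreal (3 powr p / (p - 1)) * (ennreal (1 / (d + \<bar>\<theta>\<bar> / 6)) * indicator {-pi<..<pi} \<theta>)"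
    proof (cases "\<theta> \<in> {-pi<..<pi}")
      case True
      define m where "m = d + \<bar>\<theta>\<bar> / 6"
      have m: "0 < m" using d by (simp add: m_def)
      have "(\<integral>\<^sup>+ r \<in> {0<..}. (?v (rcis r \<theta>) * ennreal r) \<partial>lborel) \<le> (\<integral>\<^sup>+ r. ennreal (3 powr p) * (ennreal ((1 - r) powr (p - 2) * (1 - r + m) powr (- p)) * indicator {0<..<1} r) \<partial>lborel)"
      proof (rule nn_integral_mono)
        fix r :: real
        show "?v (rcis r \<theta>) * ennreal r * indicator {0<..} r \<le> ennreal (3 powr p) * (ennreal ((1 - r) powr (p - 2) * (1 - r + m) powr (- p)) * indicator {0<..<1} r)"
        proof (cases "0 < r \<and> r < 1")
          case r: True
          let ?\<rho> = "cmod b * r"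
          have \<rho>: "0 \<le> ?\<rho>" "?\<rho> \<le> r" "?\<rho> \<le> cmod b"
            using r b by (auto simp: mult_left_le_one_le mult_right_le_one_le)
          have rc: "of_real (cmod b) * rcis r \<theta> = rcis ?\<rho> \<theta>" by (simp add: rcis_def)
          have g: "1 - r \<le> cmod (1 - rcis ?\<rho> \<theta>)" "d \<le> cmod (1 - rcis ?\<rho> \<theta>)" "\<bar>\<theta>\<bar> / 6 \<le> cmod (1 - rcis ?\<rho> \<theta>)"
          proof -
            have \<theta>: "\<bar>\<theta>\<bar> \<le> pi" using True by auto
            have \<rho>1: "?\<rho> \<le> 1" using \<rho>(2) r by linarith
            note c = cmod_one_minus_rcis_ge[OF \<rho>(1) \<rho>1 \<theta>]
            show "1 - r \<le> cmod (1 - rcis ?\<rho> \<theta>)" "d \<le> cmod (1 - rcis ?\<rho> \<theta>)" "\<bar>\<theta>\<bar> / 6 \<le> cmod (1 - rcis ?\<rho> \<theta>)"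
              using c \<rho>(2,3) unfolding d_def by linarith+
          qed
          then have "1 - r + m \<le> 3 * cmod (1 - rcis ?\<rho> \<theta>)" unfolding m_def by linarith
          then have "(3 * cmod (1 - rcis ?\<rho> \<theta>)) powr (- p) \<le> (1 - r + m) powr (- p)"
            using r m p by (intro powr_mono2') auto
          then have "3 powr p * (3 powr (- p) * cmod (1 - rcis ?\<rho> \<theta>) powr (- p)) \<le> 3 powr p * (1 - r + m) powr (- p)"
            unfolding powr_mult by (rule mult_left_mono) simp
          then have "cmod (1 - rcis ?\<rho> \<theta>) powr (- p) \<le> 3 powr p * (1 - r + m) powr (- p)"
            by (simp add: mult.assoc[symmetric] flip: powr_add)
          then have "(1 - r) powr (p - 2) * cmod (1 - rcis ?\<rho> \<theta>) powr (- p) * r \<le> (1 - r) powr (p - 2) * (3 powr p * (1 - r + m) powr (- p)) * 1"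
            using r by (intro mult_mono) auto
          then have "ennreal ((1 - r) powr (p - 2) * cmod (1 - rcis ?\<rho> \<theta>) powr (- p) * r) \<le> ennreal (3 powr p * ((1 - r) powr (p - 2) * (1 - r + m) powr (- p)))"
            by (intro ennreal_leI) (simp add: mult_ac)
          moreover have "cmod (rcis r \<theta>) = r" using r by simp
          ultimately show ?thesis using r unfolding rc by (simp add: ennreal_mult')
        qed (auto simp: indicator_def)
      qed
      also have "\<dots> = ennreal (3 powr p) * (\<integral>\<^sup>+ r \<in> {0<..<1}. ennreal ((1 - r) powr (p - 2) * (1 - r + m) powr (- p)) \<partial>lborel)"
        by (rule nn_integral_cmult) measurable
      also have "\<dots> \<le> ennreal (3 powr p) * ennreal (1 / (m * (p - 1)))"
        by (intro mult_left_mono nn_integral_radial_kernel_le p m) simp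
      also have "\<dots> = ennreal (3 powr p / (p - 1)) * ennreal (1 / m)"
        using m p by (simp add: mult_ac flip: ennreal_mult')
      finally show ?thesis using True by (simp add: m_def)
    qed simp
  qed
  also have "\<dots> = ennreal (3 powr p / (p - 1)) * (\<integral>\<^sup>+ \<theta> \<in> {-pi<..<pi}. ennreal (1 / (d + \<bar>\<theta>\<bar> / 6)) \<partial>lborel)"
    by (rule nn_integral_cmult) measurable
  also have "\<dots> \<le> ennreal (3 powr p / (p - 1)) * ennreal (12 * ln (2 / d))"
    using d by (intro mult_left_mono nn_integral_angular_kernel_le) auto
  finally have I: "(\<integral>\<^sup>+ z. ?u z \<partial>lborel) \<le> ennreal (3 powr p / (p - 1)) * ennreal (12 * ln (2 / d))" .
  have "(\<integral>\<^sup>+ z. ennreal ((1 - cmod z) powr (p - 2) * cmod (1 - cnj b * z) powr (- p)) \<partial>area_measure) = ennreal (1 / pi) * (\<integral>\<^sup>+ z. ?u z \<partial>lborel)"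
    by (rule nn_integral_area_measure) measurable
  \<comment> \<open>The normalizing factor 1 / pi is estimated by 1.\<close>
  also have "\<dots> \<le> ennreal 1 * (ennreal (3 powr p / (p - 1)) * ennreal (12 * ln (2 / d)))"
    using I pi_ge_two by (intro mult_mono ennreal_leI) (auto simp: field_simps)
  also have "\<dots> = ennreal (12 * 3 powr p / (p - 1) * ln (2 / (1 - cmod b)))"
    using p by (simp add: d_def mult_ac flip: ennreal_mult')
  finally show ?thesis .
qed

section \<open>Logarithmic test functions\<close>

text \<open>The constant \<open>6\<close> makes the logarithm at least \<open>ln (2 / (1 - |b|))\<close> where
  \<open>|1 - \<bar>b z| \<le> 3 (1 - |b|)\<close>, and its real part positive on the whole disc.\<close>
definition log_test :: "real \<Rightarrow> complex \<Rightarrow> complex \<Rightarrow> complex" where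
  "log_test p b z = of_real (ln (2 / (1 - cmod b)) powr (- 1 / p)) * (of_real (ln 6) - Ln (1 - cnj b * z))"

lemma one_minus_cnj_mult_Re_pos:
  assumes "cmod b < 1" "cmod z < 1"
  shows "0 < Re (1 - cnj b * z)"
  using complex_Re_le_cmod[of "cnj b * z"] cnj_mult_less_1[OF assms] by simp

lemma cmod_one_minus_cnj_less_2:
  assumes "cmod b < 1" "cmod z < 1"
  shows "cmod (1 - cnj b * z) < 2"
  using norm_triangle_ineq4[of 1 "cnj b * z"] cnj_mult_less_1[OF assms] by simp

lemma has_field_derivative_log_test:
  assumes "cmod b < 1" "cmod z < 1"
  shows "(log_test p b has_field_derivative of_real (ln (2 / (1 - cmod b)) powr (- 1 / p)) * (cnj b / (1 - cnj b * z))) (at z)"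
proof -
  have "1 - cnj b * z \<notin> \<real>\<^sub>\<le>\<^sub>0"
    using one_minus_cnj_mult_Re_pos[OF assms] by (auto simp: complex_nonpos_Reals_iff)
  then have "((\<lambda>z. of_real (ln 6) - Ln (1 - cnj b * z)) has_field_derivative cnj b / (1 - cnj b * z)) (at z)"
    by (auto intro!: derivative_eq_intros simp: field_simps)
  then show ?thesis unfolding log_test_def[abs_def] by (rule DERIV_cmult)
qed

lemma Re_log_test:
  assumes "cmod b < 1" "cmod z < 1"
  shows "Re (log_test p b z) = ln (2 / (1 - cmod b)) powr (- 1 / p) * (ln 6 - ln (cmod (1 - cnj b * z)))"
  using one_minus_cnj_mult_nz[OF assms] by (simp add: log_test_def)

lemma Re_log_test_nonneg:
  assumes "cmod b < 1" "cmod z < 1"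
  shows "0 \<le> Re (log_test p b z)"
proof -
  have "ln (cmod (1 - cnj b * z)) \<le> ln 6"
    using one_minus_cnj_mult_nz[OF assms] cmod_one_minus_cnj_less_2[OF assms] by simp
  then show ?thesis unfolding Re_log_test[OF assms] by simp
qed

lemma Re_log_test_ge:
  assumes "cmod b < 1" "cmod z < 1" and near: "cmod (1 - cnj b * z) \<le> 3 * (1 - cmod b)"
  shows "ln (2 / (1 - cmod b)) powr (1 - 1 / p) \<le> Re (log_test p b z)"
proof -
  let ?L = "ln (2 / (1 - cmod b))"
  have L: "0 < ?L" using assms by (intro log_pos) auto
  have "ln (cmod (1 - cnj b * z)) \<le> ln (3 * (1 - cmod b))"
    using one_minus_cnj_mult_nz[OF assms(1,2)] near assms(1) by simp
  moreover have "ln 6 - ln (3 * (1 - cmod b)) = ?L"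
  proof -
    have "ln 6 - ln (3 * (1 - cmod b)) = ln (6 / (3 * (1 - cmod b)))"
      using assms(1) by (subst ln_div) auto
    also have "6 / (3 * (1 - cmod b)) = 2 / (1 - cmod b)" using assms(1) by (simp add: divide_simps)
    finally show ?thesis .
  qed
  ultimately have "?L powr (- 1 / p) * ?L \<le> ?L powr (- 1 / p) * (ln 6 - ln (cmod (1 - cnj b * z)))"
    by (intro mult_left_mono) auto
  moreover have "?L powr (- 1 / p) * ?L = ?L powr (1 - 1 / p)"
    using L powr_mult_base[of ?L "- 1 / p"] by (simp add: mult.commute)
  ultimately show ?thesis unfolding Re_log_test[OF assms(1,2)] by simp
qed

lemma log_test_coeff_bounds:
  assumes "cmod b < 1" "1 < p"
  shows "0 \<le> ln (2 / (1 - cmod b)) powr (- 1 / p)" "ln (2 / (1 - cmod b)) powr (- 1 / p) \<le> ln 2 powr (- 1 / p)"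
  using assms log_ge_ln2[of "cmod b"] by (auto intro!: powr_mono2')

text \<open>The bound does not involve b and is bounded on compact subsets of the disc, as the
  locally uniform convergence of a series of test functions requires.\<close>

lemma cmod_log_test_le:
  assumes "cmod b < 1" "cmod z < 1" "1 < p"
  shows "cmod (log_test p b z) \<le> ln 2 powr (- 1 / p) * (ln 6 + ln 2 - ln (1 - cmod z) + pi)"
proof -
  let ?u = "1 - cnj b * z"
  have u: "0 < cmod ?u" using one_minus_cnj_mult_nz[OF assms(1,2)] by simp
  have ge: "1 - cmod z \<le> cmod ?u"
    using cmod_one_minus_cnj_ge[of b "cnj z"] assms(1) by (metis complex_cnj_cnj complex_mod_cnj mult.commute cmod_one_minus_cnj_ge)
  have "cmod (Ln ?u) \<le> \<bar>Re (Ln ?u)\<bar> + \<bar>Im (Ln ?u)\<bar>" by (rule cmod_le)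
  also have "\<bar>Im (Ln ?u)\<bar> \<le> pi" using u Im_Ln_le_pi[of ?u] mpi_less_Im_Ln[of ?u] by auto
  also have "\<bar>Re (Ln ?u)\<bar> \<le> ln 2 - ln (1 - cmod z)"
  proof -
    have "ln (cmod ?u) \<le> ln 2" using cmod_one_minus_cnj_less_2[OF assms(1,2)] u by simp
    moreover have "ln (1 - cmod z) \<le> ln (cmod ?u)" using ge assms(2) u by simp
    moreover have "ln (1 - cmod z) \<le> 0" "0 \<le> ln (2::real)" using assms(2) by auto
    moreover have "Re (Ln ?u) = ln (cmod ?u)" using u by (intro Re_Ln) auto
    ultimately show ?thesis by linarith
  qed
  finally have "cmod (Ln ?u) \<le> ln 2 - ln (1 - cmod z) + pi" by simp
  moreover have "cmod (of_real (ln 6) - Ln ?u) \<le> cmod (of_real (ln 6)) + cmod (Ln ?u)" by (rule norm_triangle_ineq4)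
  moreover have "cmod (of_real (ln 6) :: complex) = ln 6" unfolding norm_of_real by simp
  ultimately have "cmod (of_real (ln 6) - Ln ?u) \<le> ln 6 + ln 2 - ln (1 - cmod z) + pi" by linarith
  then have "ln (2 / (1 - cmod b)) powr (- 1 / p) * cmod (of_real (ln 6) - Ln ?u) \<le> ln 2 powr (- 1 / p) * (ln 6 + ln 2 - ln (1 - cmod z) + pi)"
    using log_test_coeff_bounds[OF assms(1,3)] by (intro mult_mono) auto
  then show ?thesis by (simp add: log_test_def norm_mult)
qed

text \<open>The normalization L b powr (- 1 / p), raised to the power p, cancels the logarithm of
  \<open>forelli_rudin_log\<close>. The integrand contains the modulus of the derivative of
  \<open>log_test p b\<close>, written out.\<close>

lemma log_test_besov:
  assumes b: "cmod b < 1" and p: "1 < p"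
  shows "(\<integral>\<^sup>+ z. ennreal ((1 - cmod z) powr (p - 2) * (ln (2 / (1 - cmod b)) powr (- 1 / p) * cmod (cnj b / (1 - cnj b * z))) powr p) \<partial>area_measure)
    \<le> ennreal (12 * 3 powr p / (p - 1))"
proof -
  let ?L = "ln (2 / (1 - cmod b))"
  have L: "0 < ?L" using b by (intro log_pos) auto
  have "(\<integral>\<^sup>+ z. ennreal ((1 - cmod z) powr (p - 2) * (?L powr (- 1 / p) * cmod (cnj b / (1 - cnj b * z))) powr p) \<partial>area_measure)
    \<le> (\<integral>\<^sup>+ z. ennreal (1 / ?L) * ennreal ((1 - cmod z) powr (p - 2) * cmod (1 - cnj b * z) powr (- p)) \<partial>area_measure)"
  proof (rule nn_integral_mono)
    fix z assume "z \<in> space area_measure"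
    then have z: "cmod z < 1" by simp
    have u: "0 < cmod (1 - cnj b * z)" using one_minus_cnj_mult_nz[OF b z] by simp
    have "(?L powr (- 1 / p)) powr p = 1 / ?L"
    proof -
      have "- 1 / p * p = - 1" using p by simp
      then show ?thesis using L by (simp only: powr_powr) (simp add: powr_minus_divide)
    qed
    moreover have "cmod (cnj b / (1 - cnj b * z)) powr p \<le> cmod (1 - cnj b * z) powr (- p)"
    proof -
      have "cmod (cnj b / (1 - cnj b * z)) \<le> 1 / cmod (1 - cnj b * z)"
        unfolding norm_divide using b u by (intro divide_right_mono) auto
      then have "cmod (cnj b / (1 - cnj b * z)) powr p \<le> (1 / cmod (1 - cnj b * z)) powr p"
        using p by (intro powr_mono2) auto
      then show ?thesis using u by (simp add: powr_divide powr_minus_divide)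
    qed
    ultimately have "(?L powr (- 1 / p) * cmod (cnj b / (1 - cnj b * z))) powr p \<le> 1 / ?L * cmod (1 - cnj b * z) powr (- p)"
      unfolding powr_mult using L by (simp only:) (intro mult_left_mono, auto)
    then have "(1 - cmod z) powr (p - 2) * (?L powr (- 1 / p) * cmod (cnj b / (1 - cnj b * z))) powr p
      \<le> (1 - cmod z) powr (p - 2) * (1 / ?L * cmod (1 - cnj b * z) powr (- p))"
      by (rule mult_left_mono) simp
    then have "ennreal ((1 - cmod z) powr (p - 2) * (?L powr (- 1 / p) * cmod (cnj b / (1 - cnj b * z))) powr p)
      \<le> ennreal (1 / ?L * ((1 - cmod z) powr (p - 2) * cmod (1 - cnj b * z) powr (- p)))"
      by (intro ennreal_leI) (simp only: mult_ac)
    also have "\<dots> = ennreal (1 / ?L) * ennreal ((1 - cmod z) powr (p - 2) * cmod (1 - cnj b * z) powr (- p))"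
      using L by (intro ennreal_mult') auto
    finally show "ennreal ((1 - cmod z) powr (p - 2) * (?L powr (- 1 / p) * cmod (cnj b / (1 - cnj b * z))) powr p)
      \<le> ennreal (1 / ?L) * ennreal ((1 - cmod z) powr (p - 2) * cmod (1 - cnj b * z) powr (- p))" .
  qed
  also have "\<dots> = ennreal (1 / ?L) * (\<integral>\<^sup>+ z. ennreal ((1 - cmod z) powr (p - 2) * cmod (1 - cnj b * z) powr (- p)) \<partial>area_measure)"
    by (rule nn_integral_cmult) measurable
  also have "\<dots> \<le> ennreal (1 / ?L) * ennreal (12 * 3 powr p / (p - 1) * ?L)"
    by (intro mult_left_mono forelli_rudin_log p b) simp
  also have "\<dots> = ennreal (1 / ?L * (12 * 3 powr p / (p - 1) * ?L))"
    using L by (intro ennreal_mult'[symmetric]) auto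
  also have "1 / ?L * (12 * 3 powr p / (p - 1) * ?L) = 12 * 3 powr p / (p - 1)" using L by simp
  finally show ?thesis .
qed

section \<open>Convex series of test functions\<close>

text \<open>Jensen's inequality for a countable mean, again by the tangent at c. The slack in the
  bound on c admits the modulus of a series, and B ensures convergence. Besov bounds for series then
  follow pointwise, without a triangle inequality for the Besov norm.\<close>

lemma powr_suminf_convex:
  fixes x w :: "nat \<Rightarrow> real"
  assumes p: "1 \<le> p" and x: "\<And>n. 0 \<le> x n" "\<And>n. x n \<le> B" and w: "\<And>n. 0 \<le> w n" "w sums 1"
    and c: "0 \<le> c" "c \<le> (\<Sum>n. w n * x n)"
  shows "c powr p \<le> (\<Sum>n. w n * x n powr p)"
proof -
  have B: "0 \<le> B" using x(1)[of 0] x(2)[of 0] by linarith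
  have sw: "summable w" "suminf w = 1" using w(2) by (auto simp: sums_iff)
  have s1: "summable (\<lambda>n. w n * x n)"
    by (rule summable_comparison_test'[OF summable_mult2[OF sw(1), of B]]) (use x w in \<open>auto simp: abs_mult intro!: mult_left_mono\<close>)
  have s2: "summable (\<lambda>n. w n * x n powr p)"
    by (rule summable_comparison_test'[OF summable_mult2[OF sw(1), of "B powr p"]])
      (use x w p in \<open>auto simp: abs_mult intro!: mult_left_mono powr_mono2\<close>)
  have "p * c powr (p - 1) * c \<le> p * c powr (p - 1) * (\<Sum>n. w n * x n)"
    using c p by (intro mult_left_mono) auto
  also have "\<dots> = (\<Sum>n. p * c powr (p - 1) * (w n * x n))" by (rule suminf_mult[OF s1, symmetric])
  also have "\<dots> \<le> (\<Sum>n. w n * x n powr p + (p - 1) * c powr p * w n)"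
  proof (rule suminf_le)
    fix n
    have "w n * (p * c powr (p - 1) * x n) \<le> w n * (x n powr p + (p - 1) * c powr p)"
      using powr_tangent_le[OF p x(1) c(1)] w(1) by (intro mult_left_mono) auto
    then show "p * c powr (p - 1) * (w n * x n) \<le> w n * x n powr p + (p - 1) * c powr p * w n"
      by (simp add: algebra_simps)
  qed (intro summable_mult summable_add s1 s2 sw)+
  also have "\<dots> = (\<Sum>n. w n * x n powr p) + (p - 1) * c powr p"
    using s2 sw by (subst suminf_add[symmetric]) (auto simp: suminf_mult intro: summable_mult)
  finally have "p * c powr (p - 1) * c \<le> (\<Sum>n. w n * x n powr p) + (p - 1) * c powr p" .
  moreover have "c powr (p - 1) * c = c powr p" using c(1) powr_mult_base[of c "p - 1"] by (simp add: mult.commute)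
  then have "p * c powr (p - 1) * c = p * c powr p" by (simp only: mult.assoc)
  ultimately have "p * c powr p \<le> (\<Sum>n. w n * x n powr p) + (p - 1) * c powr p" by (simp only:)
  then show ?thesis by (simp add: algebra_simps)
qed

text \<open>The exponent starts at 1, so that the weights have sum 1 and a weighted series is a
  convex combination.\<close>

definition half_pow :: "nat \<Rightarrow> real" where "half_pow n = (1 / 2) ^ Suc n"

lemma half_pow_nonneg: "0 \<le> half_pow n" and half_pow_sums: "half_pow sums 1"
  using power_half_series by (simp_all add: half_pow_def[abs_def])

text \<open>A convex combination inherits the common Besov bound of its terms: convexity of the p-th
  power is applied pointwise to the derivatives, and the integral is taken term by term.\<close>

lemma log_test_series:
  assumes p: "1 < p" and b: "\<And>n. cmod (b n) < 1"
  obtains f where "f \<in> besov p" "\<And>z. cmod z < 1 \<Longrightarrow> (\<lambda>n. of_real (half_pow n) * log_test p (b n) z) sums f z"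
proof -
  let ?c = "\<lambda>n. ln (2 / (1 - cmod (b n))) powr (- 1 / p)"
  let ?d = "\<lambda>n z. of_real (?c n) * (cnj (b n) / (1 - cnj (b n) * z))"
  have "\<exists>f f'. \<forall>z\<in>unit_disc. ((\<lambda>n. of_real (half_pow n) * log_test p (b n) z) sums f z) \<and>
      ((\<lambda>n. of_real (half_pow n) * ?d n z) sums f' z) \<and> (f has_field_derivative f' z) (at z)"
  proof (rule series_and_derivative_comparison_local[OF open_ball])
    fix n and z :: complex assume "z \<in> unit_disc"
    then show "((\<lambda>z. of_real (half_pow n) * log_test p (b n) z) has_field_derivative of_real (half_pow n) * ?d n z) (at z)"
      using has_field_derivative_log_test[OF b[of n], of z p] by (intro DERIV_cmult) simp
  next
    fix z :: complex assume "z \<in> unit_disc"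
    then have z: "cmod z < 1" by simp
    \<comment> \<open>On the ball of radius r about z the distance to the circle is still at least
      r, so K bounds all test functions there.\<close>
    define r where "r = (1 - cmod z) / 2"
    define K where "K = ln 2 powr (- 1 / p) * (ln 6 + ln 2 - ln r + pi)"
    have bd: "cmod (of_real (half_pow n) * log_test p (b n) y) \<le> half_pow n * K" if "y \<in> ball z r" for n y
    proof -
      have y: "1 - cmod z \<le> 2 * (1 - cmod y)" "cmod y < 1" using ball_half_distance[OF z, of y] that by (simp_all add: r_def)
      have "ln r \<le> ln (1 - cmod y)" using y z by (simp add: r_def)
      then have "ln 2 powr (- 1 / p) * (ln 6 + ln 2 - ln (1 - cmod y) + pi) \<le> K"
        unfolding K_def by (intro mult_left_mono) auto
      then have "cmod (log_test p (b n) y) \<le> K" using cmod_log_test_le[OF b[of n] y(2) p] by linarith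
      then have "half_pow n * cmod (log_test p (b n) y) \<le> half_pow n * K" by (intro mult_left_mono half_pow_nonneg)
      then show ?thesis using half_pow_nonneg[of n] by (simp add: norm_mult)
    qed
    show "\<exists>d h. 0 < d \<and> summable h \<and> (\<forall>\<^sub>F n in sequentially. \<forall>y\<in>ball z d \<inter> unit_disc. cmod (of_real (half_pow n) * log_test p (b n) y) \<le> h n)"
    proof (intro exI conjI)
      show "0 < r" using z by (simp add: r_def)
      show "summable (\<lambda>n. half_pow n * K)" using half_pow_sums by (intro summable_mult2) (rule sums_summable)
    qed (use bd in auto)
  qed
  then obtain f f' where ff: "\<And>z. z \<in> unit_disc \<Longrightarrow> ((\<lambda>n. of_real (half_pow n) * log_test p (b n) z) sums f z) \<and>
      ((\<lambda>n. of_real (half_pow n) * ?d n z) sums f' z) \<and> (f has_field_derivative f' z) (at z)"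
    by blast
  have inD: "z \<in> unit_disc" if "cmod z < 1" for z :: complex using that by simp
  note f = ff[OF inD, THEN conjunct1] and f' = ff[OF inD, THEN conjunct2, THEN conjunct1]
    and fd = ff[OF inD, THEN conjunct2, THEN conjunct2]
  have an: "f analytic_on unit_disc"
    unfolding analytic_on_open[OF open_ball] holomorphic_on_def field_differentiable_def
    using fd has_field_derivative_at_within by (metis dist_0_norm mem_ball)
  let ?x = "\<lambda>n z. ?c n * cmod (cnj (b n) / (1 - cnj (b n) * z))"
  have "besov_integral p f
    \<le> (\<integral>\<^sup>+ z. (\<Sum>n. ennreal (half_pow n) * ennreal ((1 - cmod z) powr (p - 2) * ?x n z powr p)) \<partial>area_measure)"
  proof (rule nn_integral_mono)
    fix z assume "z \<in> space area_measure"
    then have z: "cmod z < 1" by simp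
    define B where "B = ln 2 powr (- 1 / p) * (1 / (1 - cmod z))"
    have x0: "0 \<le> ?x n z" for n by simp
    have xB: "?x n z \<le> B" for n
    proof -
      have "1 - cmod z \<le> cmod (1 - cnj (b n) * z)"
        using cmod_one_minus_cnj_ge[of "b n" "cnj z"] b[of n] by (metis complex_cnj_cnj complex_mod_cnj mult.commute cmod_one_minus_cnj_ge)
      then have "cmod (cnj (b n) / (1 - cnj (b n) * z)) \<le> 1 / (1 - cmod z)"
        unfolding norm_divide using b[of n] z by (intro frac_le) auto
      then show ?thesis
        unfolding B_def using log_test_coeff_bounds[OF b[of n] p] by (intro mult_mono) auto
    qed
    have B: "0 \<le> B" using z by (simp add: B_def)
    have sx: "summable (\<lambda>n. half_pow n * ?x n z)"
      by (rule summable_comparison_test'[OF summable_mult2[OF sums_summable[OF half_pow_sums], of B]])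
        (use x0 xB half_pow_nonneg in \<open>simp add: abs_mult mult_left_mono\<close>)
    have sxp: "summable (\<lambda>n. half_pow n * ?x n z powr p)"
      by (rule summable_comparison_test'[OF summable_mult2[OF sums_summable[OF half_pow_sums], of "B powr p"]])
        (use x0 xB half_pow_nonneg p in \<open>simp add: abs_mult mult_left_mono powr_mono2\<close>)
    have nd: "cmod (of_real (half_pow n) * ?d n z) = half_pow n * ?x n z" for n
      by (simp only: norm_mult norm_of_real abs_of_nonneg[OF half_pow_nonneg] abs_of_nonneg[OF powr_ge_zero])
    have "deriv f z = f' z" using fd[OF z] by (rule DERIV_imp_deriv)
    also have "f' z = (\<Sum>n. of_real (half_pow n) * ?d n z)" using f'[OF z] by (simp add: sums_iff)
    finally have "cmod (deriv f z) = cmod (\<Sum>n. of_real (half_pow n) * ?d n z)" by simp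
    also have "\<dots> \<le> (\<Sum>n. cmod (of_real (half_pow n) * ?d n z))"
      using sx by (intro summable_norm) (simp only: nd)
    also have "\<dots> = (\<Sum>n. half_pow n * ?x n z)" by (simp only: nd)
    finally have "cmod (deriv f z) powr p \<le> (\<Sum>n. half_pow n * ?x n z powr p)"
      using p by (intro powr_suminf_convex[OF _ x0 xB half_pow_nonneg half_pow_sums]) auto
    then have "(1 - cmod z) powr (p - 2) * cmod (deriv f z) powr p \<le> (1 - cmod z) powr (p - 2) * (\<Sum>n. half_pow n * ?x n z powr p)"
      by (rule mult_left_mono) simp
    also have "\<dots> = (\<Sum>n. (1 - cmod z) powr (p - 2) * (half_pow n * ?x n z powr p))" by (rule suminf_mult[OF sxp, symmetric])
    finally have "ennreal ((1 - cmod z) powr (p - 2) * cmod (deriv f z) powr p) \<le> ennreal (\<Sum>n. (1 - cmod z) powr (p - 2) * (half_pow n * ?x n z powr p))"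
      by (rule ennreal_leI)
    also have "\<dots> = (\<Sum>n. ennreal ((1 - cmod z) powr (p - 2) * (half_pow n * ?x n z powr p)))"
      using half_pow_nonneg by (intro suminf_ennreal2[symmetric] summable_mult sxp) auto
    also have "\<dots> = (\<Sum>n. ennreal (half_pow n) * ennreal ((1 - cmod z) powr (p - 2) * ?x n z powr p))"
      using half_pow_nonneg by (intro suminf_cong) (simp add: mult_ac flip: ennreal_mult')
    finally show "ennreal ((1 - cmod z) powr (p - 2) * cmod (deriv f z) powr p) \<le> (\<Sum>n. ennreal (half_pow n) * ennreal ((1 - cmod z) powr (p - 2) * ?x n z powr p))" .
  qed
  also have "\<dots> = (\<Sum>n. \<integral>\<^sup>+ z. ennreal (half_pow n) * ennreal ((1 - cmod z) powr (p - 2) * ?x n z powr p) \<partial>area_measure)"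
    by (rule nn_integral_suminf) measurable
  also have "\<dots> = (\<Sum>n. ennreal (half_pow n) * (\<integral>\<^sup>+ z. ennreal ((1 - cmod z) powr (p - 2) * ?x n z powr p) \<partial>area_measure))"
    by (intro suminf_cong nn_integral_cmult) measurable
  also have "\<dots> \<le> (\<Sum>n. ennreal (half_pow n) * ennreal (12 * 3 powr p / (p - 1)))"
    by (intro suminf_le mult_left_mono log_test_besov b p) auto
  also have "\<dots> = (\<Sum>n. ennreal (half_pow n)) * ennreal (12 * 3 powr p / (p - 1))"
    by (rule ennreal_suminf_multc)
  also have "(\<Sum>n. ennreal (half_pow n)) = ennreal 1"
    using half_pow_sums half_pow_nonneg by (subst suminf_ennreal2) (auto simp: sums_iff)
  finally have "besov_integral p f < \<infinity>"
    by (rule le_less_trans) (simp add: ennreal_mult_less_top)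
  then have "f \<in> besov p" using an p by (simp add: besov_def)
  then show ?thesis using f by (rule that)
qed

section \<open>Membership of the image function in Q_s\<close>

text \<open>The integrand has a primitive P on the convex disc, and the integral along the segment
  from 0 to z is P z - P 0.\<close>

lemma T_op_derivative:
  assumes "g holomorphic_on unit_disc" "f holomorphic_on unit_disc"
  shows "T_op g f holomorphic_on unit_disc" "\<And>z. cmod z < 1 \<Longrightarrow> deriv (T_op g f) z = deriv g z * f z"
proof -
  have h: "(\<lambda>\<xi>. deriv g \<xi> * f \<xi>) holomorphic_on unit_disc"
    using assms by (intro holomorphic_intros holomorphic_deriv) auto
  obtain P where P: "\<And>z. z \<in> unit_disc \<Longrightarrow> (P has_field_derivative deriv g z * f z) (at z within unit_disc)"
    using holomorphic_convex_primitive'[OF convex_ball open_ball h] by blast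
  have eq: "P z - P 0 = T_op g f z" if z: "z \<in> unit_disc" for z
  proof -
    have "path_image (linepath 0 z) \<subseteq> unit_disc" using z by (simp add: closed_segment_subset)
    then have "((\<lambda>\<xi>. deriv g \<xi> * f \<xi>) has_contour_integral P (pathfinish (linepath 0 z)) - P (pathstart (linepath 0 z))) (linepath 0 z)"
      by (intro contour_integral_primitive[OF P]) auto
    then show ?thesis
      unfolding T_op_def pathfinish_linepath pathstart_linepath by (rule contour_integral_unique[symmetric])
  qed
  have d: "(T_op g f has_field_derivative deriv g z * f z) (at z)" if z: "z \<in> unit_disc" for z
  proof (rule has_field_derivative_transform_within_open[where f = "\<lambda>z. P z - P 0" and S = unit_disc])
    have "(P has_field_derivative deriv g z * f z) (at z)" using P[OF z] unfolding at_within_open[OF z open_ball] .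
    from DERIV_diff[OF this DERIV_const] show "((\<lambda>z. P z - P 0) has_field_derivative deriv g z * f z) (at z)"
      by (simp only: diff_zero)
  qed (use z eq in \<open>simp_all only: open_ball\<close>)
  show "T_op g f holomorphic_on unit_disc"
    unfolding holomorphic_on_def field_differentiable_def
    by (intro ballI exI) (rule has_field_derivative_at_within[OF d])
  show "deriv (T_op g f) z = deriv g z * f z" if "cmod z < 1" for z
    using that by (intro DERIV_imp_deriv d) simp
qed

lemma SUP_less_top_iff_bounded:
  fixes F :: "'a \<Rightarrow> ennreal"
  shows "(SUP a\<in>S. F a) < \<infinity> \<longleftrightarrow> (\<exists>K\<ge>0. \<forall>a\<in>S. F a \<le> ennreal K)"
proof
  assume "(SUP a\<in>S. F a) < \<infinity>"
  then obtain K where "0 \<le> K" "(SUP a\<in>S. F a) = ennreal K"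
    by (cases "SUP a\<in>S. F a" rule: ennreal_cases) auto
  moreover have "F a \<le> (SUP a\<in>S. F a)" if "a \<in> S" for a using that by (rule SUP_upper)
  ultimately show "\<exists>K\<ge>0. \<forall>a\<in>S. F a \<le> ennreal K" by auto
next
  assume "\<exists>K\<ge>0. \<forall>a\<in>S. F a \<le> ennreal K"
  then obtain K where "\<forall>a\<in>S. F a \<le> ennreal K" by blast
  then have "(SUP a\<in>S. F a) \<le> ennreal K" by (intro SUP_least) auto
  then show "(SUP a\<in>S. F a) < \<infinity>" by (rule le_less_trans) simp
qed

text \<open>The two comparisons of the Green function with 1 - |phi_a|^2 have the constants 2 powr s
  and 41, independent of a, so both suprema are finite together.\<close>

lemma Q_space_iff:
  assumes "0 < s" "s \<le> 1"
  shows "f \<in> Q_space s \<longleftrightarrow> f holomorphic_on unit_disc \<and>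
    (\<exists>K\<ge>0. \<forall>a. cmod a < 1 \<longrightarrow> (\<integral>\<^sup>+ z. Q_density s f a z \<partial>area_measure) \<le> ennreal K)"
proof -
  have "(\<exists>K\<ge>0. \<forall>a\<in>unit_disc. (\<integral>\<^sup>+ z. ennreal ((cmod (deriv f z))\<^sup>2 * green z a powr s) \<partial>area_measure) \<le> ennreal K) \<longleftrightarrow>
    (\<exists>K\<ge>0. \<forall>a. cmod a < 1 \<longrightarrow> (\<integral>\<^sup>+ z. Q_density s f a z \<partial>area_measure) \<le> ennreal K)"
    if f: "f holomorphic_on unit_disc"
  proof -
    have f': "deriv f holomorphic_on unit_disc" by (rule holomorphic_deriv[OF f open_ball])
    show ?thesis
    proof
      assume "\<exists>K\<ge>0. \<forall>a\<in>unit_disc. (\<integral>\<^sup>+ z. ennreal ((cmod (deriv f z))\<^sup>2 * green z a powr s) \<partial>area_measure) \<le> ennreal K"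
      then obtain K where K: "0 \<le> K" "\<And>a. cmod a < 1 \<Longrightarrow> (\<integral>\<^sup>+ z. ennreal ((cmod (deriv f z))\<^sup>2 * green z a powr s) \<partial>area_measure) \<le> ennreal K" by auto
      have "(\<integral>\<^sup>+ z. Q_density s f a z \<partial>area_measure) \<le> ennreal (2 powr s * K)" if a: "cmod a < 1" for a
      proof -
        have "(\<integral>\<^sup>+ z. Q_density s f a z \<partial>area_measure)
          \<le> ennreal (2 powr s) * (\<integral>\<^sup>+ z. ennreal ((cmod (deriv f z))\<^sup>2 * green z a powr s) \<partial>area_measure)"
          by (rule nn_integral_disc_aut_le_green[OF a assms(1) borel_measurable_area_measure_holomorphic[OF f']])
        also have "\<dots> \<le> ennreal (2 powr s) * ennreal K" using K(2)[OF a] by (rule mult_left_mono) simp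
        finally show ?thesis by (simp add: ennreal_mult')
      qed
      then show "\<exists>K\<ge>0. \<forall>a. cmod a < 1 \<longrightarrow> (\<integral>\<^sup>+ z. Q_density s f a z \<partial>area_measure) \<le> ennreal K"
        using K(1) by (intro exI[of _ "2 powr s * K"]) auto
    next
      assume "\<exists>K\<ge>0. \<forall>a. cmod a < 1 \<longrightarrow> (\<integral>\<^sup>+ z. Q_density s f a z \<partial>area_measure) \<le> ennreal K"
      then obtain K where K: "0 \<le> K" "\<And>a. cmod a < 1 \<Longrightarrow> (\<integral>\<^sup>+ z. Q_density s f a z \<partial>area_measure) \<le> ennreal K" by auto
      then show "\<exists>K\<ge>0. \<forall>a\<in>unit_disc. (\<integral>\<^sup>+ z. ennreal ((cmod (deriv f z))\<^sup>2 * green z a powr s) \<partial>area_measure) \<le> ennreal K"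
        using nn_integral_green_le[OF f' _ assms K(1) K(2)] by (intro exI[of _ "41 * K"]) auto
    qed
  qed
  then show ?thesis
    unfolding Q_space_def mem_Collect_eq SUP_less_top_iff_bounded analytic_on_open[OF open_ball] by blast
qed

text \<open>Only the derivative g' f of the image enters the condition, so |f|^2 becomes an
  additional weight in the condition on g.\<close>

lemma T_op_Q_space_iff:
  assumes s: "0 < s" "s \<le> 1" and g: "g holomorphic_on unit_disc" and f: "f holomorphic_on unit_disc"
  shows "T_op g f \<in> Q_space s \<longleftrightarrow>
    (\<exists>K\<ge>0. \<forall>a. cmod a < 1 \<longrightarrow> (\<integral>\<^sup>+ z. ennreal ((cmod (f z))\<^sup>2) * Q_density s g a z \<partial>area_measure) \<le> ennreal K)"
proof -
  have "(\<integral>\<^sup>+ z. ennreal ((cmod (deriv (T_op g f) z))\<^sup>2 * (1 - (cmod (disc_aut a z))\<^sup>2) powr s) \<partial>area_measure)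
    = (\<integral>\<^sup>+ z. ennreal ((cmod (f z))\<^sup>2) * Q_density s g a z \<partial>area_measure)" for a
    by (intro nn_integral_cong)
      (simp add: T_op_derivative(2)[OF g f] norm_mult power_mult_distrib mult_ac flip: ennreal_mult')
  then show ?thesis
    unfolding Q_space_iff[OF s] using T_op_derivative(1)[OF g f] by simp
qed

section \<open>The integration operator\<close>

lemma holomorphic_on_log_test: "cmod b < 1 \<Longrightarrow> log_test p b holomorphic_on unit_disc"
  unfolding holomorphic_on_def field_differentiable_def
  by (intro ballI exI) (rule has_field_derivative_at_within[OF has_field_derivative_log_test], auto)

text \<open>If no bound existed, points \<open>b n\<close> with integrals above \<open>8 ^ n\<close>
  could be put into one series f in the Besov space. All terms have nonnegative real part, so |f|
  dominates \<open>half_pow n\<close> times the real part of the n-th test function. The finite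
  bound K for this one f would then satisfy \<open>2 ^ n \<le> 4 * K\<close> for every n.\<close>

lemma log_test_uniform_bound:
  assumes s: "0 < s" "s \<le> 1" and g: "g holomorphic_on unit_disc" and p: "1 < p"
    and maps: "maps_into (T_op g) (besov p) (Q_space s)"
  obtains K where "0 \<le> K" "\<And>b. cmod b < 1 \<Longrightarrow>
    (\<integral>\<^sup>+ z. ennreal ((Re (log_test p b z))\<^sup>2) * Q_density s g b z \<partial>area_measure) \<le> ennreal K"
proof -
  define W where "W b = (\<integral>\<^sup>+ z. ennreal ((Re (log_test p b z))\<^sup>2) * Q_density s g b z \<partial>area_measure)" for b
  have [measurable]: "deriv g \<in> borel_measurable area_measure"
    by (intro borel_measurable_area_measure_holomorphic holomorphic_deriv g open_ball)
  have mG[measurable]: "Q_density s g b \<in> borel_measurable area_measure" for b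
    unfolding disc_aut_def by measurable
  have "\<exists>K\<ge>0. \<forall>b. cmod b < 1 \<longrightarrow> W b \<le> ennreal K"
  proof (rule ccontr)
    assume *: "\<not> (\<exists>K\<ge>0. \<forall>b. cmod b < 1 \<longrightarrow> W b \<le> ennreal K)"
    \<comment> \<open>Any base above 4 would do, since the squared weights of the series decay like
      4 ^ (-n).\<close>
    have "\<exists>b. cmod b < 1 \<and> ennreal (8 ^ n) < W b" for n :: nat
    proof -
      have "0 \<le> (8::real) ^ n" by simp
      with * have "\<not> (\<forall>b. cmod b < 1 \<longrightarrow> W b \<le> ennreal (8 ^ n))" by blast
      then show ?thesis by (simp only: not_all not_imp not_le)
    qed
    then obtain b where b: "\<And>n. cmod (b n) < 1" and big: "\<And>n. ennreal (8 ^ n) < W (b n)" by metis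
    obtain f where f: "f \<in> besov p" "\<And>z. cmod z < 1 \<Longrightarrow> (\<lambda>n. of_real (half_pow n) * log_test p (b n) z) sums f z"
      using log_test_series[of p b] p b by blast
    have fh: "f holomorphic_on unit_disc" using f(1) by (simp add: besov_def analytic_on_open)
    have "T_op g f \<in> Q_space s" using maps f(1) by (auto simp: maps_into_def)
    then obtain K where K: "0 \<le> K" "\<And>a. cmod a < 1 \<Longrightarrow> (\<integral>\<^sup>+ z. ennreal ((cmod (f z))\<^sup>2) * Q_density s g a z \<partial>area_measure) \<le> ennreal K"
      unfolding T_op_Q_space_iff[OF s g fh] by blast
    have small: "(2::real) ^ n \<le> 4 * K" for n
    proof -
      have pt: "half_pow n * Re (log_test p (b n) z) \<le> cmod (f z)" if z: "cmod z < 1" for z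
      proof -
        have "(\<lambda>k. Re (of_real (half_pow k) * log_test p (b k) z)) sums Re (f z)" using f(2)[OF z] by (rule sums_Re)
        then have sm: "(\<lambda>k. half_pow k * Re (log_test p (b k) z)) sums Re (f z)" by simp
        have "sum (\<lambda>k. half_pow k * Re (log_test p (b k) z)) {n} \<le> suminf (\<lambda>k. half_pow k * Re (log_test p (b k) z))"
          by (rule sum_le_suminf[OF sums_summable[OF sm]]) (use half_pow_nonneg Re_log_test_nonneg[OF b z] in auto)
        then have "half_pow n * Re (log_test p (b n) z) \<le> Re (f z)" using sm by (simp add: sums_iff)
        then show ?thesis using complex_Re_le_cmod[of "f z"] by linarith
      qed
      have "ennreal ((half_pow n)\<^sup>2) * ennreal (8 ^ n) \<le> ennreal ((half_pow n)\<^sup>2) * W (b n)"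
        by (rule mult_left_mono[OF less_imp_le[OF big]]) simp
      also have "\<dots> = (\<integral>\<^sup>+ z. ennreal ((half_pow n)\<^sup>2) * (ennreal ((Re (log_test p (b n) z))\<^sup>2) * Q_density s g (b n) z) \<partial>area_measure)"
        unfolding W_def
      proof (rule nn_integral_cmult[symmetric])
        have [measurable]: "log_test p (b n) \<in> borel_measurable area_measure"
          by (intro borel_measurable_area_measure_holomorphic holomorphic_on_log_test b)
        show "(\<lambda>z. ennreal ((Re (log_test p (b n) z))\<^sup>2) * Q_density s g (b n) z) \<in> borel_measurable area_measure"
          by (intro borel_measurable_times_ennreal mG) measurable
      qed
      also have "\<dots> \<le> (\<integral>\<^sup>+ z. ennreal ((cmod (f z))\<^sup>2) * Q_density s g (b n) z \<partial>area_measure)"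
      proof (rule nn_integral_mono)
        fix z assume "z \<in> space area_measure"
        then have z: "cmod z < 1" by simp
        have "(half_pow n * Re (log_test p (b n) z))\<^sup>2 \<le> (cmod (f z))\<^sup>2"
          using pt[OF z] half_pow_nonneg Re_log_test_nonneg[OF b z] by (intro power_mono) auto
        then have "ennreal ((half_pow n)\<^sup>2) * ennreal ((Re (log_test p (b n) z))\<^sup>2) \<le> ennreal ((cmod (f z))\<^sup>2)"
          by (simp add: power_mult_distrib ennreal_leI flip: ennreal_mult')
        then have "ennreal ((half_pow n)\<^sup>2) * ennreal ((Re (log_test p (b n) z))\<^sup>2) * Q_density s g (b n) z \<le> ennreal ((cmod (f z))\<^sup>2) * Q_density s g (b n) z"
          by (rule mult_right_mono) simp
        then show "ennreal ((half_pow n)\<^sup>2) * (ennreal ((Re (log_test p (b n) z))\<^sup>2) * Q_density s g (b n) z) \<le> ennreal ((cmod (f z))\<^sup>2) * Q_density s g (b n) z"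
          by (simp only: mult.assoc)
      qed
      also have "\<dots> \<le> ennreal K" by (rule K(2)[OF b])
      finally have "(half_pow n)\<^sup>2 * 8 ^ n \<le> K"
        using K(1) by (simp add: ennreal_le_iff flip: ennreal_mult')
      moreover have "(half_pow n)\<^sup>2 * 8 ^ n = 2 ^ n / 4"
      proof -
        have "(8::real) ^ n = 4 ^ n * 2 ^ n" by (simp flip: power_mult_distrib)
        moreover have "(half_pow n)\<^sup>2 = 1 / (4 * 4 ^ n)"
          by (simp add: half_pow_def power2_eq_square field_simps flip: power_mult_distrib)
        ultimately show ?thesis by simp
      qed
      ultimately show ?thesis by simp
    qed
    obtain n where "4 * K < 2 ^ n" using real_arch_pow[of 2 "4 * K"] by auto
    with small[of n] show False by simp
  qed
  then obtain K where "0 \<le> K" "\<And>b. cmod b < 1 \<Longrightarrow> W b \<le> ennreal K" by blast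
  then show ?thesis unfolding W_def by (rule that)
qed

text \<open>The point on the radius through \<open>a\<close> at distance \<open>min 1 (2 ^ k * (1 - |a|))\<close> from the circle;
  for \<open>a = 0\<close> it is \<open>0\<close> because \<open>sgn 0 = 0\<close>.\<close>
definition shift_point :: "complex \<Rightarrow> nat \<Rightarrow> complex" where
  "shift_point a k = sgn a * of_real (max 0 (1 - 2 ^ k * (1 - cmod a)))"

lemma cmod_shift_point: "cmod a < 1 \<Longrightarrow> cmod (shift_point a k) = max 0 (1 - 2 ^ k * (1 - cmod a))"
proof (cases "a = 0")
  case True
  have "1 \<le> (2::real) ^ k" by simp
  then show ?thesis using True by (simp add: shift_point_def)
qed (simp add: shift_point_def norm_mult norm_sgn)

lemma cmod_shift_point_less: "cmod a < 1 \<Longrightarrow> cmod (shift_point a k) < 1"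
  by (simp add: cmod_shift_point)

section \<open>Dyadic comparison of the weights along a radius\<close>

text \<open>Take the least k with the second property; minimality gives the first one, and for k = 0
  it is the hypothesis \<delta> \<le> D.\<close>

lemma exists_dyadic_scale:
  fixes \<delta> D :: real
  assumes "0 < \<delta>" "\<delta> \<le> D"
  obtains k :: nat where "2 ^ k * \<delta> \<le> D" "D \<le> 2 * (2 ^ k * \<delta>)"
proof -
  obtain n where "D / \<delta> < 2 ^ n" using real_arch_pow[of 2 "D / \<delta>"] by auto
  then have ex: "\<exists>n. D \<le> 2 * (2 ^ n * \<delta>)"
    using assms by (intro exI[of _ n]) (simp add: field_simps)
  define k where "k = (LEAST n. D \<le> 2 * (2 ^ n * \<delta>))"
  have k: "D \<le> 2 * (2 ^ k * \<delta>)" unfolding k_def by (rule LeastI_ex[OF ex])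
  moreover have "2 ^ k * \<delta> \<le> D"
  proof (cases k)
    case 0
    then show ?thesis using assms by simp
  next
    case (Suc j)
    then have "\<not> D \<le> 2 * (2 ^ j * \<delta>)" using not_less_Least[of j "\<lambda>n. D \<le> 2 * (2 ^ n * \<delta>)"] by (simp add: k_def)
    then show ?thesis using Suc by simp
  qed
  ultimately show ?thesis by (intro that)
qed

text \<open>k is the dyadic scale of |1 - \<open>cnj a * z\<close>| relative to 1 - |a|. Then z is
  so close to the k-th point of the radius that the test function there is large at z. The weight at
  a is smaller than the weight at that point by the factor 2 powr (- k s), against a loss of at most
  (1 + k)^2 from the logarithms.\<close>

lemma log_weight_le:
  assumes a: "cmod a < 1" and z: "cmod z < 1" and s: "0 < s" and p: "1 < p"
  obtains k where "ln (2 / (1 - cmod a)) powr (2 * (1 - 1 / p)) * (1 - (cmod (disc_aut a z))\<^sup>2) powr s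
    \<le> 18 powr s * ((1 + real k)\<^sup>2 * 2 powr (- (real k * s))) * ((Re (log_test p (shift_point a k) z))\<^sup>2 * (1 - (cmod (disc_aut (shift_point a k) z))\<^sup>2) powr s)"
proof -
  define \<delta> where "\<delta> = 1 - cmod a"
  define D where "D = cmod (1 - cnj a * z)"
  have \<delta>: "0 < \<delta>" "\<delta> \<le> D" using a cmod_one_minus_cnj_ge[OF z, of a] by (simp_all add: \<delta>_def D_def)
  obtain k :: nat where k: "2 ^ k * \<delta> \<le> D" "D \<le> 2 * (2 ^ k * \<delta>)" using exists_dyadic_scale[OF \<delta>] .
  define b where "b = shift_point a k"
  have nb: "cmod b = max 0 (1 - 2 ^ k * \<delta>)" using cmod_shift_point[OF a] by (simp add: b_def \<delta>_def)
  have b: "cmod b < 1" using cmod_shift_point_less[OF a] by (simp add: b_def)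
  define h where "h = 2 ^ k * \<delta>"
  have h: "0 < h" "1 - cmod b \<le> h" "0 < 1 - cmod b" "\<delta> \<le> h" using \<delta>(1) nb b by (auto simp: h_def)
  have near: "cmod (1 - cnj b * z) \<le> 3 * (1 - cmod b)"
  \<comment> \<open>For h \<ge> 1 the point has reached the origin and the claim is 1 \<le> 3.
    Otherwise |a - b| \<le> h, and D + h \<le> 3 h.\<close>
  proof (cases "1 \<le> h")
    case True
    then have "b = 0" using nb by (simp add: h_def)
    then show ?thesis by simp
  next
    case False
    then have nb': "cmod b = 1 - h" using nb by (simp add: h_def)
    have "cmod (a - b) \<le> h"
    proof -
      have ab: "a - b = sgn a * of_real (cmod a - (1 - h))"
      proof -
        have "a = sgn a * of_real (cmod a)" by (cases "a = 0") (simp_all add: sgn_div_norm scaleR_conv_of_real)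
        moreover have "b = sgn a * of_real (1 - h)" using False by (simp add: b_def shift_point_def h_def \<delta>_def)
        ultimately show ?thesis by (metis of_real_diff right_diff_distrib)
      qed
      have "cmod (a - b) \<le> 1 * \<bar>cmod a - (1 - h)\<bar>"
        unfolding ab norm_mult norm_of_real by (intro mult_right_mono) (auto simp: norm_sgn)
      also have "cmod a - (1 - h) = h - \<delta>" by (simp add: \<delta>_def)
      finally show ?thesis using h \<delta>(1) by simp
    qed
    have "1 - cnj b * z = (1 - cnj a * z) + cnj (a - b) * z" by (simp add: algebra_simps)
    also have "cmod \<dots> \<le> D + cmod (cnj (a - b) * z)" unfolding D_def by (rule norm_triangle_ineq)
    also have "cmod (cnj (a - b) * z) = cmod (a - b) * cmod z" by (simp only: norm_mult complex_mod_cnj)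
    also have "cmod (a - b) * cmod z \<le> h * 1" using \<open>cmod (a - b) \<le> h\<close> z h by (intro mult_mono) auto
    finally show ?thesis using k(2) nb' by (simp add: h_def)
  qed
  let ?La = "ln (2 / (1 - cmod a))" and ?Lb = "ln (2 / (1 - cmod b))" and ?\<alpha> = "1 - 1 / p"
  let ?ja = "1 - (cmod (disc_aut a z))\<^sup>2" and ?jb = "1 - (cmod (disc_aut b z))\<^sup>2" and ?R = "Re (log_test p b z)"
  have \<alpha>: "0 \<le> ?\<alpha>" "?\<alpha> \<le> 1" using p by auto
  have Lb: "0 < ?Lb" using b by (intro log_pos) auto
  have Lb2: "ln 2 \<le> ?Lb" using b by (intro log_ge_ln2) auto
  have La: "0 < ?La" using a by (intro log_pos) auto
  \<comment> \<open>\<open>?La\<close> exceeds ln (2 / h) by k ln 2, and both ln (2 / h) and ln 2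
    are at most \<open>?Lb\<close>.\<close>
  have "?La \<le> (1 + real k) * ?Lb"
  proof -
    have "?La = ln 2 - ln \<delta>" using \<delta> by (simp add: \<delta>_def ln_div)
    also have "ln \<delta> = ln h - real k * ln 2" using \<delta>(1) by (simp add: h_def ln_mult ln_realpow)
    finally have "?La = ln 2 - ln h + real k * ln 2" by simp
    also have "ln 2 - ln h \<le> ?Lb"
      using h b by (subst ln_div) auto
    also have "real k * ln 2 \<le> real k * ?Lb" using Lb2 by (intro mult_left_mono) auto
    finally show ?thesis by (simp add: algebra_simps)
  qed
  then have "?La powr (2 * ?\<alpha>) \<le> ((1 + real k) * ?Lb) powr (2 * ?\<alpha>)"
    using La \<alpha> by (intro powr_mono2) auto
  also have "\<dots> = (1 + real k) powr (2 * ?\<alpha>) * ?Lb powr (2 * ?\<alpha>)" by (rule powr_mult)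
  also have "\<dots> \<le> (1 + real k)\<^sup>2 * ?R\<^sup>2"
  proof (rule mult_mono)
    have "(1 + real k) powr (2 * ?\<alpha>) \<le> (1 + real k) powr 2" using \<alpha> by (intro powr_mono) auto
    then show "(1 + real k) powr (2 * ?\<alpha>) \<le> (1 + real k)\<^sup>2" by simp
    have "?Lb powr (2 * ?\<alpha>) = (?Lb powr ?\<alpha>)\<^sup>2"
      unfolding power2_eq_square powr_add[symmetric] by simp
    also have "\<dots> \<le> ?R\<^sup>2" using Re_log_test_ge[OF b z near] by (intro power_mono) auto
    finally show "?Lb powr (2 * ?\<alpha>) \<le> ?R\<^sup>2" .
  qed auto
  finally have L: "?La powr (2 * ?\<alpha>) \<le> (1 + real k)\<^sup>2 * ?R\<^sup>2" .
  have j: "0 < ?ja" "0 < ?jb" by (rule one_minus_disc_aut_pos[OF a z] one_minus_disc_aut_pos[OF b z])+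
  \<comment> \<open>The constant is 2 times 9: 1 - |a|^2 \<le> 2 \<delta>, and the factor 3 of
    \<open>near\<close> is squared. The decay comes from \<delta> / h^2 = 2 powr (- k) / h.\<close>
  have "?ja \<le> 18 * 2 powr (- real k) * ?jb"
  proof -
    define t where "t = 1 - (cmod z)\<^sup>2"
    have t: "0 < t" using one_minus_square_bounds(3)[OF z] by (simp add: t_def)
    have hD: "h\<^sup>2 \<le> D\<^sup>2" using k(1) h by (intro power_mono) (auto simp: h_def)
    have "?ja = (1 - (cmod a)\<^sup>2) * t / D\<^sup>2" unfolding one_minus_disc_aut[OF a z] t_def D_def ..
    also have "\<dots> \<le> 2 * \<delta> * t / h\<^sup>2"
      using one_minus_square_bounds(2)[OF a] hD h t \<delta> by (intro frac_le mult_right_mono) (auto simp: \<delta>_def)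
    also have "\<dots> = 2 * 2 powr (- real k) * (t / h)"
      using \<delta>(1) by (simp add: h_def power2_eq_square powr_minus powr_realpow field_simps)
    also have "\<dots> \<le> 2 * 2 powr (- real k) * (9 * ?jb)"
    proof (rule mult_left_mono)
      have c: "0 < cmod (1 - cnj b * z)" using one_minus_cnj_mult_nz[OF b z] by simp
      have "(cmod (1 - cnj b * z))\<^sup>2 \<le> (3 * (1 - cmod b))\<^sup>2" using near by (intro power_mono) auto
      then have "(1 - cmod b) * t / (3 * (1 - cmod b))\<^sup>2 \<le> (1 - (cmod b)\<^sup>2) * t / (cmod (1 - cnj b * z))\<^sup>2"
        using one_minus_square_bounds(1)[OF b] c t h by (intro frac_le mult_right_mono) auto
      also have "\<dots> = ?jb" unfolding one_minus_disc_aut[OF b z] t_def ..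
      also have "(1 - cmod b) * t / (3 * (1 - cmod b))\<^sup>2 = t / (9 * (1 - cmod b))"
      proof -
        have "x * t / (3 * x)\<^sup>2 = t / (9 * x)" if "x \<noteq> 0" for x using that by (simp add: power2_eq_square)
        from this[of "1 - cmod b"] show ?thesis using h(3) by linarith
      qed
      finally have "t / (9 * (1 - cmod b)) \<le> ?jb" .
      moreover have "t / (9 * h) \<le> t / (9 * (1 - cmod b))" using h t by (intro divide_left_mono) auto
      ultimately have "t / (9 * h) \<le> ?jb" by linarith
      then show "t / h \<le> 9 * ?jb" using h by (simp add: field_simps)
    qed simp
    also have "\<dots> = 18 * 2 powr (- real k) * ?jb" by simp
    finally show ?thesis .
  qed
  then have "?ja powr s \<le> (18 * 2 powr (- real k) * ?jb) powr s" using j s by (intro powr_mono2) auto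
  also have "\<dots> = 18 powr s * 2 powr (- (real k * s)) * ?jb powr s"
    by (simp only: powr_mult powr_powr mult_minus_left)
  finally have J: "?ja powr s \<le> 18 powr s * 2 powr (- (real k * s)) * ?jb powr s" .
  have "?La powr (2 * ?\<alpha>) * ?ja powr s \<le> ((1 + real k)\<^sup>2 * ?R\<^sup>2) * (18 powr s * 2 powr (- (real k * s)) * ?jb powr s)"
    using L J by (intro mult_mono) auto
  also have "\<dots> = 18 powr s * ((1 + real k)\<^sup>2 * 2 powr (- (real k * s))) * (?R\<^sup>2 * ?jb powr s)" by (simp only: mult_ac)
  finally show ?thesis unfolding b_def by (rule that)
qed

text \<open>Half of the exponential decay absorbs the polynomial: 1 + x \<le> exp x at x = k s ln 2
  / 4 gives 1 + k \<le> c 2 powr (k s / 4) with c = 4 / (s ln 2) \<ge> 1. What remains is a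
  geometric sequence.\<close>

lemma dyadic_weight_le:
  assumes s: "0 < s" "s \<le> 1"
  shows "(1 + real k)\<^sup>2 * 2 powr (- (real k * s)) \<le> (4 / (s * ln 2))\<^sup>2 * (2 powr (- s / 2)) ^ k"
proof -
  define c where "c = 4 / (s * ln 2)"
  have ln2: "0 < ln (2::real)" "ln (2::real) \<le> 1" using ln_le_minus_one[of 2] by auto
  have c: "1 \<le> c"
  proof -
    have "s * ln 2 \<le> 1 * 1" using s ln2 by (intro mult_mono) auto
    then show ?thesis using s ln2 by (simp add: c_def field_simps)
  qed
  have "1 + real k \<le> c * (1 + real k * s / 4 * ln 2)"
    using c s ln2 by (simp add: c_def distrib_left)
  also have "\<dots> \<le> c * 2 powr (real k * s / 4)"
  proof (rule mult_left_mono)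
    have "1 + real k * s / 4 * ln 2 \<le> exp (real k * s / 4 * ln 2)" by (rule exp_ge_add_one_self)
    then show "1 + real k * s / 4 * ln 2 \<le> 2 powr (real k * s / 4)" by (simp add: powr_def)
  qed (use c in simp)
  finally have "(1 + real k)\<^sup>2 \<le> (c * 2 powr (real k * s / 4))\<^sup>2" by (intro power_mono) auto
  then have "(1 + real k)\<^sup>2 * 2 powr (- (real k * s)) \<le> (c * 2 powr (real k * s / 4))\<^sup>2 * 2 powr (- (real k * s))"
    by (rule mult_right_mono) simp
  also have "\<dots> = c\<^sup>2 * (2 powr (real k * s / 4) * 2 powr (real k * s / 4) * 2 powr (- (real k * s)))"
    by (simp add: power2_eq_square mult_ac)
  also have "2 powr (real k * s / 4) * 2 powr (real k * s / 4) * 2 powr (- (real k * s)) = 2 powr (- s / 2 * real k)"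
    by (simp flip: powr_add)
  also have "\<dots> = (2 powr (- s / 2)) ^ k"
    by (simp only: powr_powr[symmetric]) (simp add: powr_realpow)
  finally show ?thesis by (simp add: c_def)
qed

section \<open>Necessity and sufficiency of the logarithmic condition\<close>

lemma Q_log_space_iff:
  "f \<in> Q_log_space s \<alpha> \<longleftrightarrow> f holomorphic_on unit_disc \<and>
    (\<exists>K\<ge>0. \<forall>a. cmod a < 1 \<longrightarrow> ennreal (ln (2 / (1 - cmod a)) powr (2 * \<alpha>)) * (\<integral>\<^sup>+ z. Q_density s f a z \<partial>area_measure) \<le> ennreal K)"
  unfolding Q_log_space_def mem_Collect_eq SUP_less_top_iff_bounded analytic_on_open[OF open_ball] Ball_def mem_ball_0 ..

text \<open>\<open>log_weight_le\<close> dominates the weight at a by a term belonging to one point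
  of the radius. Integration and the uniform bound for the test functions leave a geometric
  series.\<close>

lemma maps_into_imp_Q_log_space:
  assumes s: "0 < s" "s \<le> 1" and g: "g holomorphic_on unit_disc" and p: "1 < p"
    and maps: "maps_into (T_op g) (besov p) (Q_space s)"
  shows "g \<in> Q_log_space s (1 - 1 / p)"
proof -
  let ?W = "\<lambda>b z. ennreal ((Re (log_test p b z))\<^sup>2) * Q_density s g b z"
  have [measurable]: "deriv g \<in> borel_measurable area_measure"
    by (intro borel_measurable_area_measure_holomorphic holomorphic_deriv g open_ball)
  have mG: "Q_density s g b \<in> borel_measurable area_measure" for b
    unfolding disc_aut_def by measurable
  have mW: "?W b \<in> borel_measurable area_measure" if b: "cmod b < 1" for b
  proof -
    have [measurable]: "log_test p b \<in> borel_measurable area_measure"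
      by (intro borel_measurable_area_measure_holomorphic holomorphic_on_log_test b)
    show ?thesis by (intro borel_measurable_times_ennreal mG) measurable
  qed
  obtain K where K: "0 \<le> K" "\<And>b. cmod b < 1 \<Longrightarrow> (\<integral>\<^sup>+ z. ?W b z \<partial>area_measure) \<le> ennreal K"
    by (rule log_test_uniform_bound[OF s g p maps]) (rule that)
  define q where "q = 2 powr (- s / 2)"
  have q: "0 \<le> q" "q < 1"
  proof -
    have "2 powr (- s / 2) < 2 powr (0::real)" using s by (intro powr_less_mono) auto
    then show "0 \<le> q" "q < 1" by (simp_all add: q_def)
  qed
  define c where "c = 18 powr s * (4 / (s * ln 2))\<^sup>2"
  have c: "0 \<le> c" by (simp add: c_def)
  have "ennreal (ln (2 / (1 - cmod a)) powr (2 * (1 - 1 / p))) * (\<integral>\<^sup>+ z. Q_density s g a z \<partial>area_measure) \<le> ennreal (c * (1 / (1 - q)) * K)" if a: "cmod a < 1" for a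
  proof -
    let ?b = "shift_point a" and ?L = "ln (2 / (1 - cmod a)) powr (2 * (1 - 1 / p))"
    have b: "cmod (?b k) < 1" for k by (rule cmod_shift_point_less[OF a])
    have "ennreal ?L * (\<integral>\<^sup>+ z. Q_density s g a z \<partial>area_measure) = (\<integral>\<^sup>+ z. ennreal ?L * Q_density s g a z \<partial>area_measure)"
      by (rule nn_integral_cmult[OF mG, symmetric])
    also have "\<dots> \<le> (\<integral>\<^sup>+ z. (\<Sum>k. ennreal (c * q ^ k) * ?W (?b k) z) \<partial>area_measure)"
    proof (rule nn_integral_mono)
      fix z assume "z \<in> space area_measure"
      then have z: "cmod z < 1" by simp
      obtain k where k: "?L * (1 - (cmod (disc_aut a z))\<^sup>2) powr s
        \<le> 18 powr s * ((1 + real k)\<^sup>2 * 2 powr (- (real k * s))) * ((Re (log_test p (?b k) z))\<^sup>2 * (1 - (cmod (disc_aut (?b k) z))\<^sup>2) powr s)"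
        using log_weight_le[OF a z s(1) p] .
      let ?r = "(Re (log_test p (?b k) z))\<^sup>2" and ?j = "(1 - (cmod (disc_aut (?b k) z))\<^sup>2) powr s"
      note k
      also have "18 powr s * ((1 + real k)\<^sup>2 * 2 powr (- (real k * s))) * (?r * ?j) \<le> 18 powr s * ((4 / (s * ln 2))\<^sup>2 * q ^ k) * (?r * ?j)"
        unfolding q_def by (intro mult_right_mono mult_left_mono dyadic_weight_le s) auto
      finally have "(cmod (deriv g z))\<^sup>2 * (?L * (1 - (cmod (disc_aut a z))\<^sup>2) powr s) \<le> (cmod (deriv g z))\<^sup>2 * (18 powr s * ((4 / (s * ln 2))\<^sup>2 * q ^ k) * (?r * ?j))"
        by (rule mult_left_mono) simp
      then have "?L * ((cmod (deriv g z))\<^sup>2 * (1 - (cmod (disc_aut a z))\<^sup>2) powr s) \<le> c * q ^ k * (?r * ((cmod (deriv g z))\<^sup>2 * ?j))"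
        unfolding c_def by (simp only: mult_ac)
      then have "ennreal (?L * ((cmod (deriv g z))\<^sup>2 * (1 - (cmod (disc_aut a z))\<^sup>2) powr s)) \<le> ennreal (c * q ^ k * (?r * ((cmod (deriv g z))\<^sup>2 * ?j)))"
        by (rule ennreal_leI)
      moreover have "ennreal (?L * ((cmod (deriv g z))\<^sup>2 * (1 - (cmod (disc_aut a z))\<^sup>2) powr s)) = ennreal ?L * Q_density s g a z"
        by (rule ennreal_mult') simp
      moreover have "ennreal (c * q ^ k * (?r * ((cmod (deriv g z))\<^sup>2 * ?j))) = ennreal (c * q ^ k) * ?W (?b k) z"
        using c q by (subst ennreal_mult', simp) (subst ennreal_mult', simp_all)
      ultimately have "ennreal ?L * Q_density s g a z \<le> ennreal (c * q ^ k) * ?W (?b k) z" by (simp only:)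
      \<comment> \<open>The scale k depends on z, so before integration the term is enlarged to the
        sum over all scales.\<close>
      also have "\<dots> = sum (\<lambda>k. ennreal (c * q ^ k) * ?W (?b k) z) {k}" by simp
      also have "\<dots> \<le> (\<Sum>k. ennreal (c * q ^ k) * ?W (?b k) z)" by (rule sum_le_suminf) auto
      finally show "ennreal ?L * Q_density s g a z \<le> (\<Sum>k. ennreal (c * q ^ k) * ?W (?b k) z)" .
    qed
    also have "\<dots> = (\<Sum>k. \<integral>\<^sup>+ z. ennreal (c * q ^ k) * ?W (?b k) z \<partial>area_measure)"
      by (intro nn_integral_suminf borel_measurable_times_ennreal[OF _ mW[OF b]]) simp
    also have "\<dots> = (\<Sum>k. ennreal (c * q ^ k) * (\<integral>\<^sup>+ z. ?W (?b k) z \<partial>area_measure))"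
      by (intro suminf_cong nn_integral_cmult mW b)
    also have "\<dots> \<le> (\<Sum>k. ennreal (c * q ^ k) * ennreal K)"
      by (intro suminf_le mult_left_mono K(2) b) auto
    also have "\<dots> = (\<Sum>k. ennreal (c * q ^ k)) * ennreal K" by (rule ennreal_suminf_multc)
    also have "(\<Sum>k. ennreal (c * q ^ k)) = ennreal (c * (1 / (1 - q)))"
    proof -
      have "(\<lambda>k. c * q ^ k) sums (c * (1 / (1 - q)))" using q by (intro sums_mult geometric_sums) auto
      then show ?thesis using c q by (subst suminf_ennreal2) (auto simp: sums_iff)
    qed
    also have "\<dots> * ennreal K = ennreal (c * (1 / (1 - q)) * K)"
      using c q by (intro ennreal_mult'[symmetric]) auto
    finally show ?thesis .
  qed
  moreover have "0 \<le> c * (1 / (1 - q)) * K" using c q K(1) by simp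
  ultimately show ?thesis unfolding Q_log_space_iff using g by blast
qed

text \<open>The square of the growth bound for f a is matched exactly by the logarithmic factor in
  the condition on g. For the oscillation f - f a the plain Q_s bound of g suffices.\<close>

lemma Q_log_space_imp_maps_into:
  assumes s: "0 < s" "s \<le> 1" and p: "1 < p" and sp: "1 - 2 / p < s"
    and Q: "g \<in> Q_log_space s (1 - 1 / p)"
  shows "maps_into (T_op g) (besov p) (Q_space s)"
proof -
  let ?L = "\<lambda>a. ln (2 / (1 - cmod a))" and ?\<alpha> = "1 - 1 / p"
  have g: "g holomorphic_on unit_disc" using Q by (simp add: Q_log_space_iff)
  obtain K where K: "0 \<le> K" "\<And>a. cmod a < 1 \<Longrightarrow> ennreal (?L a powr (2 * ?\<alpha>)) * (\<integral>\<^sup>+ z. Q_density s g a z \<partial>area_measure) \<le> ennreal K"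
    using Q unfolding Q_log_space_iff by blast
  have [measurable]: "deriv g \<in> borel_measurable area_measure"
    by (intro borel_measurable_area_measure_holomorphic holomorphic_deriv g open_ball)
  have mG: "Q_density s g b \<in> borel_measurable area_measure" for b
    unfolding disc_aut_def by measurable
  define c where "c = ln (2::real) powr (2 * ?\<alpha>)"
  have c: "0 < c" by (simp add: c_def)
  \<comment> \<open>The logarithm is at least ln 2, so the logarithmic condition contains the plain
    one.\<close>
  have GM: "(\<integral>\<^sup>+ z. Q_density s g a z \<partial>area_measure) \<le> ennreal (1 / c * K)" if a: "cmod a < 1" for a
  proof -
    have "c \<le> ?L a powr (2 * ?\<alpha>)"
      unfolding c_def using a p by (intro powr_mono2 log_ge_ln2) (auto simp: field_simps)
    then have "ennreal c * (\<integral>\<^sup>+ z. Q_density s g a z \<partial>area_measure) \<le> ennreal (?L a powr (2 * ?\<alpha>)) * (\<integral>\<^sup>+ z. Q_density s g a z \<partial>area_measure)"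
      by (intro mult_right_mono ennreal_leI) auto
    also have "\<dots> \<le> ennreal K" by (rule K(2)[OF a])
    finally have "ennreal (1 / c) * (ennreal c * (\<integral>\<^sup>+ z. Q_density s g a z \<partial>area_measure)) \<le> ennreal (1 / c) * ennreal K"
      by (rule mult_left_mono) simp
    moreover have "ennreal (1 / c) * ennreal c = 1" using c by (simp flip: ennreal_mult')
    moreover have "ennreal (1 / c) * ennreal K = ennreal (1 / c * K)" using c by (intro ennreal_mult'[symmetric]) simp
    ultimately show ?thesis by (simp only: mult.assoc[symmetric] mult_1)
  qed
  show ?thesis unfolding maps_into_def
  proof (intro subsetI, elim imageE)
    fix h f assume h: "h = T_op g f" and f: "f \<in> besov p"
    have fh: "f holomorphic_on unit_disc"
      and fin: "besov_integral p f < \<infinity>"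
      using f p by (simp_all add: besov_def analytic_on_open)
    have mf: "f \<in> borel_measurable area_measure" by (rule borel_measurable_area_measure_holomorphic[OF fh])
    obtain M where M: "0 \<le> M" "\<And>z. cmod z < 1 \<Longrightarrow> cmod (f z) \<le> M * ?L z powr ?\<alpha>"
      by (rule besov_growth[OF fh p fin]) (rule that)
    have "0 \<le> 1 / c * K" using c K(1) by simp
    from oscillation_embedding[OF fh g p s(1) sp this fin GM]
    obtain C where C: "0 \<le> C" "\<And>a. cmod a < 1 \<Longrightarrow> (\<integral>\<^sup>+ z. ennreal ((cmod (f z - f a))\<^sup>2) * Q_density s g a z \<partial>area_measure) \<le> ennreal C"
      by blast
    have "(\<integral>\<^sup>+ z. ennreal ((cmod (f z))\<^sup>2) * Q_density s g a z \<partial>area_measure) \<le> ennreal (2 * M\<^sup>2 * K + 2 * C)" if a: "cmod a < 1" for a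
    proof -
      have mo: "(\<lambda>z. ennreal ((cmod (f z - f a))\<^sup>2) * Q_density s g a z) \<in> borel_measurable area_measure"
        by (intro borel_measurable_times_ennreal mG) (use mf in measurable)
      have "(\<integral>\<^sup>+ z. ennreal ((cmod (f z))\<^sup>2) * Q_density s g a z \<partial>area_measure)
        \<le> (\<integral>\<^sup>+ z. ennreal (2 * (cmod (f a))\<^sup>2) * Q_density s g a z + ennreal 2 * (ennreal ((cmod (f z - f a))\<^sup>2) * Q_density s g a z) \<partial>area_measure)"
      proof (rule nn_integral_mono)
        fix z
        have "(cmod (f z))\<^sup>2 \<le> (cmod (f a) + cmod (f z - f a))\<^sup>2"
          by (intro power_mono norm_triangle_sub) simp
        also have "\<dots> \<le> 2 * (cmod (f a))\<^sup>2 + 2 * (cmod (f z - f a))\<^sup>2"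
          using sum_squares_bound[of "cmod (f a)" "cmod (f z - f a)"] by (simp add: power2_sum)
        finally have "ennreal ((cmod (f z))\<^sup>2) \<le> ennreal (2 * (cmod (f a))\<^sup>2 + 2 * (cmod (f z - f a))\<^sup>2)" by (rule ennreal_leI)
        also have "\<dots> = ennreal (2 * (cmod (f a))\<^sup>2) + ennreal 2 * ennreal ((cmod (f z - f a))\<^sup>2)"
          by (subst ennreal_plus) (simp_all add: ennreal_mult')
        finally have "ennreal ((cmod (f z))\<^sup>2) * Q_density s g a z \<le> (ennreal (2 * (cmod (f a))\<^sup>2) + ennreal 2 * ennreal ((cmod (f z - f a))\<^sup>2)) * Q_density s g a z"
          by (rule mult_right_mono) simp
        then show "ennreal ((cmod (f z))\<^sup>2) * Q_density s g a z \<le> ennreal (2 * (cmod (f a))\<^sup>2) * Q_density s g a z + ennreal 2 * (ennreal ((cmod (f z - f a))\<^sup>2) * Q_density s g a z)"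
          by (simp only: distrib_right mult.assoc)
      qed
      also have "\<dots> = ennreal (2 * (cmod (f a))\<^sup>2) * (\<integral>\<^sup>+ z. Q_density s g a z \<partial>area_measure) + ennreal 2 * (\<integral>\<^sup>+ z. ennreal ((cmod (f z - f a))\<^sup>2) * Q_density s g a z \<partial>area_measure)"
        using mG[of a] mo by (subst nn_integral_add) (simp_all only: nn_integral_cmult borel_measurable_times_ennreal borel_measurable_const)
      also have "\<dots> \<le> ennreal (2 * M\<^sup>2) * ennreal K + ennreal 2 * ennreal C"
      proof (intro add_mono mult_left_mono C(2) a)
        have "(cmod (f a))\<^sup>2 \<le> (M * ?L a powr ?\<alpha>)\<^sup>2" using M(2)[OF a] by (rule power_mono) simp
        also have "\<dots> = M\<^sup>2 * ?L a powr (2 * ?\<alpha>)"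
          unfolding power_mult_distrib power2_eq_square[of "_ powr _"] powr_add[symmetric] by simp
        finally have "ennreal (2 * (cmod (f a))\<^sup>2) \<le> ennreal (2 * M\<^sup>2 * ?L a powr (2 * ?\<alpha>))" by (intro ennreal_leI) simp
        also have "\<dots> = ennreal (2 * M\<^sup>2) * ennreal (?L a powr (2 * ?\<alpha>))" by (rule ennreal_mult') simp
        finally have "ennreal (2 * (cmod (f a))\<^sup>2) * (\<integral>\<^sup>+ z. Q_density s g a z \<partial>area_measure) \<le> ennreal (2 * M\<^sup>2) * ennreal (?L a powr (2 * ?\<alpha>)) * (\<integral>\<^sup>+ z. Q_density s g a z \<partial>area_measure)"
          by (rule mult_right_mono) simp
        also have "\<dots> \<le> ennreal (2 * M\<^sup>2) * ennreal K"
          unfolding mult.assoc using K(2)[OF a] by (rule mult_left_mono) simp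
        finally show "ennreal (2 * (cmod (f a))\<^sup>2) * (\<integral>\<^sup>+ z. Q_density s g a z \<partial>area_measure) \<le> ennreal (2 * M\<^sup>2) * ennreal K" .
      qed simp
      also have "\<dots> = ennreal (2 * M\<^sup>2 * K + 2 * C)"
        using K(1) C(1) by (intro ennreal_lincomb[symmetric]) auto
      finally show ?thesis .
    qed
    moreover have "0 \<le> 2 * M\<^sup>2 * K + 2 * C" using K(1) C(1) by simp
    ultimately show "h \<in> Q_space s" unfolding h T_op_Q_space_iff[OF s g fh] by blast
  qed
qed

text \<open>The constant 1 lies in B^1, and its image under \<open>T_op g\<close> has derivative g'.
  Conversely, functions in B^1 are bounded, and a bounded factor preserves the condition on
  g.\<close>

lemma maps_into_besov_1_iff:
  assumes s: "0 < s" "s \<le> 1" and g: "g holomorphic_on unit_disc"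
  shows "maps_into (T_op g) (besov 1) (Q_space s) \<longleftrightarrow> g \<in> Q_space s"
proof
  assume maps: "maps_into (T_op g) (besov 1) (Q_space s)"
  have "deriv (\<lambda>z. 1 :: complex) = (\<lambda>z. 0)" by (intro ext) simp
  then have "deriv (deriv (\<lambda>z. 1 :: complex)) = (\<lambda>z. 0)" by (intro ext) simp
  then have "(\<lambda>z. 1) \<in> besov 1" by (simp add: besov_def)
  then have "T_op g (\<lambda>z. 1) \<in> Q_space s" using maps by (auto simp: maps_into_def)
  then have "\<exists>K\<ge>0. \<forall>a. cmod a < 1 \<longrightarrow> (\<integral>\<^sup>+ z. Q_density s g a z \<partial>area_measure) \<le> ennreal K"
    unfolding T_op_Q_space_iff[OF s g holomorphic_on_const]
    by simp
  then show "g \<in> Q_space s" unfolding Q_space_iff[OF s] using g by blast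
next
  assume "g \<in> Q_space s"
  then obtain K where K: "0 \<le> K" "\<And>a. cmod a < 1 \<Longrightarrow> (\<integral>\<^sup>+ z. Q_density s g a z \<partial>area_measure) \<le> ennreal K"
    unfolding Q_space_iff[OF s] by blast
  have [measurable]: "deriv g \<in> borel_measurable area_measure"
    by (intro borel_measurable_area_measure_holomorphic holomorphic_deriv g open_ball)
  have mG: "Q_density s g b \<in> borel_measurable area_measure" for b
    unfolding disc_aut_def by measurable
  show "maps_into (T_op g) (besov 1) (Q_space s)" unfolding maps_into_def
  proof (intro subsetI, elim imageE)
    fix h f assume h: "h = T_op g f" and f: "f \<in> besov 1"
    have fh: "f holomorphic_on unit_disc"
      and fin: "(\<integral>\<^sup>+ z. ennreal (cmod (deriv (deriv f) z)) \<partial>area_measure) < \<infinity>"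
      using f by (simp_all add: besov_def analytic_on_open)
    obtain M where M: "\<And>z. cmod z < 1 \<Longrightarrow> cmod (f z) \<le> M"
      by (rule bounded_if_second_deriv_integrable[OF fh fin]) (rule that)
    have "(\<integral>\<^sup>+ z. ennreal ((cmod (f z))\<^sup>2) * Q_density s g a z \<partial>area_measure) \<le> ennreal (M\<^sup>2 * K)" if a: "cmod a < 1" for a
    proof -
      have "(\<integral>\<^sup>+ z. ennreal ((cmod (f z))\<^sup>2) * Q_density s g a z \<partial>area_measure) \<le> (\<integral>\<^sup>+ z. ennreal (M\<^sup>2) * Q_density s g a z \<partial>area_measure)"
        using M by (intro nn_integral_mono mult_right_mono ennreal_leI power_mono) auto
      also have "\<dots> = ennreal (M\<^sup>2) * (\<integral>\<^sup>+ z. Q_density s g a z \<partial>area_measure)" by (rule nn_integral_cmult[OF mG])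
      also have "\<dots> \<le> ennreal (M\<^sup>2) * ennreal K" using K(2)[OF a] by (rule mult_left_mono) simp
      also have "\<dots> = ennreal (M\<^sup>2 * K)" by (rule ennreal_mult'[symmetric]) simp
      finally show ?thesis .
    qed
    moreover have "0 \<le> M\<^sup>2 * K" using K(1) by simp
    ultimately show "h \<in> Q_space s" unfolding h T_op_Q_space_iff[OF s g fh] by blast
  qed
qed

theorem theorem2p4:
  fixes s :: real and g :: "complex \<Rightarrow> complex"
  assumes "0 < s" and "s \<le> 1" and "g analytic_on unit_disc"
  shows "(maps_into (T_op g) (besov 1) (Q_space s) \<longleftrightarrow> g \<in> Q_space s) \<and>
    (\<forall>p p' :: real. 1 < p \<and> 1 / p + 1 / p' = 1 \<longrightarrow>
       (maps_into (T_op g) (besov p) (Q_space s) \<longrightarrow> g \<in> Q_log_space s (1 / p'))) \<and>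
    (\<forall>p p' :: real. 1 < p \<and> 1 / p + 1 / p' = 1 \<longrightarrow>
       (maps_into (T_op g) (besov p) (Q_space 1) \<longleftrightarrow> g \<in> Q_log_space 1 (1 / p'))) \<and>
    (\<forall>p p' :: real. 2 < p \<and> 1 / p + 1 / p' = 1 \<and> s < 1 \<and> 1 - 2 / p < s \<longrightarrow>
       (maps_into (T_op g) (besov p) (Q_space s) \<longleftrightarrow> g \<in> Q_log_space s (1 / p')))"
proof -
  note s = assms(1,2)
  have g: "g holomorphic_on unit_disc" using assms(3) by (simp add: analytic_on_open)
  have p': "1 / p' = 1 - 1 / p" if "1 / p + 1 / p' = 1" for p p' :: real using that by linarith
  \<comment> \<open>Both equivalences for p > 1 are instances: for t = 1 the last hypothesis reads 0
    < 2 / p.\<close>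
  have conv: "maps_into (T_op g) (besov p) (Q_space t) \<longleftrightarrow> g \<in> Q_log_space t (1 / p')"
    if "1 < p" "1 / p + 1 / p' = 1" "0 < t" "t \<le> 1" "1 - 2 / p < t" for p p' t :: real
    unfolding p'[OF that(2)]
    using maps_into_imp_Q_log_space[OF that(3,4) g that(1)] Q_log_space_imp_maps_into[OF that(3,4,1,5)] ..
  show ?thesis
  proof (intro conjI allI impI)
    show "maps_into (T_op g) (besov 1) (Q_space s) \<longleftrightarrow> g \<in> Q_space s"
      by (rule maps_into_besov_1_iff[OF s g])
  next
    fix p p' :: real
    assume p: "1 < p \<and> 1 / p + 1 / p' = 1" and "maps_into (T_op g) (besov p) (Q_space s)"
    then show "g \<in> Q_log_space s (1 / p')"
      unfolding p'[OF conjunct2[OF p]] by (intro maps_into_imp_Q_log_space[OF s g]) auto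
  next
    fix p p' :: real
    assume p: "1 < p \<and> 1 / p + 1 / p' = 1"
    then show "maps_into (T_op g) (besov p) (Q_space 1) \<longleftrightarrow> g \<in> Q_log_space 1 (1 / p')"
      by (intro conv) auto
  next
    fix p p' :: real
    assume p: "2 < p \<and> 1 / p + 1 / p' = 1 \<and> s < 1 \<and> 1 - 2 / p < s"
    then show "maps_into (T_op g) (besov p) (Q_space s) \<longleftrightarrow> g \<in> Q_log_space s (1 / p')"
      using s by (intro conv) auto
  qed
qed

end
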